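(* Let $A$ be a $C^*$-algebra, let $I \subseteq A$ be a (two-sided, not necessarily norm-closed) ideal, and let $J := \operatorname{int}_D(I)$ and $K := \operatorname{cl}_D(I)$ denote the Dixmier interior and the Dixmier closure of $I$, respectively. Then \[ \sqrt{I} = \sqrt{J} = \sqrt{K} = \bigcup_{n=1}^{\infty} J^{\frac{1}{n}} = \bigcup_{n=1}^{\infty} K^{\frac{1}{n}} = \{ x \in A : (x^*x)^n \in I_+ \text{ for some } n \geq 1 \} = \{ x \in A : (xx^* )^n \in I_+ \text{ for some } n \geq 1 \}. \] In particular, $\sqrt{I}$ is the union of the increasing sequence of ideals $(J^{\frac{1}{n}})_{n \geq 1}$, all of which are radical over $I$.
   Context: $C^*$-algebras are not assumed unital, and $A_+$ denotes the set of positive elements of $A$. An ideal in $A$ is an additive subgroup $I \subseteq A$ with $aI \cup Ia \subseteq I$ for all $a \in A$; it is not assumed norm-closed, self-adjoint, or closed under complex scalars. Put $I_+ := I \cap A_+$. For ideals $L,L'$, $LL'$ is the additive subgroup generated by $\{xy : x \in L, y \in L'\}$. An ideal $P$ is prime if $P \neq A$ and for all ideals $L,L' \subseteq A$, $LL' \subseteq P$ implies $L \subseteq P$ or $L' \subseteq P$. The semiprime closure $\sqrt{I}$ of an ideal $I$ is the intersection of all prime ideals of $A$ containing $I$, with $\sqrt{I} = A$ if there are none. An order ideal in $A_+$ is an additive submonoid $M \subseteq A_+$ such that $a,b \in A_+$, $a \leq b$ and $b \in M$ imply $a \in M$; it is strongly invariant if for all $x \in A$, $x^*x \in M$ if and only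 if $xx^* \in M$. A Dixmier ideal in $A$ is a two-sided ideal $I$ (not necessarily norm-closed) that is positively spanned ($I$ is the complex linear span of $I_+$), hereditary ($I_+$ is an order ideal), and such that $I_+$ is strongly invariant. For a Dixmier ideal $L$ and $s \in (0,\infty)$, $L^s$ is the complex linear span of $\{a^s : a \in L_+\}$. For any ideal $I \subseteq A$, the Dixmier interior $\operatorname{int}_D(I)$ is the sum (set of finite sums of elements of the union) of all Dixmier ideals of $A$ contained in $I$, and the Dixmier closure $\operatorname{cl}_D(I)$ is the intersection of all Dixmier ideals of $A$ containing $I$; these are themselves Dixmier ideals. An ideal $L \subseteq A$ is radical over $I$ if for every $x \in L$ there exists $n \geq 1$ with $x^n \in I$. *)

theory Defs
  imports "HOL-Analysis.Analysis" "HOL-Computational_Algebra.Polynomial"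
begin

class cstar_algebra = real_normed_algebra + complete_space +
  fixes scaleC :: "complex \<Rightarrow> 'a \<Rightarrow> 'a" (infixr "*\<^sub>C" 75)
    and star :: "'a \<Rightarrow> 'a"
  assumes scaleC_add_right: "c *\<^sub>C (x + y) = c *\<^sub>C x + c *\<^sub>C y"
    and scaleC_add_left: "(c + d) *\<^sub>C x = c *\<^sub>C x + d *\<^sub>C x"
    and scaleC_scaleC: "c *\<^sub>C (d *\<^sub>C x) = (c * d) *\<^sub>C x"
    and scaleC_of_real: "complex_of_real r *\<^sub>C x = r *\<^sub>R x"
    and mult_scaleC_left: "(c *\<^sub>C x) * y = c *\<^sub>C (x * y)"
    and mult_scaleC_right: "x * (c *\<^sub>C y) = c *\<^sub>C (x * y)"
    and norm_scaleC: "norm (c *\<^sub>C x) = cmod c * norm x"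
    and star_add: "star (x + y) = star x + star y"
    and star_scaleC: "star (c *\<^sub>C x) = cnj c *\<^sub>C star x"
    and star_mult: "star (x * y) = star y * star x"
    and star_star: "star (star x) = x"
    and cstar_identity: "norm (star x * x) = (norm x)\<^sup>2"

global_interpretation complex_vector:
  vector_space "scaleC :: complex \<Rightarrow> 'a \<Rightarrow> 'a::cstar_algebra"
  defines complex_span = complex_vector.span
  by unfold_locales
    (auto simp: scaleC_add_right scaleC_add_left scaleC_scaleC
       scaleC_of_real[of 1, simplified])

text \<open>The power \<open>x\<^sup>n\<close> for \<open>n \<ge> 1\<close> only, as there need not be a unit;
  the value at \<open>n = 0\<close> is junk.\<close>

definition npow :: "'a::cstar_algebra \<Rightarrow> nat \<Rightarrow> 'a" where
  "npow x n = (((*) x) ^^ (n - 1)) x"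

text \<open>The unitization is \<open>\<complex> \<times> A\<close> with unit \<open>(1, 0)\<close>. It is used even if \<open>A\<close>
  already has a unit, which changes the spectrum at most by adjoining \<open>0\<close>; neither
  positivity nor the calculus for functions vanishing at \<open>0\<close> is affected.\<close>

definition unitization_mult ::
    "complex \<times> 'a \<Rightarrow> complex \<times> 'a \<Rightarrow> complex \<times> 'a::cstar_algebra" where
  "unitization_mult u v =
     (fst u * fst v, fst u *\<^sub>C snd v + fst v *\<^sub>C snd u + snd u * snd v)"

definition unitization_invertible :: "complex \<times> 'a::cstar_algebra \<Rightarrow> bool" where
  "unitization_invertible u \<longleftrightarrow>
     (\<exists>v. unitization_mult u v = (1, 0) \<and> unitization_mult v u = (1, 0))"

definition spectrum :: "'a::cstar_algebra \<Rightarrow> complex set" where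
  "spectrum a = {z. \<not> unitization_invertible (z, - a)}"

definition positives :: "'a::cstar_algebra set" where
  "positives = {a. star a = a \<and> spectrum a \<subseteq> \<real>\<^sub>\<ge>\<^sub>0}"

definition cstar_le :: "'a::cstar_algebra \<Rightarrow> 'a \<Rightarrow> bool" where
  "cstar_le a b \<longleftrightarrow> b - a \<in> positives"

text \<open>The constant coefficient of \<open>p\<close> is ignored; only used when it vanishes.\<close>

definition poly_eval :: "real poly \<Rightarrow> 'a::cstar_algebra \<Rightarrow> 'a" where
  "poly_eval p a = (\<Sum>i = 1..degree p. coeff p i *\<^sub>R npow a i)"

text \<open>Continuous functional calculus of a self-adjoint \<open>a\<close> (whose spectrum is real), for
  \<open>f\<close> continuous on the spectrum with \<open>f 0 = 0\<close>: the common limit of \<open>p\<^sub>k(a)\<close> over all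
  sequences of polynomials \<open>p\<^sub>k\<close> without constant term converging to \<open>f\<close> uniformly on
  the spectrum.\<close>

definition cfc :: "(real \<Rightarrow> real) \<Rightarrow> 'a::cstar_algebra \<Rightarrow> 'a" where
  "cfc f a = (THE b. \<forall>p :: nat \<Rightarrow> real poly.
     (\<forall>k. coeff (p k) 0 = 0) \<and>
     uniform_limit {t. complex_of_real t \<in> spectrum a} (\<lambda>k. poly (p k)) f sequentially
     \<longrightarrow> (\<lambda>k. poly_eval (p k) a) \<longlonglongrightarrow> b)"

text \<open>Intended for positive \<open>a\<close> and \<open>s > 0\<close>; note that \<open>0 powr s = 0\<close>.\<close>

definition cstar_powr :: "'a::cstar_algebra \<Rightarrow> real \<Rightarrow> 'a" where
  "cstar_powr a s = cfc (\<lambda>t. t powr s) a"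

definition additive_subgroup :: "'a::cstar_algebra set \<Rightarrow> bool" where
  "additive_subgroup H \<longleftrightarrow> 0 \<in> H \<and> (\<forall>x\<in>H. \<forall>y\<in>H. x - y \<in> H)"

text \<open>Not required to be norm-closed, self-adjoint or stable under complex scalars.\<close>

definition alg_ideal :: "'a::cstar_algebra set \<Rightarrow> bool" where
  "alg_ideal I \<longleftrightarrow> additive_subgroup I \<and> (\<forall>a. \<forall>x\<in>I. a * x \<in> I \<and> x * a \<in> I)"

definition ideal_prod :: "'a::cstar_algebra set \<Rightarrow> 'a set \<Rightarrow> 'a set" where
  "ideal_prod L L' = additive_subgroup hull {x * y | x y. x \<in> L \<and> y \<in> L'}"

definition prime_ideal :: "'a::cstar_algebra set \<Rightarrow> bool" where
  "prime_ideal P \<longleftrightarrow> alg_ideal P \<and> P \<noteq> UNIV \<and>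
     (\<forall>L L'. alg_ideal L \<and> alg_ideal L' \<and> ideal_prod L L' \<subseteq> P \<longrightarrow> L \<subseteq> P \<or> L' \<subseteq> P)"

definition semiprime_closure :: "'a::cstar_algebra set \<Rightarrow> 'a set" where
  "semiprime_closure I = \<Inter>{P. prime_ideal P \<and> I \<subseteq> P}"

definition radical_over :: "'a::cstar_algebra set \<Rightarrow> 'a set \<Rightarrow> bool" where
  "radical_over L I \<longleftrightarrow> (\<forall>x\<in>L. \<exists>n\<ge>1. npow x n \<in> I)"

definition order_ideal :: "'a::cstar_algebra set \<Rightarrow> bool" where
  "order_ideal M \<longleftrightarrow> M \<subseteq> positives \<and> 0 \<in> M \<and> (\<forall>a\<in>M. \<forall>b\<in>M. a + b \<in> M) \<and>
     (\<forall>a\<in>positives. \<forall>b\<in>positives. cstar_le a b \<and> b \<in> M \<longrightarrow> a \<in> M)"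

definition strongly_invariant :: "'a::cstar_algebra set \<Rightarrow> bool" where
  "strongly_invariant M \<longleftrightarrow> (\<forall>x. star x * x \<in> M \<longleftrightarrow> x * star x \<in> M)"

definition dixmier_ideal :: "'a::cstar_algebra set \<Rightarrow> bool" where
  "dixmier_ideal I \<longleftrightarrow> alg_ideal I \<and> I = complex_span (I \<inter> positives) \<and>
     order_ideal (I \<inter> positives) \<and> strongly_invariant (I \<inter> positives)"

definition ideal_powr :: "'a::cstar_algebra set \<Rightarrow> real \<Rightarrow> 'a set" where
  "ideal_powr L s = complex_span {cstar_powr a s | a. a \<in> L \<inter> positives}"

definition dixmier_interior :: "'a::cstar_algebra set \<Rightarrow> 'a set" where
  "dixmier_interior I = {sum_list xs | xs. set xs \<subseteq> \<Union>{L. dixmier_ideal L \<and> L \<subseteq> I}}"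

definition dixmier_closure :: "'a::cstar_algebra set \<Rightarrow> 'a set" where
  "dixmier_closure I = \<Inter>{L. dixmier_ideal L \<and> I \<subseteq> L}"

end

theory Submission
  imports Defs "HOL-Computational_Algebra.Fundamental_Theorem_Algebra"
begin

text \<open>The key point is that \<open>e\<^sup>3 \<in> I\<close> implies \<open>e\<^sup>2 A e\<^sup>2 \<subseteq> I\<close> for positive \<open>e\<close> and every ideal \<open>I\<close>,
  because the equation \<open>e\<^sup>2 q e\<^sup>2 = e\<^sup>3 r + r' e\<^sup>3\<close> can be solved for \<open>r, r'\<close> by a norm-convergent
  series. Hence prime ideals are closed under roots of positive elements, and since an ideal that is
  maximal among those avoiding all powers of an element is prime, \<open>\<surd>I\<close> consists of the \<open>x\<close> with
  \<open>(x\<^sup>* x)\<^sup>n \<in> I\<close> for some \<open>n\<close>. This set is itself a Dixmier ideal, so it contains the Dixmier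
  closure of \<open>I\<close>. Conversely, if \<open>e\<^sup>2 \<in> I\<close>, then the Dixmier ideal generated by \<open>e\<^sup>4\<close> lies in \<open>I\<close>,
  so the Dixmier interior contains a power of every positive element of \<open>\<surd>I\<close>. That
  \<open>J\<^sup>1\<^sup>/\<^sup>n\<close> is an ideal follows from the Loewner--Heinz inequality for dyadic exponents and the
  fact that \<open>{a. a\<^sup>2 \<in> J}\<close> is hereditary and strongly invariant among positive elements.\<close>

section \<open>The involution and complex scalars\<close>

text \<open>The obstacle throughout is that \<open>I\<close> is not norm-closed: limits of elements
  of \<open>I\<close> may leave it, so every limit is pushed into a cofactor. In the series for
  \<open>r\<close> and \<open>r'\<close> only the multipliers of \<open>e^3\<close> converge, and
  they do because \<open>e^2\<close> on both sides has total degree \<open>4 > 3\<close>. In the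
  same way \<open>star x * x \<le> d\<close> yields an exact equation
  \<open>x = u * d^(1/4)\<close>, with the limit hidden in \<open>u\<close>; this is where the
  fourth powers come from. As \<open>A\<close> may lack a unit and \<open>I\<close> need not be
  stable under complex scalars, scalars too are absorbed into such cofactors.

  For \<open>n > 1\<close> the map \<open>a \<mapsto> a^n\<close> is not monotone in general, so
  \<open>a \<le> b\<close> and \<open>b^n \<in> J\<close> do not give \<open>a^n \<in> J\<close> by
  mere comparison. Since \<open>a^n\<close> is the \<open>2^n\<close>-th power of
  \<open>a^(n / 2^n)\<close>, whose exponent is at most \<open>1\<close>, Loewner--Heinz handles the
  inner power; the outer one is undone by repeated squaring, where strong invariance replaces the
  missing inequality between squares.\<close>

instance cstar_algebra \<subseteq> banach ..

lemma scaleC_scaleR: "c *\<^sub>C (r *\<^sub>R x) = r *\<^sub>R (c *\<^sub>C (x::'a::cstar_algebra))"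
  by (metis scaleC_of_real scaleC_scaleC mult.commute)

lemma star_0 [simp]: "star 0 = (0::'a::cstar_algebra)"
  by (metis add_cancel_right_right star_add)

lemma star_minus: "star (- x) = - star (x::'a::cstar_algebra)"
  by (metis add_eq_0_iff add.right_inverse star_0 star_add)

lemma star_diff: "star (x - y) = star x - star (y::'a::cstar_algebra)"
  by (metis star_add star_minus diff_conv_add_uminus)

lemma star_scaleR: "star (r *\<^sub>R x) = r *\<^sub>R star (x::'a::cstar_algebra)"
  by (metis scaleC_of_real star_scaleC complex_cnj_complex_of_real)

lemma star_sum: "star (sum f S) = (\<Sum>i\<in>S. star (f i :: 'a::cstar_algebra))"
  by (induction S rule: infinite_finite_induct) (auto simp: star_add)

text \<open>The C*-identity and submultiplicativity give
  \<open>(norm x)^2 \<le> norm (star x) * norm x\<close>; cancel \<open>norm x\<close> and repeat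
  with \<open>star x\<close> in place of \<open>x\<close>.\<close>

lemma norm_star [simp]: "norm (star x) = norm (x::'a::cstar_algebra)"
proof -
  have le: "norm (x::'a) \<le> norm (star x)" for x
  proof (cases "x = 0")
    case False
    have "norm x * norm x \<le> norm (star x) * norm x"
      using cstar_identity[of x] norm_mult_ineq[of "star x" x] by (simp add: power2_eq_square)
    with False show ?thesis by simp
  qed auto
  from le[of x] le[of "star x"] show ?thesis by (simp add: star_star)
qed

lemma bounded_linear_star: "bounded_linear (star :: 'a::cstar_algebra \<Rightarrow> 'a)"
  by (rule bounded_linear_intro[of _ 1]) (auto simp: star_add star_scaleR)

lemmas tendsto_star [tendsto_intros] = bounded_linear.tendsto[OF bounded_linear_star]

lemma norm_mult_star: "norm (x * star x) = norm (x::'a::cstar_algebra) ^ 2"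
  using cstar_identity[of "star x"] by (simp add: star_star)

lemma norm_square_selfadjoint:
  "star h = h \<Longrightarrow> norm (h * h) = norm (h::'a::cstar_algebra) ^ 2"
  using cstar_identity[of h] by simp

text \<open>A real-linear operator with square \<open>-1\<close>: simplification then deals with
  real scalars and \<open>imul\<close> only, instead of mixing two scalar multiplications.\<close>

definition imul :: "'a::cstar_algebra \<Rightarrow> 'a" where "imul x = \<i> *\<^sub>C x"

lemma imul_simps [simp]:
  "imul (imul x) = - x" "imul x * y = imul (x * y)" "x * imul y = imul (x * y)"
  "star (imul x) = - imul (star x)"
  "imul (x + y) = imul x + imul y" "imul (- x) = - imul x" "imul (x - y) = imul x - imul y"
  "imul 0 = 0"
  by (auto simp: imul_def scaleC_scaleC mult_scaleC_left mult_scaleC_right star_scaleC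
      scaleC_add_right complex_vector.scale_right_diff_distrib)

lemma imul_scaleR [simp]: "imul (r *\<^sub>R x) = r *\<^sub>R imul x"
  by (simp add: imul_def scaleC_scaleR)

lemma scaleC_eq: "c *\<^sub>C x = Re c *\<^sub>R x + Im c *\<^sub>R imul (x::'a::cstar_algebra)"
proof -
  have "c *\<^sub>C x = (complex_of_real (Re c) + complex_of_real (Im c) * \<i>) *\<^sub>C x"
    by (simp add: complex_eq[symmetric] mult.commute)
  then show ?thesis
    unfolding scaleC_add_left scaleC_scaleC[symmetric] scaleC_of_real imul_def .
qed

section \<open>Spectra in unital algebras\<close>

text \<open>Spectral theory is developed for algebras with unit and reaches \<open>A\<close> through
  its unitization, which is an instance of this class.\<close>

class cstar_algebra_1 = cstar_algebra + real_normed_algebra_1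

definition invertible1 :: "'u::cstar_algebra_1 \<Rightarrow> bool" where
  "invertible1 u \<longleftrightarrow> (\<exists>v. u * v = 1 \<and> v * u = 1)"

definition inv1 :: "'u::cstar_algebra_1 \<Rightarrow> 'u" where
  "inv1 u = (SOME v. u * v = 1 \<and> v * u = 1)"

definition ofc :: "complex \<Rightarrow> 'u::cstar_algebra_1" where
  "ofc c = c *\<^sub>C 1"

definition spec1 :: "'u::cstar_algebra_1 \<Rightarrow> complex set" where
  "spec1 u = {z. \<not> invertible1 (ofc z - u)}"

lemma inv1:
  assumes "invertible1 (u::'u::cstar_algebra_1)"
  shows "u * inv1 u = 1" "inv1 u * u = 1"
  using someI_ex[OF assms[unfolded invertible1_def]] by (auto simp: inv1_def)

lemma inv1_unique: "(u::'u::cstar_algebra_1) * v = 1 \<Longrightarrow> v * u = 1 \<Longrightarrow> inv1 u = v"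
  by (metis inv1 invertible1_def mult.assoc mult.left_neutral mult.right_neutral)

lemma invertible1I: "(u::'u::cstar_algebra_1) * v = 1 \<Longrightarrow> v * u = 1 \<Longrightarrow> invertible1 u"
  by (auto simp: invertible1_def)

lemma invertible1_mult: "invertible1 (u::'u::cstar_algebra_1) \<Longrightarrow> invertible1 v \<Longrightarrow> invertible1 (u * v)"
  by (rule invertible1I[of _ "inv1 v * inv1 u"])
     (metis inv1 mult.assoc mult.right_neutral mult.left_neutral)+

lemma invertible1_1 [simp]: "invertible1 (1::'u::cstar_algebra_1)"
  by (rule invertible1I[of _ 1]) auto

lemma star_1 [simp]: "star (1::'u::cstar_algebra_1) = 1"
  by (metis mult.left_neutral mult.right_neutral star_mult star_star)

lemma ofc_simps: "ofc 0 = (0::'u::cstar_algebra_1)" "ofc 1 = (1::'u::cstar_algebra_1)" "ofc (c + d) = (ofc c + ofc d :: 'u::cstar_algebra_1)"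
  "ofc (c - d) = (ofc c - ofc d :: 'u::cstar_algebra_1)" "ofc (c * d) = (ofc c * ofc d :: 'u::cstar_algebra_1)"
  "ofc (- c) = (- ofc c :: 'u::cstar_algebra_1)"
  "star (ofc c) = (ofc (cnj c) :: 'u::cstar_algebra_1)" "ofc (complex_of_real r) = (r *\<^sub>R 1 :: 'u::cstar_algebra_1)"
  by (auto simp: ofc_def scaleC_add_left complex_vector.scale_left_diff_distrib mult_scaleC_left
      scaleC_scaleC star_scaleC scaleC_of_real complex_vector.scale_minus_left)

lemma ofc_mult: "ofc c * x = c *\<^sub>C (x::'u::cstar_algebra_1)" "x * ofc c = c *\<^sub>C x"
  by (auto simp: ofc_def mult_scaleC_left mult_scaleC_right)

lemma invertible1_scaleC: "c \<noteq> 0 \<Longrightarrow> invertible1 (u::'u::cstar_algebra_1) \<Longrightarrow> invertible1 (c *\<^sub>C u)"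
  by (metis invertible1_mult[of "ofc c" u] invertible1I[of "ofc c" "ofc (1/c)"]
     nonzero_mult_div_cancel_left ofc_mult(1) ofc_simps(2,5) mult.right_neutral
     times_divide_eq_left times_divide_eq_right)

section \<open>Neumann series and continuity of inversion\<close>

lemma neumann:
  assumes "norm (x::'u::cstar_algebra_1) < 1"
  shows "invertible1 (1 - x)" "norm (inv1 (1 - x)) \<le> 1 / (1 - norm x)"
proof -
  have s: "summable (\<lambda>n. x ^ n)"
    by (rule complete_algebra_summable_geometric[OF assms])
  define S where "S = (\<Sum>n. x ^ n)"
  have "S = 1 + (\<Sum>n. x ^ Suc n)"
    using suminf_split_head[OF s] unfolding S_def by simp
  moreover have "(\<Sum>n. x ^ Suc n) = x * S" "(\<Sum>n. x ^ Suc n) = S * x"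
    unfolding S_def using suminf_mult[OF s, of x] suminf_mult2[OF s, of x]
    by (auto simp: power_commutes)
  ultimately have *: "(1 - x) * S = 1" "S * (1 - x) = 1"
    by (auto simp: algebra_simps)
  then show "invertible1 (1 - x)" by (rule invertible1I)
  have "S = 1 + x * S"
    using * by (simp add: algebra_simps)
  then have "norm S \<le> 1 + norm x * norm S"
    by (metis norm_add_leD norm_mult_ineq norm_one norm_triangle_mono order_refl)
  then have "norm S \<le> 1 / (1 - norm x)"
    using assms by (simp add: field_simps)
  then show "norm (inv1 (1 - x)) \<le> 1 / (1 - norm x)"
    using inv1_unique[OF *] by simp
qed

lemma spec1_bound: "z \<in> spec1 (u::'u::cstar_algebra_1) \<Longrightarrow> cmod z \<le> norm u"
proof (rule ccontr)
  assume z: "z \<in> spec1 u" and *: "\<not> cmod z \<le> norm u"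
  then have z0: "z \<noteq> 0" by auto
  have "norm ((1/z) *\<^sub>C u) < 1"
    using * z0 by (simp add: norm_scaleC norm_divide field_simps)
  from invertible1_scaleC[OF z0 neumann(1)[OF this]]
  have "invertible1 (ofc z - u)"
    using z0 by (simp add: complex_vector.scale_right_diff_distrib scaleC_scaleC ofc_def)
  with z show False by (simp add: spec1_def)
qed

text \<open>Factor \<open>w = u * (1 - x)\<close> with \<open>norm x \<le> 1/2\<close> and apply the
  Neumann series to \<open>1 - x\<close>; the difference of the inverses is
  \<open>inv1 w * (u - w) * inv1 u\<close>. The explicit bound serves both openness of the
  invertible elements and continuity of \<open>inv1\<close>.\<close>

lemma invertible1_near:
  assumes "invertible1 (u::'u::cstar_algebra_1)" "norm (w - u) * norm (inv1 u) \<le> 1/2"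
  shows "invertible1 w" "norm (inv1 w - inv1 u) \<le> 2 * norm (inv1 u) ^ 2 * norm (w - u)"
proof -
  define x where "x = inv1 u * (u - w)"
  have nx: "norm x \<le> 1/2"
    unfolding x_def using norm_mult_ineq[of "inv1 u" "u - w"] assms(2)
    by (simp add: norm_minus_commute mult.commute)
  then have x1: "norm x < 1" by simp
  have w: "w = u * (1 - x)"
    using inv1[OF assms(1)] unfolding x_def
    by (simp add: right_diff_distrib flip: mult.assoc)
  show iw: "invertible1 w"
    unfolding w by (rule invertible1_mult[OF assms(1) neumann(1)[OF x1]])
  have "inv1 w = inv1 (1 - x) * inv1 u"
    by (rule inv1_unique; unfold w)
       (metis inv1 mult.assoc mult.right_neutral assms(1) neumann(1) x1)+
  then have "norm (inv1 w) \<le> norm (inv1 (1 - x)) * norm (inv1 u)"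
    by (simp add: norm_mult_ineq)
  also have "norm (inv1 (1 - x)) \<le> 1 / (1 - norm x)"
    by (rule neumann(2)[OF x1])
  also have "\<dots> \<le> 2" using nx by (simp add: field_simps)
  finally have nw: "norm (inv1 w) \<le> 2 * norm (inv1 u)"
    by (simp add: mult_right_mono)
  have "inv1 w * (u - w) * inv1 u = inv1 w * (u * inv1 u) - inv1 w * w * inv1 u"
    by (simp add: right_diff_distrib left_diff_distrib mult.assoc)
  then have "inv1 w - inv1 u = inv1 w * (u - w) * inv1 u"
    by (simp add: inv1[OF assms(1)] inv1[OF iw])
  then have "norm (inv1 w - inv1 u) \<le> norm (inv1 w) * norm (u - w) * norm (inv1 u)"
    using norm_mult_ineq[of "inv1 w * (u - w)" "inv1 u"]
      mult_right_mono[OF norm_mult_ineq[of "inv1 w" "u - w"], of "norm (inv1 u)"] by simp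
  also have "\<dots> \<le> (2 * norm (inv1 u)) * norm (u - w) * norm (inv1 u)"
    by (intro mult_right_mono nw) auto
  finally show "norm (inv1 w - inv1 u) \<le> 2 * norm (inv1 u) ^ 2 * norm (w - u)"
    by (simp add: power2_eq_square norm_minus_commute ac_simps)
qed

lemma open_invertible1: "open {u::'u::cstar_algebra_1. invertible1 u}"
  unfolding open_dist
proof (intro ballI)
  fix u :: 'u assume "u \<in> {u. invertible1 u}"
  then have u: "invertible1 u" by simp
  show "\<exists>e>0. \<forall>y. dist y u < e \<longrightarrow> y \<in> {u. invertible1 u}"
  proof (intro exI[of _ "1 / (2 * (norm (inv1 u) + 1))"] conjI allI impI)
    show "0 < 1 / (2 * (norm (inv1 u) + 1))"
      by (smt (verit) norm_ge_zero zero_less_divide_1_iff)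
    fix y assume "dist y u < 1 / (2 * (norm (inv1 u) + 1))"
    then have "norm (y - u) * (norm (inv1 u) + 1) \<le> 1/2"
      using norm_ge_zero[of "inv1 u"] by (simp add: dist_norm field_simps add_nonneg_pos)
    moreover have "norm (y - u) * norm (inv1 u) \<le> norm (y - u) * (norm (inv1 u) + 1)"
      by (simp add: mult_left_mono)
    ultimately show "y \<in> {u. invertible1 u}"
      using invertible1_near(1)[OF u] by simp
  qed
qed

lemma continuous_on_inv1: "continuous_on {u::'u::cstar_algebra_1. invertible1 u} inv1"
proof (rule continuous_at_imp_continuous_on, intro ballI)
  fix u :: 'u assume "u \<in> {u. invertible1 u}"
  then have u: "invertible1 u" by simp
  have "((\<lambda>w. inv1 w - inv1 u) \<longlongrightarrow> 0) (at u)"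
  proof (rule Lim_null_comparison)
    have "((\<lambda>w. norm (w - u) * norm (inv1 u)) \<longlongrightarrow> norm (u - u) * norm (inv1 u)) (at u)"
      by (intro tendsto_intros)
    then have "eventually (\<lambda>w. norm (w - u) * norm (inv1 u) < 1/2) (at u)"
      by (rule order_tendstoD) simp
    then show "eventually (\<lambda>w. norm (inv1 w - inv1 u) \<le> 2 * norm (inv1 u) ^ 2 * norm (w - u)) (at u)"
      by eventually_elim (rule invertible1_near(2)[OF u], simp)
    have "((\<lambda>w. 2 * norm (inv1 u) ^ 2 * norm (w - u)) \<longlongrightarrow> 2 * norm (inv1 u) ^ 2 * norm (u - u)) (at u)"
      by (intro tendsto_intros)
    then show "((\<lambda>w. 2 * norm (inv1 u) ^ 2 * norm (w - u)) \<longlongrightarrow> 0) (at u)" by simp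
  qed
  then show "isCont inv1 u"
    by (simp add: isCont_def LIM_zero_iff)
qed

lemma closed_spec1: "closed (spec1 (u::'u::cstar_algebra_1))"
proof -
  have "open ((\<lambda>z. ofc z - u) -` {u::'u::cstar_algebra_1. invertible1 u})"
    by (rule open_vimage[OF open_invertible1])
       (auto simp: ofc_def scaleC_eq intro!: continuous_intros)
  moreover have "spec1 u = - ((\<lambda>z. ofc z - u) -` {u::'u::cstar_algebra_1. invertible1 u})"
    by (auto simp: spec1_def)
  ultimately show ?thesis by (simp add: closed_Compl)
qed

text \<open>Arens' trick: translating by large imaginary scalars.\<close>

lemma spec1_selfadjoint_real:
  assumes h: "star h = (h::'u::cstar_algebra_1)" and z: "z \<in> spec1 h"
  shows "Im z = 0"
proof (rule ccontr)
  assume b: "Im z \<noteq> 0"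
  define M where "M = norm h ^ 2"
  have M: "M \<ge> 0" by (simp add: M_def)
  have *: "Im z ^ 2 + 2 * Im z * l \<le> M" for l :: real
  proof -
    let ?w = "ofc (\<i> * of_real l) :: 'u::cstar_algebra_1"
    have e: "ofc (z + \<i> * of_real l) - (h + ?w) = ofc z - h"
      by (simp add: ofc_simps(3))
    have "z + \<i> * of_real l \<in> spec1 (h + ?w)"
      using z unfolding spec1_def mem_Collect_eq e .
    then have "cmod (z + \<i> * of_real l) \<le> norm (h + ?w)" by (rule spec1_bound)
    then have "cmod (z + \<i> * of_real l) ^ 2 \<le> norm (h + ?w) ^ 2" by (simp add: power_mono)
    also have "\<dots> = norm (star (h + ?w) * (h + ?w))" by (simp add: cstar_identity)
    also have "star (h + ?w) * (h + ?w) = h * h + (l^2) *\<^sub>R 1"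
    proof -
      have "?w = l *\<^sub>R imul 1"
        unfolding ofc_def by (simp add: scaleC_eq)
      then show ?thesis using h
        by (simp add: star_add star_scaleR algebra_simps power2_eq_square)
    qed
    also have "norm (h * h + (l^2) *\<^sub>R 1) \<le> M + l^2"
      unfolding M_def using norm_triangle_ineq[of "h*h" "(l^2) *\<^sub>R 1"] norm_mult_ineq[of h h]
      by (simp add: power2_eq_square)
    finally have "(Re z)^2 + (Im z + l)^2 \<le> M + l^2"
      by (simp add: cmod_power2)
    moreover have "(Re z)^2 \<ge> 0" by simp
    ultimately have "(Im z + l)^2 \<le> M + l^2" by linarith
    then show ?thesis by (simp add: power2_eq_square algebra_simps)
  qed
  have "Im z ^ 2 > 0" using b by simp
  \<comment> \<open>For \<open>l = M / Im z\<close> the bound becomes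
    \<open>(Im z)^2 + 2 * M \<le> M\<close>.\<close>
  with *[of "M / Im z"] M b show False by simp
qed

text \<open>Each application of the C*-identity to the self-adjoint power doubles the exponent. Only
  exponents \<open>2^k\<close> are reached this way, so later growth arguments run along
  these.\<close>

lemma norm_pow2_selfadjoint:
  assumes "star h = (h::'u::cstar_algebra_1)" shows "norm (h ^ (2^k)) = norm h ^ (2^k)"
proof -
  have st: "star (h ^ n) = h ^ n" for n
    by (induction n) (auto simp: star_mult assms power_commutes)
  show ?thesis
  proof (induction k)
    case (Suc k)
    have "h ^ (2 ^ Suc k) = h ^ (2^k) * h ^ (2^k)"
      by (simp add: mult_2 power_add)
    then have "norm (h ^ (2 ^ Suc k)) = norm (h ^ (2^k)) ^ 2"
      using norm_square_selfadjoint[OF st] by simp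
    then show ?case using Suc by (simp add: power_mult mult.commute flip: power_mult)
  qed simp
qed

text \<open>Partial fractions: \<open>1 / (1 - y^2)\<close> is the mean of
  \<open>1 / (1 - y)\<close> and \<open>1 / (1 + y)\<close>.\<close>

lemma half_sum_inverse:
  assumes "(1 - y) * a = (1::'u::cstar_algebra_1)" "a * (1 - y) = 1" "(1 + y) * b = 1" "b * (1 + y) = 1"
  defines "s \<equiv> (1/2) *\<^sub>R (a + b)"
  shows "(1 - y * y) * s = 1" "s * (1 - y * y) = 1"
proof -
  have "(1 - y * y) = (1 + y) * (1 - y)" "(1 - y * y) = (1 - y) * (1 + y)"
    by (auto simp: algebra_simps)
  then have "(1 - y * y) * a = 1 + y" "a * (1 - y * y) = 1 + y"
     "(1 - y * y) * b = 1 - y" "b * (1 - y * y) = 1 - y"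
    using assms(1-4) by (metis mult.assoc mult.left_neutral mult.right_neutral)+
  then show "(1 - y * y) * s = 1" "s * (1 - y * y) = 1"
    unfolding s_def by (auto simp: distrib_left distrib_right scaleR_2[symmetric] simp flip: scaleR_add_right)
qed

lemma power_ofc_mult: "(ofc z * (h::'u::cstar_algebra_1)) ^ n = ofc (z ^ n) * h ^ n"
  by (induction n) (auto simp: ofc_simps ofc_mult mult_scaleC_left mult_scaleC_right scaleC_scaleC mult.commute)

lemma exists_root_minus1: "\<exists>w. cmod w = 1 \<and> w ^ (2^k) = -1"
  by (rule exI[of _ "cis (pi / 2^k)"]) (simp add: Complex.DeMoivre cis_pi)

text \<open>Rickart's elementary argument for the spectral radius: averaging the resolvent over
  \<open>2\<^sup>k\<close>-th roots of unity keeps its modulus of continuity.\<close>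

lemma spec1_norm_attained:
  assumes h: "star h = (h::'u::cstar_algebra_1)"
  shows "\<exists>z\<in>spec1 h. cmod z = norm h"
proof (cases "h = 0")
  case True
  have "\<not> invertible1 (0::'u::cstar_algebra_1)" by (auto simp: invertible1_def)
  then show ?thesis using True by (auto simp: spec1_def ofc_simps intro!: bexI[of _ 0])
next
  case False
  define M where "M = norm h"
  have M: "M > 0" using False by (simp add: M_def)
  show ?thesis
  proof (rule ccontr)
    assume neg: "\<not> ?thesis"
    define D where "D = spec1 h"
    have cD: "compact D"
      unfolding D_def compact_eq_bounded_closed
      using closed_spec1 spec1_bound by (metis boundedI)
    obtain r where r: "0 \<le> r" "r < M" "\<And>z. z \<in> D \<Longrightarrow> cmod z \<le> r"
    proof (cases "D = {}")
      case True then show ?thesis using that[of 0] M by auto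
    next
      case False
      obtain x where "x \<in> D" "\<forall>y\<in>D. cmod y \<le> cmod x"
        using continuous_attains_sup[OF cD False, of cmod] by (auto intro: continuous_intros)
      then show ?thesis
        using that[of "cmod x"] neg spec1_bound[of x h] unfolding D_def M_def by force
    qed
    \<comment> \<open>\<open>1 / R\<close> is the midpoint of \<open>r\<close> and \<open>M\<close>:
      the resolvent exists on the whole disc of radius \<open>R\<close>, which still reaches beyond
      \<open>1 / M\<close>.\<close>
    define R where "R = 2 / (r + M)"
    have R: "R > 0" "1/M < R" using r M by (auto simp: R_def field_simps)
    have inv: "invertible1 (1 - ofc z * h)" if "cmod z \<le> R" for z
    proof (cases "z = 0")
      case False
      have "cmod (1/z) \<ge> 1/R" using that False R by (simp add: norm_divide field_simps)
      moreover have "1/R > r" using r by (simp add: R_def)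
      ultimately have "1/z \<notin> D" using r(3)[of "1/z"] by force
      then have "invertible1 (ofc (1/z) - h)" by (simp add: D_def spec1_def)
      from invertible1_scaleC[OF False this] show ?thesis using False
        by (simp add: complex_vector.scale_right_diff_distrib ofc_def scaleC_scaleC mult_scaleC_left)
    qed (simp add: ofc_simps)
    define F where "F z = inv1 (1 - ofc z * h)" for z
    have "continuous_on (cball 0 R) F"
      unfolding F_def
      by (rule continuous_on_compose2[OF continuous_on_inv1])
         (use inv in \<open>auto simp: ofc_def scaleC_eq intro!: continuous_intros\<close>)
    then have "uniformly_continuous_on (cball 0 R) F"
      by (rule compact_uniformly_continuous) simp
    then obtain d where d: "d > 0"
      "\<And>x y. x \<in> cball 0 R \<Longrightarrow> y \<in> cball 0 R \<Longrightarrow> dist y x < d \<Longrightarrow> dist (F y) (F x) < 1/8"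
      unfolding uniformly_continuous_on_def by (metis zero_less_divide_1_iff zero_less_numeral)
    \<comment> \<open>The point is that \<open>d\<close> and \<open>1/8\<close> do not depend on
      \<open>k\<close>. In the induction step the resolvent at level \<open>k + 1\<close> is the
      mean of the values at \<open>z\<close> and \<open>w * z\<close>; rotation by \<open>w\<close>
      preserves the disc and all distances, so the mean inherits the same estimate.\<close>
    have main: "(\<forall>z. cmod z \<le> R \<longrightarrow> invertible1 (1 - ofc (z^(2^k)) * h^(2^k))) \<and>
      (\<forall>z y. cmod z \<le> R \<longrightarrow> cmod y \<le> R \<longrightarrow> cmod (y - z) < d \<longrightarrow>
          norm (inv1 (1 - ofc (y^(2^k)) * h^(2^k)) - inv1 (1 - ofc (z^(2^k)) * h^(2^k))) \<le> 1/8)" for k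
    proof (induction k)
      case 0
      show ?case using inv d(2) by (auto simp: F_def dist_norm less_imp_le)
    next
      case (Suc k)
      note Suc1 = Suc.IH[THEN conjunct1, rule_format] and Suc2 = Suc.IH[THEN conjunct2, rule_format]
      obtain w where w: "cmod w = 1" "w ^ (2^k) = -1" using exists_root_minus1 by blast
      define G where "G z = inv1 (1 - ofc (z^(2^k)) * h^(2^k))" for z
      have eq: "(1 - ofc (z^(2^Suc k)) * h^(2^Suc k)) * ((1/2) *\<^sub>R (G z + G (w * z))) = 1"
               "((1/2) *\<^sub>R (G z + G (w * z))) * (1 - ofc (z^(2^Suc k)) * h^(2^Suc k)) = 1"
        if z: "cmod z \<le> R" for z
      proof -
        define y where "y = ofc (z^(2^k)) * h^(2^k)"
        have y2: "y * y = ofc (z^(2^Suc k)) * h^(2^Suc k)"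
          unfolding y_def power_ofc_mult[symmetric] by (simp add: mult_2 power_add)
        have wz: "cmod (w * z) \<le> R" using z w by (simp add: norm_mult)
        have y': "1 - ofc ((w*z)^(2^k)) * h^(2^k) = 1 + y"
          unfolding y_def by (simp add: power_mult_distrib w ofc_simps)
        have "(1 - y) * G z = 1" "G z * (1 - y) = 1"
          using inv1[OF Suc1[OF z]] unfolding G_def y_def by auto
        moreover have "(1 + y) * G (w*z) = 1" "G (w*z) * (1 + y) = 1"
          using inv1[OF Suc1[OF wz]] unfolding G_def y'[symmetric] by auto
        ultimately show
          "(1 - ofc (z^(2^Suc k)) * h^(2^Suc k)) * ((1/2) *\<^sub>R (G z + G (w * z))) = 1"
          "((1/2) *\<^sub>R (G z + G (w * z))) * (1 - ofc (z^(2^Suc k)) * h^(2^Suc k)) = 1"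
          using half_sum_inverse[of y "G z" "G (w*z)"] unfolding y2 by blast+
      qed
      show ?case
      proof (intro conjI allI impI)
        fix z assume z: "cmod z \<le> R"
        show "invertible1 (1 - ofc (z^(2^Suc k)) * h^(2^Suc k))"
          by (rule invertible1I[OF eq[OF z]])
      next
        fix z y assume zy: "cmod z \<le> R" "cmod y \<le> R" "cmod (y - z) < d"
        have wd: "cmod (w * y - w * z) < d"
          using zy w by (simp add: norm_mult flip: right_diff_distrib)
        have a: "norm (G y - G z) \<le> 1/8" "norm (G (w*y) - G (w*z)) \<le> 1/8"
          using Suc2[of z y] Suc2[of "w*z" "w*y"] zy wd w unfolding G_def by (auto simp: norm_mult)
        have "(1/2) *\<^sub>R (G y + G (w * y)) - (1/2) *\<^sub>R (G z + G (w * z))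
           = (1/2) *\<^sub>R ((G y - G z) + (G (w*y) - G (w*z)))" by (simp add: algebra_simps)
        then have "norm ((1/2) *\<^sub>R (G y + G (w * y)) - (1/2) *\<^sub>R (G z + G (w * z))) \<le> 1/8"
          using norm_triangle_ineq[of "G y - G z" "G (w*y) - G (w*z)"] a by simp
        then show "norm (inv1 (1 - ofc (y^(2^Suc k)) * h^(2^Suc k)) - inv1 (1 - ofc (z^(2^Suc k)) * h^(2^Suc k))) \<le> 1/8"
          using inv1_unique[OF eq(1)[OF zy(1)] eq(2)[OF zy(1)]]
            inv1_unique[OF eq(1)[OF zy(2)] eq(2)[OF zy(2)]] by simp
      qed
    qed
    \<comment> \<open>Two radii on either side of \<open>1 / M\<close> and less than
      \<open>d\<close> apart. For large \<open>k\<close> the element \<open>q t0\<close> is small,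
      so \<open>S t0\<close> is near \<open>1\<close>, and by \<open>main\<close> so is
      \<open>S t1\<close>; this forces \<open>norm (q t1) < 1\<close>, although
      \<open>norm (q t1) = (t1 * M)^(2^k) \<ge> 1\<close>.\<close>
    define t1 where "t1 = min R (1/M + d/4)"
    define t0 where "t0 = max (1/M - d/4) 0"
    have t: "0 \<le> t0" "t0 < 1/M" "1/M < t1" "t1 \<le> R" "t1 - t0 < d"
      using R M d unfolding t0_def t1_def by auto
    have "(\<lambda>k. (t0 * M) ^ (2^k)) \<longlonglongrightarrow> 0"
    proof -
      have "(\<lambda>n. (t0 * M) ^ n) \<longlonglongrightarrow> 0"
        by (rule LIMSEQ_power_zero) (use t M in \<open>auto simp: field_simps abs_mult\<close>)
      then show ?thesis
        by (rule filterlim_compose) (intro filterlim_subseq, auto simp: strict_mono_def)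
    qed
    then have "eventually (\<lambda>k. (t0 * M) ^ (2^k) < 1/16) sequentially"
      by (rule order_tendstoD) simp
    then obtain k where k: "(t0 * M) ^ (2^k) < 1/16"
      by (auto simp: eventually_sequentially)
    define q where "q t = ofc ((complex_of_real t)^(2^k)) * h^(2^k)" for t
    have nq: "norm (q t) = (t * M) ^ (2^k)" if "t \<ge> 0" for t
      using that norm_pow2_selfadjoint[OF h] unfolding q_def M_def ofc_mult norm_scaleC
      by (simp add: norm_power power_mult_distrib)
    define S where "S t = inv1 (1 - q t)" for t
    have S0: "norm (S t0 - 1) \<le> 1/8"
    proof -
      have n: "norm (q t0) < 1/16" using nq t k by simp
      then have n1: "norm (q t0) < 1" by simp
      have i: "invertible1 (1 - q t0)" by (rule neumann[OF n1])
      have "S t0 - 1 = S t0 * q t0"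
        using inv1(2)[OF i] unfolding S_def by (simp add: algebra_simps)
      then have "norm (S t0 - 1) \<le> norm (S t0) * norm (q t0)" by (simp add: norm_mult_ineq)
      also have "\<dots> \<le> 2 * (1/16)"
      proof (intro mult_mono)
        have "norm (S t0) \<le> 1 / (1 - norm (q t0))" unfolding S_def by (rule neumann(2)[OF n1])
        also have "\<dots> \<le> 2" using n by (simp add: field_simps)
        finally show "norm (S t0) \<le> 2" .
      qed (use n in auto)
      finally show ?thesis by simp
    qed
    have "norm (S t1 - S t0) \<le> 1/8"
      unfolding S_def q_def
      by (rule main[THEN conjunct2, rule_format]) (use t in \<open>auto simp: norm_of_real simp flip: of_real_diff\<close>)
    with S0 have S1: "norm (1 - S t1) \<le> 1/4"
      using norm_triangle_ineq[of "S t1 - S t0" "S t0 - 1"] by (simp add: norm_minus_commute)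
    have i1: "invertible1 (1 - q t1)"
      unfolding q_def using main[of k] t R M by (auto simp: norm_of_real)
    have "- q t1 = (1 - q t1) * (1 - S t1)"
      using inv1(1)[OF i1] unfolding S_def by (simp add: algebra_simps)
    then have "norm (q t1) \<le> norm (1 - q t1) * norm (1 - S t1)"
      by (metis norm_minus_cancel norm_mult_ineq)
    also have "\<dots> \<le> (1 + norm (q t1)) * (1/4)"
      using norm_triangle_ineq4[of 1 "q t1"] S1 by (intro mult_mono) auto
    finally have "norm (q t1) < 1" by simp
    moreover have "norm (q t1) = (t1 * M) ^ (2^k)" using nq t M
      by (smt (verit) zero_less_divide_1_iff)
    moreover have "(t1 * M) ^ (2^k) \<ge> 1"
      using t M by (intro one_le_power) (simp add: field_simps less_imp_le)
    ultimately show False by simp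
  qed
qed

subsection \<open>Polynomials\<close>

definition cpoly :: "complex poly \<Rightarrow> 'u \<Rightarrow> 'u::cstar_algebra_1" where
  "cpoly p u = fold_coeffs (\<lambda>c y. ofc c + u * y) p 0"

abbreviation rpoly :: "real poly \<Rightarrow> 'u \<Rightarrow> 'u::cstar_algebra_1" where
  "rpoly p u \<equiv> cpoly (map_poly complex_of_real p) u"

lemma cpoly_0 [simp]: "cpoly 0 u = 0"
  by (simp add: cpoly_def)

lemma cpoly_pCons [simp]: "cpoly (pCons c p) u = ofc c + u * cpoly p u"
  by (cases "p = 0 \<and> c = 0") (auto simp: cpoly_def ofc_simps)

lemma cpoly_add: "cpoly (p + q) u = cpoly p u + cpoly q u"
proof (induction p arbitrary: q)
  case (pCons a p)
  then show ?case by (cases q) (simp add: algebra_simps ofc_simps)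
qed simp

lemma cpoly_smult: "cpoly (smult c p) u = c *\<^sub>C cpoly p u"
  by (induction p)
     (simp_all add: ofc_def scaleC_add_right scaleC_scaleC mult_scaleC_right)

lemma cpoly_minus: "cpoly (- p) u = - cpoly p u"
  using cpoly_smult[of "-1" p u] by simp

lemma cpoly_mult: "cpoly (p * q) u = cpoly p u * cpoly q u"
  by (induction p)
     (simp_all add: cpoly_add cpoly_smult ofc_simps distrib_right ofc_mult mult.assoc)

lemma cpoly_sum: "cpoly p u = (\<Sum>i\<le>degree p. coeff p i *\<^sub>C u ^ i)"
proof (induction p)
  case (pCons c p)
  show ?case
  proof (cases "p = 0")
    case False
    have "(\<Sum>i\<le>degree (pCons c p). coeff (pCons c p) i *\<^sub>C u ^ i)
        = c *\<^sub>C 1 + (\<Sum>i\<le>degree p. coeff p i *\<^sub>C u ^ Suc i)"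
      using False by (simp add: sum.atMost_Suc_shift del: sum.atMost_Suc power_Suc)
    also have "(\<Sum>i\<le>degree p. coeff p i *\<^sub>C u ^ Suc i) = u * cpoly p u"
      unfolding pCons.IH sum_distrib_left by (simp add: mult_scaleC_right)
    finally show ?thesis by (simp add: ofc_def)
  qed (simp add: ofc_def)
qed simp

text \<open>Split off a linear factor \<open>X - w\<close> by the fundamental theorem of algebra.
  Its root lies outside \<open>spec1 u\<close>, so \<open>u - ofc w\<close> is invertible, and
  induction treats the cofactor.\<close>

lemma invertible1_cpoly:
  assumes "p \<noteq> 0" "\<And>w. w \<in> spec1 u \<Longrightarrow> poly p w \<noteq> 0"
  shows "invertible1 (cpoly p u)"
  using assms
proof (induction "degree p" arbitrary: p)
  case 0
  then obtain c where c: "p = [:c:]" by (metis degree_0_id)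
  with 0 have "c \<noteq> 0" by auto
  then show ?case using invertible1_scaleC[of c "1"] c by (simp add: ofc_def)
next
  case (Suc n)
  then have "\<not> constant (poly p)" by (simp add: constant_degree)
  from fundamental_theorem_of_algebra[OF this] obtain w where w: "poly p w = 0" by blast
  then obtain q where q: "p = [:- w, 1:] * q" by (auto simp: poly_eq_0_iff_dvd)
  with Suc have "q \<noteq> 0" by auto
  have "degree p = 1 + degree q"
    unfolding q by (subst degree_mult_eq) (use \<open>q \<noteq> 0\<close> in auto)
  with Suc(2) have "n = degree q" by simp
  moreover have "\<And>w. w \<in> spec1 u \<Longrightarrow> poly q w \<noteq> 0" using q Suc(4) by auto
  ultimately have i: "invertible1 (cpoly q u)" using Suc(1) \<open>q \<noteq> 0\<close> by blast
  have "w \<notin> spec1 u" using Suc(4) w by blast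
  then have "invertible1 (ofc w - u)" by (simp add: spec1_def)
  from invertible1_scaleC[of "-1", OF _ this] have "invertible1 (u - ofc w)" by simp
  moreover have "cpoly [:- w, 1:] u = u - ofc w" by (simp add: ofc_simps)
  ultimately show ?case unfolding q cpoly_mult using i invertible1_mult by metis
qed

text \<open>The inclusion half of spectral mapping, from \<open>invertible1_cpoly\<close> for
  \<open>[:z:] - p\<close>; a nonempty spectrum guarantees that this polynomial is not zero.\<close>

lemma spec1_cpoly:
  assumes "spec1 u \<noteq> {}" and z: "z \<in> spec1 (cpoly p u)"
  shows "\<exists>w\<in>spec1 u. z = poly p w"
proof (rule ccontr)
  assume neg: "\<not> ?thesis"
  then have "invertible1 (cpoly ([:z:] - p) u)"
    using assms(1) by (intro invertible1_cpoly) auto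
  moreover have "cpoly ([:z:] - p) u = ofc z - cpoly p u"
    using cpoly_add[of "[:z:]" "- p" u] by (simp add: cpoly_minus)
  ultimately show False using z by (simp add: spec1_def)
qed

lemma spec1_nonempty: "star h = h \<Longrightarrow> spec1 h \<noteq> {}"
  using spec1_norm_attained by blast

lemma poly_of_real: "poly (map_poly complex_of_real p) (of_real t) = of_real (poly p t)"
  by (induction p) (auto simp: map_poly_pCons)

lemma coeff_rpoly: "coeff (map_poly complex_of_real p) i = of_real (coeff p i)"
  by (simp add: coeff_map_poly)

lemma degree_rpoly: "degree (map_poly complex_of_real p) = degree p"
  by (rule degree_map_poly) auto

lemma rpoly_sum: "rpoly p u = (\<Sum>i\<le>degree p. coeff p i *\<^sub>R u ^ i)"
  by (simp add: cpoly_sum coeff_rpoly degree_rpoly scaleC_of_real)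

lemma map_poly_of_real_hom:
  "map_poly complex_of_real (p + q) = map_poly complex_of_real p + map_poly complex_of_real q"
  "map_poly complex_of_real (p - q) = map_poly complex_of_real p - map_poly complex_of_real q"
  "map_poly complex_of_real (p * q) = map_poly complex_of_real p * map_poly complex_of_real q"
  by (auto simp: poly_eq_iff coeff_map_poly coeff_mult)

lemma rpoly_hom:
  "rpoly (p + q) u = rpoly p u + rpoly q u"
  "rpoly (p - q) u = rpoly p u - rpoly q u"
  "rpoly (p * q) u = rpoly p u * rpoly q u"
  "rpoly (smult r p) u = r *\<^sub>R rpoly p u"
proof -
  show "rpoly (p - q) u = rpoly p u - rpoly q u"
    using cpoly_add[of "map_poly complex_of_real p" "- map_poly complex_of_real q" u]
    by (simp add: map_poly_of_real_hom cpoly_minus)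
  have "map_poly complex_of_real (smult r p) = smult (of_real r) (map_poly complex_of_real p)"
    by (auto simp: poly_eq_iff coeff_map_poly)
  then show "rpoly (smult r p) u = r *\<^sub>R rpoly p u"
    by (simp add: cpoly_smult scaleC_of_real)
qed (auto simp: map_poly_of_real_hom cpoly_add cpoly_mult)

lemma star_power: "star (h ^ n) = star h ^ n" for h :: "'u::cstar_algebra_1"
  by (induction n) (auto simp: star_mult power_commutes)

lemma star_rpoly: "star h = h \<Longrightarrow> star (rpoly p h) = rpoly p h"
  by (simp add: rpoly_sum star_sum star_scaleR star_power)

text \<open>The norm of the self-adjoint element \<open>rpoly p h\<close> is attained on its
  spectrum, which consists of values of \<open>p\<close> on \<open>spec1 h\<close>. This estimate
  turns uniform convergence on the spectrum into norm convergence.\<close>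

lemma norm_rpoly_le:
  assumes h: "star h = h" and B: "\<And>t. complex_of_real t \<in> spec1 h \<Longrightarrow> \<bar>poly p t\<bar> \<le> B"
  shows "norm (rpoly p h) \<le> B"
proof -
  obtain z where z: "z \<in> spec1 (rpoly p h)" "cmod z = norm (rpoly p h)"
    using spec1_norm_attained[OF star_rpoly[OF h]] by blast
  obtain w where w: "w \<in> spec1 h" "z = poly (map_poly complex_of_real p) w"
    using spec1_cpoly[OF spec1_nonempty[OF h] z(1)] by blast
  have "w = of_real (Re w)"
    using spec1_selfadjoint_real[OF h w(1)] by (simp add: complex_eq_iff)
  with w z B[of "Re w"] show ?thesis
    by (metis norm_of_real poly_of_real)
qed

text \<open>The inverse of \<open>z - y * x\<close> is \<open>(1 / z) * (1 + y * v * x)\<close>,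
  where \<open>v\<close> inverts \<open>z - x * y\<close>.\<close>

lemma spec1_commute:
  assumes "z \<noteq> 0" "z \<notin> spec1 (x * y)" shows "z \<notin> spec1 (y * x)"
proof -
  define v where "v = inv1 (ofc z - x * y)"
  have v: "(ofc z - x * y) * v = 1" "v * (ofc z - x * y) = 1"
    using inv1 assms(2) unfolding v_def spec1_def by auto
  then have v1: "x * y * v = z *\<^sub>C v - 1" "v * (x * y) = z *\<^sub>C v - 1"
    by (auto simp: left_diff_distrib right_diff_distrib ofc_mult algebra_simps)
  define w where "w = (1/z) *\<^sub>C (1 + y * v * x)"
  have o1: "z *\<^sub>C 1 = ofc z" by (simp add: ofc_def)
  have "(ofc z - y * x) * (1 + y * v * x) = ofc z + z *\<^sub>C (y * v * x) - y * x - y * (x * y * v) * x"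
    by (simp add: algebra_simps ofc_mult o1)
  also have "\<dots> = ofc z"
    unfolding v1 by (simp add: algebra_simps mult_scaleC_left mult_scaleC_right ofc_def)
  finally have 1: "(ofc z - y * x) * w = 1"
    using assms(1) by (simp add: w_def mult_scaleC_right scaleC_scaleC ofc_def)
  have "(1 + y * v * x) * (ofc z - y * x) = ofc z + z *\<^sub>C (y * v * x) - y * x - y * (v * (x * y)) * x"
    by (simp add: algebra_simps ofc_mult o1)
  also have "\<dots> = ofc z"
    unfolding v1 by (simp add: algebra_simps mult_scaleC_left mult_scaleC_right ofc_def)
  finally have 2: "w * (ofc z - y * x) = 1"
    using assms(1) by (simp add: w_def mult_scaleC_left scaleC_scaleC ofc_def)
  show ?thesis using invertible1I[OF 1 2] by (simp add: spec1_def)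
qed

section \<open>The unitization as a C*-algebra\<close>

text \<open>A new type, since \<open>complex \<times> 'a\<close> already carries the Euclidean
  product norm, which is in general not a C*-norm.\<close>

datatype 'a unitization = Unitz (scal: complex) (elt: 'a)

instantiation unitization :: (cstar_algebra) ring_1
begin
definition "0 = Unitz 0 0"
definition "1 = Unitz 1 0"
definition "x + y = Unitz (scal x + scal y) (elt x + elt y)"
definition "x - y = Unitz (scal x - scal y) (elt x - elt y)"
definition "- x = Unitz (- scal x) (- elt x)"
definition "x * y = Unitz (scal x * scal y) (scal x *\<^sub>C elt y + scal y *\<^sub>C elt x + elt x * elt y)"
instance
  by standard
    (auto simp: zero_unitization_def one_unitization_def plus_unitization_def
      minus_unitization_def uminus_unitization_def times_unitization_def algebra_simps
      scaleC_scaleC mult_scaleC_left mult_scaleC_right scaleC_add_right scaleC_add_left)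
end

lemma unitization_simps [simp]:
  "scal 0 = 0" "elt (0 :: 'a::cstar_algebra unitization) = 0"
  "scal (1 :: 'a unitization) = 1" "elt (1 :: 'a unitization) = 0"
  "scal (x + y) = scal x + scal y" "elt (x + y :: 'a unitization) = elt x + elt y"
  "scal (x - y) = scal x - scal y" "elt (x - y) = elt x - elt y"
  "scal (- x) = - scal x" "elt (- x) = - elt x"
  "scal (x * y) = scal x * scal y"
  "elt (x * y) = scal x *\<^sub>C elt y + scal y *\<^sub>C elt x + elt x * elt y"
  by (auto simp: zero_unitization_def one_unitization_def plus_unitization_def
      minus_unitization_def uminus_unitization_def times_unitization_def)

text \<open>The norm is the maximum of the modulus of the scalar part and the operator norm of left
  multiplication on \<open>A\<close>; if \<open>A\<close> is unital, the latter alone is only a seminorm.\<close>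

definition uact :: "'a::cstar_algebra unitization \<Rightarrow> 'a \<Rightarrow> 'a" where
  "uact u x = scal u *\<^sub>C x + elt u * x"

lemma bounded_linear_uact: "bounded_linear (uact u)"
proof (rule bounded_linear_intro[of _ "cmod (scal u) + norm (elt u)"])
  fix x
  have "norm (uact u x) \<le> norm (scal u *\<^sub>C x) + norm (elt u * x)"
    unfolding uact_def by (rule norm_triangle_ineq)
  also have "\<dots> \<le> norm x * (cmod (scal u) + norm (elt u))"
    using norm_mult_ineq[of "elt u" x] by (simp add: norm_scaleC algebra_simps)
  finally show "norm (uact u x) \<le> norm x * (cmod (scal u) + norm (elt u))" .
qed (auto simp: uact_def scaleC_add_right scaleC_scaleR algebra_simps)

lemma uact_mult: "uact (u * v) x = uact u (uact v x)"
  by (simp add: uact_def scaleC_add_right scaleC_scaleC mult_scaleC_left mult_scaleC_right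
     distrib_left distrib_right mult.assoc)

lemma uact_add: "uact (u + v) x = uact u x + uact v x"
  by (simp add: uact_def scaleC_add_left algebra_simps)

lemma onorm_uact_nonneg: "onorm (uact u) \<ge> 0"
  by (rule onorm_pos_le[OF bounded_linear_uact])

lemma norm_uact: "norm (uact u x) \<le> onorm (uact u) * norm x"
  by (rule onorm[OF bounded_linear_uact])

lemma onorm_uact_le: "onorm (uact u) \<le> cmod (scal u) + norm (elt u)"
proof (rule onorm_bound)
  fix x
  have "norm (uact u x) \<le> norm (scal u *\<^sub>C x) + norm (elt u * x)"
    unfolding uact_def by (rule norm_triangle_ineq)
  also have "\<dots> \<le> (cmod (scal u) + norm (elt u)) * norm x"
    using norm_mult_ineq[of "elt u" x] by (simp add: norm_scaleC algebra_simps)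
  finally show "norm (uact u x) \<le> (cmod (scal u) + norm (elt u)) * norm x" .
qed auto

text \<open>Test the operator on \<open>star x\<close>, where the C*-identity gives the value
  \<open>(norm x)^2\<close>. Hence \<open>A\<close> embeds isometrically.\<close>

lemma norm_le_onorm_uact: "norm x \<le> onorm (uact (Unitz 0 x))"
proof (cases "x = 0")
  case False
  have "norm x * norm x = norm (uact (Unitz 0 x) (star x))"
    by (simp add: uact_def norm_mult_star power2_eq_square)
  also have "\<dots> \<le> onorm (uact (Unitz 0 x)) * norm x"
    using norm_uact[of "Unitz 0 x" "star x"] by simp
  finally show ?thesis using False by simp
qed (simp add: onorm_uact_nonneg)

instantiation unitization :: (cstar_algebra) real_algebra_1
begin
definition "r *\<^sub>R x = Unitz (r *\<^sub>R scal x) (r *\<^sub>R elt x)"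
instance
  by standard
    (auto simp: scaleR_unitization_def algebra_simps scaleC_of_real[symmetric] scaleC_scaleC
       scaleC_add_left scaleC_add_right mult_scaleC_left mult_scaleC_right
       scaleR_conv_of_real[where 'a = complex] intro!: unitization.expand)
end

lemma unitization_scaleR [simp]:
  "scal (r *\<^sub>R x) = r *\<^sub>R scal x" "elt (r *\<^sub>R x) = r *\<^sub>R elt x"
  by (auto simp: scaleR_unitization_def)

lemma uact_scaleR: "uact (r *\<^sub>R u) x = r *\<^sub>R uact u x"
proof -
  have "scal (r *\<^sub>R u) = complex_of_real r * scal u"
    by (simp add: scaleR_conv_of_real[where 'a = complex])
  then show ?thesis
    by (simp only: uact_def unitization_scaleR(2) scaleC_scaleC[symmetric] scaleC_of_real
        mult_scaleR_left scaleR_add_right)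
qed

instantiation unitization :: (cstar_algebra) real_normed_algebra_1
begin
definition "norm x = max (cmod (scal x)) (onorm (uact x))"
definition "dist (x::'a unitization) y = norm (x - y)"
definition "sgn (x::'a unitization) = inverse (norm x) *\<^sub>R x"
definition "(uniformity :: ('a unitization \<times> 'a unitization) filter) =
  (INF e\<in>{0 <..}. principal {(x, y). dist x y < e})"
definition "open (U :: 'a unitization set) \<longleftrightarrow>
  (\<forall>x\<in>U. eventually (\<lambda>(x', y). x' = x \<longrightarrow> y \<in> U) uniformity)"
instance
proof
  fix x y :: "'a unitization" and r :: real and U :: "'a unitization set"
  show "dist x y = norm (x - y)" by (rule dist_unitization_def)
  show "sgn x = inverse (norm x) *\<^sub>R x" by (rule sgn_unitization_def)
  show "(uniformity :: ('a unitization \<times> 'a unitization) filter) =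
    (INF e\<in>{0 <..}. principal {(x, y). dist x y < e})" by (rule uniformity_unitization_def)
  show "open U \<longleftrightarrow> (\<forall>x\<in>U. eventually (\<lambda>(x', y). x' = x \<longrightarrow> y \<in> U) uniformity)"
    by (rule open_unitization_def)
  show "norm x = 0 \<longleftrightarrow> x = 0"
  proof
    assume n: "norm x = 0"
    then have s: "scal x = 0" and o: "onorm (uact x) \<le> 0"
      unfolding norm_unitization_def using onorm_uact_nonneg[of x]
      by (smt (verit) norm_le_zero_iff)+
    have "x = Unitz 0 (elt x)" using s by (cases x) simp
    then have "norm (elt x) \<le> 0" using norm_le_onorm_uact[of "elt x"] o by (metis order.trans)
    with s show "x = 0" by (auto intro: unitization.expand)
  next
    assume "x = 0"
    then show "norm x = 0"
      unfolding norm_unitization_def using onorm_uact_le[of x] onorm_uact_nonneg[of x] by simp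
  qed
  show "norm (x + y) \<le> norm x + norm y"
  proof -
    have "onorm (uact (x + y)) \<le> onorm (uact x) + onorm (uact y)"
      unfolding uact_add[abs_def]
      by (rule onorm_triangle[OF bounded_linear_uact bounded_linear_uact])
    moreover have "cmod (scal x + scal y) \<le> cmod (scal x) + cmod (scal y)"
      by (rule norm_triangle_ineq)
    ultimately show ?thesis unfolding norm_unitization_def by (auto simp: max_def)
  qed
  show "norm (r *\<^sub>R x) = \<bar>r\<bar> * norm x"
    unfolding norm_unitization_def uact_scaleR[abs_def] onorm_scaleR[OF bounded_linear_uact]
    by (simp add: max_mult_distrib_left)
  show "norm (x * y) \<le> norm x * norm y"
  proof -
    have "onorm (uact (x * y)) \<le> onorm (uact x) * onorm (uact y)"
      using onorm_compose[OF bounded_linear_uact bounded_linear_uact, of x y]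
      by (simp add: uact_mult[abs_def] o_def)
    also have "\<dots> \<le> norm x * norm y"
      unfolding norm_unitization_def by (intro mult_mono) (auto simp: onorm_uact_nonneg le_max_iff_disj)
    finally have "onorm (uact (x * y)) \<le> norm x * norm y" .
    moreover have "cmod (scal x) * cmod (scal y) \<le> norm x * norm y"
      unfolding norm_unitization_def by (intro mult_mono) (auto simp: le_max_iff_disj)
    ultimately show ?thesis
      unfolding norm_unitization_def[of "x * y"] by (simp add: norm_mult)
  qed
  show "norm (1 :: 'a unitization) = 1"
    unfolding norm_unitization_def using onorm_uact_le[of "1 :: 'a unitization"] by simp
qed
end

lemma norm_Unitz_0: "norm (Unitz 0 x) = norm x"
  unfolding norm_unitization_def
  using norm_le_onorm_uact[of x] onorm_uact_le[of "Unitz 0 x"] by simp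

lemma norm_unitization_le: "norm u \<le> cmod (scal u) + norm (elt u)"
  unfolding norm_unitization_def using onorm_uact_le[of u] by simp

lemma norm_scal_le: "cmod (scal u) \<le> norm u"
  unfolding norm_unitization_def by simp

text \<open>Together with \<open>norm_scal_le\<close> this makes both components of a Cauchy
  sequence Cauchy, which gives completeness.\<close>

lemma norm_elt_le: "norm (elt u) \<le> 2 * norm u"
proof -
  have "Unitz 0 (elt u) = u - Unitz (scal u) 0"
    by (rule unitization.expand) simp
  then have "norm (elt u) \<le> norm u + norm (Unitz (scal u) (0::'a))"
    by (metis norm_Unitz_0 norm_triangle_ineq4)
  also have "norm (Unitz (scal u) (0::'a)) \<le> cmod (scal u)"
    using norm_unitization_le[of "Unitz (scal u) (0::'a)"] by simp
  finally show ?thesis using norm_scal_le[of u] by simp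
qed

instantiation unitization :: (cstar_algebra) cstar_algebra
begin
definition "c *\<^sub>C x = Unitz (c * scal x) (c *\<^sub>C elt x)"
definition "star x = Unitz (cnj (scal x)) (star (elt x))"
instance
proof
  fix x y :: "'a unitization" and c d :: complex and r :: real
  note defs = scaleC_unitization_def star_unitization_def
  show "c *\<^sub>C (x + y) = c *\<^sub>C x + c *\<^sub>C y" "(c + d) *\<^sub>C x = c *\<^sub>C x + d *\<^sub>C x"
    "c *\<^sub>C (d *\<^sub>C x) = (c * d) *\<^sub>C x" "complex_of_real r *\<^sub>C x = r *\<^sub>R x"
    "(c *\<^sub>C x) * y = c *\<^sub>C (x * y)" "x * (c *\<^sub>C y) = c *\<^sub>C (x * y)"
    "star (x + y) = star x + star y" "star (c *\<^sub>C x) = cnj c *\<^sub>C star x"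
    "star (x * y) = star y * star x" "star (star x) = x"
    by (auto simp: defs algebra_simps scaleC_add_left scaleC_add_right scaleC_scaleC
        scaleC_of_real mult_scaleC_left mult_scaleC_right star_add star_scaleC star_mult star_star
        scaleR_conv_of_real[where 'a = complex] intro!: unitization.expand)
  have uc: "uact (c *\<^sub>C x) v = c *\<^sub>C uact x v" for c x and v :: 'a
    by (simp add: uact_def defs scaleC_add_right scaleC_scaleC mult_scaleC_left)
  have le: "onorm (uact (c *\<^sub>C x)) \<le> cmod c * onorm (uact x)" for c and x :: "'a unitization"
  proof (rule onorm_bound)
    fix v
    show "norm (uact (c *\<^sub>C x) v) \<le> cmod c * onorm (uact x) * norm v"
      unfolding uc norm_scaleC using mult_left_mono[OF norm_uact[of x v], of "cmod c"]
      by (simp add: mult.assoc)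
  qed (simp add: onorm_uact_nonneg)
  have "onorm (uact (c *\<^sub>C x)) = cmod c * onorm (uact x)"
  proof (cases "c = 0")
    case True
    then show ?thesis using le[of c x] onorm_uact_nonneg[of "c *\<^sub>C x"] by simp
  next
    case False
    have "(1/c) *\<^sub>C (c *\<^sub>C x) = x"
      using False by (auto simp: defs scaleC_scaleC intro!: unitization.expand)
    then have "onorm (uact x) \<le> cmod (1/c) * onorm (uact (c *\<^sub>C x))"
      using le[of "1/c" "c *\<^sub>C x"] by simp
    then have "cmod c * onorm (uact x) \<le> onorm (uact (c *\<^sub>C x))"
      using False by (simp add: norm_divide field_simps)
    with le[of c x] show ?thesis by simp
  qed
  then show "norm (c *\<^sub>C x) = cmod c * norm x"
    unfolding norm_unitization_def by (simp add: defs norm_mult max_mult_distrib_left)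
  \<comment> \<open>For the \<open>A\<close>-valued pairing \<open>star v * w\<close>, the action of
    \<open>star x\<close> is adjoint to that of \<open>x\<close>. This carries over the usual proof
    of the C*-identity for operators on a Hilbert space.\<close>
  have star_uact: "star (uact x v) * w = star v * uact (star x) w" for x :: "'a unitization" and v w
    by (simp add: uact_def defs star_add star_scaleC star_mult distrib_left distrib_right
        mult_scaleC_left mult_scaleC_right mult.assoc)
  have smult: "star x * y = Unitz (cnj (scal x) * scal y)
       (cnj (scal x) *\<^sub>C elt y + scal y *\<^sub>C star (elt x) + star (elt x) * elt y)" for x y :: "'a unitization"
    by (rule unitization.expand) (simp add: defs)
  have sq: "onorm (uact x) ^ 2 \<le> onorm (uact (star x * x))" for x :: "'a unitization"
  proof -
    let ?s = "onorm (uact (star x * x))"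
    have "onorm (uact x) \<le> sqrt ?s"
    proof (rule onorm_bound)
      fix v
      have "norm (uact x v) ^ 2 = norm (star (uact x v) * uact x v)"
        by (simp add: cstar_identity)
      also have "\<dots> = norm (star v * uact (star x * x) v)"
        by (simp add: star_uact uact_mult)
      also have "\<dots> \<le> norm v * (?s * norm v)"
        using norm_mult_ineq[of "star v" "uact (star x * x) v"]
          mult_left_mono[OF norm_uact[of "star x * x" v], of "norm v"] by simp
      finally have "norm (uact x v) ^ 2 \<le> (sqrt ?s * norm v) ^ 2"
        by (simp add: power_mult_distrib onorm_uact_nonneg power2_eq_square[of "norm v"] ac_simps)
      then show "norm (uact x v) \<le> sqrt ?s * norm v"
        by (rule power2_le_imp_le) (simp add: onorm_uact_nonneg)
    qed (simp add: onorm_uact_nonneg)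
    then have "onorm (uact x) ^ 2 \<le> sqrt ?s ^ 2"
      by (rule power_mono) (rule onorm_uact_nonneg)
    then show ?thesis by (simp add: onorm_uact_nonneg)
  qed
  have sub: "onorm (uact (star x * x)) \<le> onorm (uact (star x)) * onorm (uact x)" for x :: "'a unitization"
    using onorm_compose[OF bounded_linear_uact bounded_linear_uact, of "star x" x]
    by (simp add: uact_mult[abs_def] o_def)
  have le: "onorm (uact x) \<le> onorm (uact (star x))" for x :: "'a unitization"
  proof (cases "onorm (uact x) = 0")
    case False
    then have "onorm (uact x) > 0" using onorm_uact_nonneg[of x] by simp
    moreover have "onorm (uact x) * onorm (uact x) \<le> onorm (uact (star x)) * onorm (uact x)"
      using sq[of x] sub[of x] by (simp add: power2_eq_square)
    ultimately show ?thesis by simp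
  qed (simp add: onorm_uact_nonneg)
  have ss: "star (star x) = x" by (auto simp: defs star_star intro!: unitization.expand)
  have "onorm (uact (star x * x)) = onorm (uact x) ^ 2"
    using sq[of x] sub[of x] le[of x] le[of "star x"] ss by (simp add: power2_eq_square)
  moreover have "cmod (scal (star x * x)) = cmod (scal x) ^ 2"
    by (simp add: defs norm_mult power2_eq_square)
  ultimately show "norm (star x * x) = (norm x)\<^sup>2"
    unfolding norm_unitization_def
    by (auto simp: max_def onorm_uact_nonneg power2_le_iff_abs_le abs_of_nonneg)
next
  fix X :: "nat \<Rightarrow> 'a unitization"
  assume X: "Cauchy X"
  have "Cauchy (\<lambda>n. scal (X n))"
  proof (rule CauchyI)
    fix e :: real assume "e > 0"
    with X obtain M where M: "\<forall>m\<ge>M. \<forall>n\<ge>M. norm (X m - X n) < e"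
      using CauchyD by blast
    have "cmod (scal (X m) - scal (X n)) < e" if "m \<ge> M" "n \<ge> M" for m n
      using M that norm_scal_le[of "X m - X n"] by fastforce
    then show "\<exists>M. \<forall>m\<ge>M. \<forall>n\<ge>M. cmod (scal (X m) - scal (X n)) < e" by blast
  qed
  then obtain l where l: "(\<lambda>n. scal (X n)) \<longlonglongrightarrow> l"
    using Cauchy_convergent_iff convergent_def by blast
  have "Cauchy (\<lambda>n. elt (X n))"
  proof (rule CauchyI)
    fix e :: real assume "e > 0"
    then have "e/2 > 0" by simp
    with X obtain M where M: "\<forall>m\<ge>M. \<forall>n\<ge>M. norm (X m - X n) < e/2"
      using CauchyD by blast
    have "norm (elt (X m) - elt (X n)) < e" if "m \<ge> M" "n \<ge> M" for m n
      using M that norm_elt_le[of "X m - X n"] by fastforce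
    then show "\<exists>M. \<forall>m\<ge>M. \<forall>n\<ge>M. norm (elt (X m) - elt (X n)) < e" by blast
  qed
  then obtain a where a: "(\<lambda>n. elt (X n)) \<longlonglongrightarrow> a"
    using Cauchy_convergent_iff convergent_def by blast
  have "(\<lambda>n. X n - Unitz l a) \<longlonglongrightarrow> 0"
  proof (rule Lim_null_comparison)
    show "\<forall>\<^sub>F n in sequentially. norm (X n - Unitz l a) \<le> cmod (scal (X n) - l) + norm (elt (X n) - a)"
      using norm_unitization_le[of "X _ - Unitz l a"] by (intro always_eventually) simp
    have "(\<lambda>n. cmod (scal (X n) - l) + norm (elt (X n) - a)) \<longlonglongrightarrow> cmod (l - l) + norm (a - a)"
      by (intro tendsto_intros l a)
    then show "(\<lambda>n. cmod (scal (X n) - l) + norm (elt (X n) - a)) \<longlonglongrightarrow> 0" by simp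
  qed
  then show "convergent X"
    by (rule convergentI[OF LIM_zero_cancel])
qed
end

lemma unitization_scaleC [simp]:
  "scal (c *\<^sub>C x) = c * scal x" "elt (c *\<^sub>C x) = c *\<^sub>C elt x"
  "scal (star x) = cnj (scal x)" "elt (star x) = star (elt x)"
  by (auto simp: scaleC_unitization_def star_unitization_def)

instance unitization :: (cstar_algebra) cstar_algebra_1 ..

section \<open>The embedding into the unitization and comparison of spectra\<close>

definition emb :: "'a::cstar_algebra \<Rightarrow> 'a unitization" where "emb a = Unitz 0 a"

lemma emb_simps: "emb (a + b) = emb a + emb b" "emb (a - b) = emb a - emb b" "emb (- a) = - emb a"
  "emb (a * b) = emb a * emb b" "emb (r *\<^sub>R a) = r *\<^sub>R emb a" "emb (c *\<^sub>C a) = c *\<^sub>C emb a"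
  "star (emb a) = emb (star a)" "emb 0 = 0"
  by (auto simp: emb_def intro!: unitization.expand)

lemma norm_emb [simp]: "norm (emb a) = norm a"
  by (simp add: emb_def norm_Unitz_0)

lemma emb_inject [simp]: "emb a = emb b \<longleftrightarrow> a = b"
  by (simp add: emb_def)

lemma scal_emb [simp]: "scal (emb a) = 0"
  by (simp add: emb_def)

lemma spectrum_emb: "spectrum a = spec1 (emb a)"
proof -
  have "unitization_invertible (z, - a) \<longleftrightarrow> invertible1 (ofc z - emb a)" for z
  proof -
    have e: "ofc z - emb a = Unitz z (- a)"
      by (rule unitization.expand) (simp add: ofc_def emb_def)
    have p: "(\<exists>v. P v) \<longleftrightarrow> (\<exists>c b. P (c, b))" for P :: "complex \<times> 'a \<Rightarrow> bool" by auto
    have q: "(\<exists>v. P v) \<longleftrightarrow> (\<exists>c b. P (Unitz c b))" for P :: "'a unitization \<Rightarrow> bool"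
      by (metis unitization.exhaust)
    show ?thesis
      unfolding unitization_invertible_def invertible1_def e p q unitization_mult_def
      by (simp add: times_unitization_def one_unitization_def)
  qed
  then show ?thesis by (auto simp: spectrum_def spec1_def)
qed

lemma zero_in_spectrum: "0 \<in> spectrum a"
proof -
  have "\<not> invertible1 (ofc 0 - emb a)"
    by (auto simp: invertible1_def ofc_simps one_unitization_def times_unitization_def)
  then show ?thesis by (simp add: spectrum_emb spec1_def)
qed

text \<open>Positivity in a unital algebra, in particular in \<open>'a unitization\<close>, is
  defined through a further unitization, and this lemma removes the extra layer. One direction
  applies the unital homomorphism \<open>(c, a) \<mapsto> c + a\<close>; the other writes an inverse
  \<open>v\<close> of \<open>z - u\<close> as scalar part \<open>1 / z\<close> plus the
  rest.\<close>

lemma spectrum_unital: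
  fixes u :: "'u::cstar_algebra_1"
  shows "spectrum u = insert 0 (spec1 u)"
proof -
  have "z \<in> spectrum u \<longleftrightarrow> z \<in> spec1 u" if z: "z \<noteq> 0" for z
  proof
    assume "z \<in> spec1 u"
    show "z \<in> spectrum u"
    proof (rule ccontr)
      assume "z \<notin> spectrum u"
      then obtain v where v: "(ofc z - emb u) * v = 1" "v * (ofc z - emb u) = 1"
        by (auto simp: spectrum_emb spec1_def invertible1_def)
      define \<phi> where "\<phi> w = ofc (scal w) + elt w" for w :: "'u unitization"
      have hom: "\<phi> (x * y) = \<phi> x * \<phi> y" "\<phi> 1 = 1" "\<phi> (x - y) = \<phi> x - \<phi> y" for x y
        by (auto simp: \<phi>_def ofc_simps scaleC_add_right distrib_left distrib_right ofc_mult)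
      have "\<phi> (ofc z - emb u) = ofc z - u"
        by (simp add: \<phi>_def ofc_def emb_def)
      with v hom have "(ofc z - u) * \<phi> v = 1" "\<phi> v * (ofc z - u) = 1" by metis+
      with \<open>z \<in> spec1 u\<close> show False by (auto simp: spec1_def invertible1_def)
    qed
  next
    assume "z \<in> spectrum u"
    show "z \<in> spec1 u"
    proof (rule ccontr)
      assume "z \<notin> spec1 u"
      then obtain v where v: "(ofc z - u) * v = 1" "v * (ofc z - u) = 1"
        by (auto simp: spec1_def invertible1_def)
      define w where "w = Unitz (1/z) (v - ofc (1/z))"
      have e: "ofc z - emb u = Unitz z (- u)"
        by (rule unitization.expand) (simp add: ofc_def emb_def)
      have v': "z *\<^sub>C v = 1 + u * v" "z *\<^sub>C v = 1 + v * u"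
        using v by (auto simp: algebra_simps ofc_mult)
      have zz: "z *\<^sub>C ofc (1/z) = (1::'u)" using z by (simp add: ofc_def scaleC_scaleC)
      have z1: "z *\<^sub>C (v - ofc (1/z)) = z *\<^sub>C v - 1"
        using zz by (simp add: complex_vector.scale_right_diff_distrib)
      have 1: "z *\<^sub>C (v - ofc (1/z)) + (1/z) *\<^sub>C (- u) + (- u) * (v - ofc (1/z)) = 0"
        unfolding z1 v'(1) by (simp add: right_diff_distrib ofc_mult)
      have 2: "(1/z) *\<^sub>C (- u) + z *\<^sub>C (v - ofc (1/z)) + (v - ofc (1/z)) * (- u) = 0"
        unfolding z1 v'(2) by (simp add: left_diff_distrib ofc_mult)
      have "(ofc z - emb u) * w = 1" "w * (ofc z - emb u) = 1"
        using z 1 2 unfolding e w_def times_unitization_def one_unitization_def by simp_all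
      with \<open>z \<in> spectrum u\<close> show False by (auto simp: spectrum_emb spec1_def invertible1_def)
    qed
  qed
  with zero_in_spectrum[of u] have "z \<in> spectrum u \<longleftrightarrow> z \<in> insert 0 (spec1 u)" for z
    by (cases "z = 0") auto
  then show ?thesis by blast
qed

lemma spectrum_commute:
  assumes "z \<noteq> 0" shows "z \<in> spectrum (x * y) \<longleftrightarrow> z \<in> spectrum (y * x)"
  using spec1_commute[OF assms, of "emb x" "emb y"] spec1_commute[OF assms, of "emb y" "emb x"]
  unfolding spectrum_emb emb_simps(4) by blast

section \<open>Functional calculus\<close>

lemma npow_1 [simp]: "npow x (Suc 0) = x"
  by (simp add: npow_def)

lemma npow_Suc: "n \<ge> 1 \<Longrightarrow> npow x (Suc n) = x * npow x n"
  by (cases n) (auto simp: npow_def)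

lemma emb_npow: "n \<ge> 1 \<Longrightarrow> emb (npow x n) = emb x ^ n"
proof (induction n)
  case (Suc n)
  then show ?case by (cases "n = 0") (auto simp: npow_Suc emb_simps)
qed simp

lemma npow_add: "m \<ge> 1 \<Longrightarrow> n \<ge> 1 \<Longrightarrow> npow x (m + n) = npow x m * npow x n"
  by (subst emb_inject[symmetric]) (simp add: emb_npow emb_simps power_add)

lemma npow_mult: "m \<ge> 1 \<Longrightarrow> n \<ge> 1 \<Longrightarrow> npow x (m * n) = npow (npow x m) n"
  by (subst emb_inject[symmetric]) (simp add: emb_npow emb_simps power_mult)

lemma star_npow: "n \<ge> 1 \<Longrightarrow> star (npow x n) = npow (star x) n"
  by (subst emb_inject[symmetric]) (simp add: emb_npow star_power flip: emb_simps(7))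

lemma npow_scaleR: "n \<ge> 1 \<Longrightarrow> npow (r *\<^sub>R x) n = r ^ n *\<^sub>R npow x n"
  by (subst emb_inject[symmetric]) (simp add: emb_npow emb_simps scaleR_power)

lemma npow_mult_star:
  assumes "n \<ge> 1" shows "npow (x * y) (Suc n) = x * npow (y * x) n * y"
proof -
  have "(u * v) ^ Suc n = u * (v * u) ^ n * v" for u v :: "'a unitization"
    by (induction n) (simp_all add: mult.assoc power_commutes)
  from this[of "emb x" "emb y"] show ?thesis
    using assms by (subst emb_inject[symmetric]) (simp add: emb_npow emb_simps)
qed

lemma emb_sum: "emb (\<Sum>i\<in>S. f i) = (\<Sum>i\<in>S. emb (f i))"
  by (induction S rule: infinite_finite_induct) (auto simp: emb_simps)

lemma emb_poly_eval:
  assumes "coeff p 0 = 0" shows "emb (poly_eval p a) = rpoly p (emb a)"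
proof -
  have "rpoly p (emb a) = (\<Sum>i\<in>{1..degree p}. coeff p i *\<^sub>R emb a ^ i)"
    unfolding rpoly_sum by (rule sum.mono_neutral_right) (use assms in \<open>auto simp: Suc_le_eq\<close>)
  also have "\<dots> = (\<Sum>i\<in>{1..degree p}. emb (coeff p i *\<^sub>R npow a i))"
    by (intro sum.cong) (auto simp: emb_simps emb_npow)
  finally show ?thesis by (simp add: poly_eval_def emb_sum)
qed

definition rspec :: "'a::cstar_algebra \<Rightarrow> real set" where
  "rspec a = {t. complex_of_real t \<in> spectrum a}"

lemma star_emb: "star a = a \<Longrightarrow> star (emb a) = emb a"
  by (simp add: emb_simps)

lemma spectrum_real: "star a = a \<Longrightarrow> z \<in> spectrum a \<Longrightarrow> z = complex_of_real (Re z) \<and> Re z \<in> rspec a"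
proof -
  assume a: "star a = a" and z: "z \<in> spectrum a"
  have "Im z = 0"
    using spec1_selfadjoint_real[OF star_emb[OF a]] z by (simp add: spectrum_emb)
  then have "z = complex_of_real (Re z)" by (simp add: complex_eq_iff)
  with z show ?thesis by (auto simp: rspec_def)
qed

lemma zero_in_rspec [simp]: "0 \<in> rspec a"
  using zero_in_spectrum[of a] by (simp add: rspec_def)

lemma rspec_bound: "t \<in> rspec a \<Longrightarrow> \<bar>t\<bar> \<le> norm a"
  using spec1_bound[of "of_real t" "emb a"] by (simp add: rspec_def spectrum_emb)

lemma compact_rspec: "compact (rspec a)"
proof -
  have "rspec a = complex_of_real -` spec1 (emb a)"
    by (auto simp: rspec_def spectrum_emb)
  moreover have "closed (complex_of_real -` spec1 (emb a))"
    by (rule closed_vimage[OF closed_spec1]) (intro continuous_intros)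
  moreover have "bounded (rspec a)"
    by (rule boundedI[of _ "norm a"]) (simp add: rspec_bound)
  ultimately show ?thesis by (simp add: compact_eq_bounded_closed)
qed

lemma rspec_norm_attained:
  assumes "star a = a" shows "\<exists>t\<in>rspec a. \<bar>t\<bar> = norm a"
proof -
  obtain z where z: "z \<in> spectrum a" "cmod z = norm a"
    using spec1_norm_attained[OF star_emb[OF assms]] by (auto simp: spectrum_emb)
  then show ?thesis using spectrum_real[OF assms z(1)] by (metis norm_of_real)
qed

section \<open>Existence of the functional calculus\<close>

definition cfc_dom :: "'a::cstar_algebra \<Rightarrow> (real \<Rightarrow> real) \<Rightarrow> bool" where
  "cfc_dom a f \<longleftrightarrow> star a = a \<and> continuous_on (rspec a) f \<and> f 0 = 0"

text \<open>Since \<open>0\<close> always lies in \<open>rspec a\<close> and \<open>f 0 = 0\<close>,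
  removing the constant term of a Weierstrass approximant at most doubles the error.\<close>

lemma cfc_dom_approx:
  assumes "cfc_dom a f"
  shows "\<exists>p. (\<forall>k. coeff (p k) 0 = 0) \<and> uniform_limit (rspec a) (\<lambda>k. poly (p k)) f sequentially"
proof -
  have "\<exists>p. coeff p 0 = 0 \<and> (\<forall>x\<in>rspec a. \<bar>poly p x - f x\<bar> < 1 / Suc k)" for k
  proof -
    have e: "(0::real) < 1 / (2 * Suc k)" by simp
    obtain g where g: "real_polynomial_function g"
      "\<And>x. x \<in> rspec a \<Longrightarrow> \<bar>f x - g x\<bar> < 1 / (2 * Suc k)"
      using Stone_Weierstrass_real_polynomial_function[OF compact_rspec _ e, of a f] assms
      unfolding cfc_dom_def by blast
    obtain c n where c: "g = (\<lambda>x. \<Sum>i\<le>n. c i * x ^ i)"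
      using real_polynomial_function_imp_sum[OF g(1)] by blast
    define q where "q = (\<Sum>i\<le>n. monom (c i) i)"
    have q: "poly q x = g x" for x
      by (simp add: q_def c poly_sum poly_monom)
    define p where "p = q - [:poly q 0:]"
    have "coeff p 0 = 0" by (simp add: p_def poly_0_coeff_0)
    moreover have "\<bar>poly p x - f x\<bar> < 1 / Suc k" if "x \<in> rspec a" for x
    proof -
      have "f 0 = 0" using assms by (simp add: cfc_dom_def)
      then have "\<bar>g 0\<bar> < 1 / (2 * Suc k)" using g(2)[of 0] by simp
      moreover have "\<bar>f x - g x\<bar> < 1 / (2 * Suc k)" using g(2) that by blast
      ultimately have "\<bar>g x - g 0 - f x\<bar> < 1 / (2 * Suc k) + 1 / (2 * Suc k)" by linarith
      then show ?thesis by (simp add: p_def q field_simps)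
    qed
    ultimately show ?thesis by blast
  qed
  then obtain p where p: "\<And>k. coeff (p k) 0 = 0"
    "\<And>k x. x \<in> rspec a \<Longrightarrow> \<bar>poly (p k) x - f x\<bar> < 1 / Suc k" by metis
  have "uniform_limit (rspec a) (\<lambda>k. poly (p k)) f sequentially"
  proof (rule uniform_limitI)
    fix e :: real assume "e > 0"
    then obtain N where N: "1 / real (Suc N) < e" using nat_approx_posE by blast
    show "\<forall>\<^sub>F k in sequentially. \<forall>x\<in>rspec a. dist (poly (p k) x) (f x) < e"
      unfolding eventually_sequentially
    proof (intro exI[of _ N] allI impI ballI)
      fix k x assume "N \<le> k" "x \<in> rspec a"
      moreover have "1 / real (Suc k) \<le> 1 / real (Suc N)"
        using \<open>N \<le> k\<close> by (intro divide_left_mono) auto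
      ultimately show "dist (poly (p k) x) (f x) < e"
        using p(2)[of x k] N by (simp add: dist_real_def)
    qed
  qed
  with p(1) show ?thesis by blast
qed

lemma norm_poly_eval_le:
  assumes "star a = a" "coeff p 0 = 0" "\<And>t. t \<in> rspec a \<Longrightarrow> \<bar>poly p t\<bar> \<le> B"
  shows "norm (poly_eval p a) \<le> B"
proof -
  have "norm (rpoly p (emb a)) \<le> B"
    by (rule norm_rpoly_le[OF star_emb[OF assms(1)]])
       (use assms(3) in \<open>simp add: rspec_def spectrum_emb\<close>)
  then show ?thesis
    using emb_poly_eval[OF assms(2), of a] norm_emb[of "poly_eval p a"] by simp
qed

lemma poly_eval_hom:
  assumes "coeff p 0 = 0" "coeff q 0 = 0"
  shows "poly_eval (p + q) a = poly_eval p a + poly_eval q a"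
    "poly_eval (p - q) a = poly_eval p a - poly_eval q a"
    "poly_eval (p * q) a = poly_eval p a * poly_eval q a"
    "poly_eval (smult r p) a = r *\<^sub>R poly_eval p a"
  by (subst emb_inject[symmetric], simp add: emb_poly_eval assms emb_simps rpoly_hom coeff_mult)+

lemma star_poly_eval:
  assumes "star a = a" "coeff p 0 = 0"
  shows "star (poly_eval p a) = poly_eval p a"
proof -
  have "emb (star (poly_eval p a)) = emb (poly_eval p a)"
    by (simp only: emb_simps(7)[symmetric] emb_poly_eval[OF assms(2)]
        star_rpoly[OF star_emb[OF assms(1)]])
  then show ?thesis by simp
qed

text \<open>Shows that the definite description in \<open>cfc\<close> denotes: any two approximating
  sequences become uniformly close on the spectrum, hence close in norm, so all share one limit.
  That at least one such sequence exists makes the limit unique.\<close>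

lemma cfc_limit:
  assumes dom: "cfc_dom a f" and p: "\<And>k. coeff (p k) 0 = 0"
    "uniform_limit (rspec a) (\<lambda>k. poly (p k)) f sequentially"
  shows "(\<lambda>k. poly_eval (p k) a) \<longlonglongrightarrow> cfc f a"
proof -
  have a: "star a = a" using dom by (simp add: cfc_dom_def)
  have near: "\<exists>N. \<forall>m\<ge>N. \<forall>n\<ge>N. norm (poly_eval (r m) a - poly_eval (q n) a) < e"
    if r: "\<And>k. coeff (r k) 0 = 0" "uniform_limit (rspec a) (\<lambda>k. poly (r k)) f sequentially"
     and q: "\<And>k. coeff (q k) 0 = 0" "uniform_limit (rspec a) (\<lambda>k. poly (q k)) f sequentially"
     and e: "e > 0" for r q :: "nat \<Rightarrow> real poly" and e :: real
  proof -
    have e4: "e/4 > 0" using e by simp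
    obtain N1 where N1: "\<forall>n\<ge>N1. \<forall>x\<in>rspec a. dist (poly (r n) x) (f x) < e/4"
      using r(2) e4 unfolding uniform_limit_sequentially_iff by blast
    obtain N2 where N2: "\<forall>n\<ge>N2. \<forall>x\<in>rspec a. dist (poly (q n) x) (f x) < e/4"
      using q(2) e4 unfolding uniform_limit_sequentially_iff by blast
    show ?thesis
    proof (intro exI[of _ "max N1 N2"] allI impI)
      fix m n assume mn: "max N1 N2 \<le> m" "max N1 N2 \<le> n"
      have "norm (poly_eval (r m - q n) a) \<le> e/2"
      proof (rule norm_poly_eval_le[OF a])
        fix t assume t: "t \<in> rspec a"
        have "\<bar>poly (r m) t - f t\<bar> < e/4" "\<bar>poly (q n) t - f t\<bar> < e/4"
          using N1 N2 mn t by (auto simp: dist_real_def)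
        then show "\<bar>poly (r m - q n) t\<bar> \<le> e/2" unfolding poly_diff by linarith
      qed (simp add: r q)
      then show "norm (poly_eval (r m) a - poly_eval (q n) a) < e"
        using e by (simp add: poly_eval_hom r(1) q(1))
    qed
  qed
  obtain q where q: "\<And>k. coeff (q k) 0 = 0"
    "uniform_limit (rspec a) (\<lambda>k. poly (q k)) f sequentially"
    using cfc_dom_approx[OF dom] by blast
  have "Cauchy (\<lambda>k. poly_eval (q k) a)"
    by (rule CauchyI) (rule near[OF q q])
  then obtain b where b: "(\<lambda>k. poly_eval (q k) a) \<longlonglongrightarrow> b"
    using Cauchy_convergent_iff convergent_def by blast
  have all: "(\<lambda>k. poly_eval (r k) a) \<longlonglongrightarrow> b"
    if r: "\<And>k. coeff (r k) 0 = 0" "uniform_limit (rspec a) (\<lambda>k. poly (r k)) f sequentially" for r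
  proof -
    have "(\<lambda>k. poly_eval (r k) a - poly_eval (q k) a) \<longlonglongrightarrow> 0"
    proof (rule LIMSEQ_I)
      fix e :: real assume "e > 0"
      from near[OF r q this]
      show "\<exists>no. \<forall>n\<ge>no. norm (poly_eval (r n) a - poly_eval (q n) a - 0) < e" by auto
    qed
    from tendsto_add[OF this b] show ?thesis by simp
  qed
  let ?P = "\<lambda>b. \<forall>p :: nat \<Rightarrow> real poly. (\<forall>k. coeff (p k) 0 = 0) \<and>
     uniform_limit (rspec a) (\<lambda>k. poly (p k)) f sequentially \<longrightarrow> (\<lambda>k. poly_eval (p k) a) \<longlonglongrightarrow> b"
  have "?P b" using all by blast
  moreover have "b' = b" if "?P b'" for b'
    using that q b LIMSEQ_unique by blast
  ultimately have "cfc f a = b"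
    unfolding cfc_def rspec_def[symmetric] by (rule the_equality)
  with all[OF p] show ?thesis by simp
qed

lemma cfc_eqI:
  assumes "cfc_dom a f" "\<And>k. coeff (p k) 0 = 0"
    "uniform_limit (rspec a) (\<lambda>k. poly (p k)) f sequentially" "(\<lambda>k. poly_eval (p k) a) \<longlonglongrightarrow> b"
  shows "cfc f a = b"
  using LIMSEQ_unique[OF cfc_limit[OF assms(1-3)] assms(4)] .

section \<open>Algebraic rules and norm estimate for the functional calculus\<close>

lemma poly_fun:
  "poly (p + q) = (\<lambda>x. poly p x + poly q x)" "poly (p * q) = (\<lambda>x. poly p x * poly q x)"
  "poly (smult r p) = (\<lambda>x. r * poly p x)" "poly [:0, 1:] = (\<lambda>x. x :: real)"
  for p q :: "real poly"
  by (auto simp: fun_eq_iff)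

lemma cfc_dom_bounded: "cfc_dom a f \<Longrightarrow> bounded (f ` rspec a)"
  using compact_continuous_image[OF _ compact_rspec] compact_imp_bounded
  by (auto simp: cfc_dom_def)

lemma cfc_dom_mult: "cfc_dom a f \<Longrightarrow> cfc_dom a g \<Longrightarrow> cfc_dom a (\<lambda>t. f t * g t)"
  by (auto simp: cfc_dom_def intro: continuous_intros)

lemma cfc_dom_add: "cfc_dom a f \<Longrightarrow> cfc_dom a g \<Longrightarrow> cfc_dom a (\<lambda>t. f t + g t)"
  by (auto simp: cfc_dom_def intro: continuous_intros)

lemma cfc_dom_diff: "cfc_dom a f \<Longrightarrow> cfc_dom a g \<Longrightarrow> cfc_dom a (\<lambda>t. f t - g t)"
  by (auto simp: cfc_dom_def intro: continuous_intros)

lemma cfc_dom_scale: "cfc_dom a f \<Longrightarrow> cfc_dom a (\<lambda>t. r * f t)"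
  by (auto simp: cfc_dom_def intro: continuous_intros)

lemma cfc_dom_id: "star a = a \<Longrightarrow> cfc_dom a (\<lambda>t. t)"
  by (auto simp: cfc_dom_def intro: continuous_intros)

lemma cfc_dom_power: "star a = a \<Longrightarrow> n \<ge> 1 \<Longrightarrow> cfc_dom a (\<lambda>t. t ^ n)"
  by (auto simp: cfc_dom_def intro: continuous_intros)

lemma cfc_add:
  assumes f: "cfc_dom a f" and g: "cfc_dom a g"
  shows "cfc (\<lambda>t. f t + g t) a = cfc f a + cfc g a"
proof -
  obtain p where p: "\<And>k. coeff (p k) 0 = 0"
    "uniform_limit (rspec a) (\<lambda>k. poly (p k)) f sequentially"
    using cfc_dom_approx[OF f] by blast
  obtain q where q: "\<And>k. coeff (q k) 0 = 0"
    "uniform_limit (rspec a) (\<lambda>k. poly (q k)) g sequentially"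
    using cfc_dom_approx[OF g] by blast
  show ?thesis
  proof (rule cfc_eqI[OF cfc_dom_add[OF f g], where p = "\<lambda>k. p k + q k"])
    show "uniform_limit (rspec a) (\<lambda>k. poly (p k + q k)) (\<lambda>t. f t + g t) sequentially"
      using uniform_limit_add[OF p(2) q(2)] by (simp add: poly_fun)
    show "(\<lambda>k. poly_eval (p k + q k) a) \<longlonglongrightarrow> cfc f a + cfc g a"
      unfolding poly_eval_hom[OF p(1) q(1)]
      by (intro tendsto_add cfc_limit f g p q)
  qed (simp add: p q)
qed

lemma cfc_mult:
  assumes f: "cfc_dom a f" and g: "cfc_dom a g"
  shows "cfc (\<lambda>t. f t * g t) a = cfc f a * cfc g a"
proof -
  obtain p where p: "\<And>k. coeff (p k) 0 = 0"
    "uniform_limit (rspec a) (\<lambda>k. poly (p k)) f sequentially"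
    using cfc_dom_approx[OF f] by blast
  obtain q where q: "\<And>k. coeff (q k) 0 = 0"
    "uniform_limit (rspec a) (\<lambda>k. poly (q k)) g sequentially"
    using cfc_dom_approx[OF g] by blast
  show ?thesis
  proof (rule cfc_eqI[OF cfc_dom_mult[OF f g], where p = "\<lambda>k. p k * q k"])
    show "uniform_limit (rspec a) (\<lambda>k. poly (p k * q k)) (\<lambda>t. f t * g t) sequentially"
      using uniform_lim_mult[OF p(2) q(2) cfc_dom_bounded[OF f] cfc_dom_bounded[OF g]]
      by (simp add: poly_fun)
    show "(\<lambda>k. poly_eval (p k * q k) a) \<longlonglongrightarrow> cfc f a * cfc g a"
      unfolding poly_eval_hom[OF p(1) q(1)]
      by (intro tendsto_mult cfc_limit f g p q)
  qed (simp add: p q coeff_mult)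
qed

lemma star_cfc:
  assumes f: "cfc_dom a f" shows "star (cfc f a) = cfc f a"
proof -
  obtain p where p: "\<And>k. coeff (p k) 0 = 0"
    "uniform_limit (rspec a) (\<lambda>k. poly (p k)) f sequentially"
    using cfc_dom_approx[OF f] by blast
  have l: "(\<lambda>k. poly_eval (p k) a) \<longlonglongrightarrow> cfc f a" by (rule cfc_limit[OF f p])
  have "star (poly_eval (p k) a) = poly_eval (p k) a" for k
    by (rule star_poly_eval[OF _ p(1)]) (use f in \<open>simp add: cfc_dom_def\<close>)
  then have "(\<lambda>k. poly_eval (p k) a) \<longlonglongrightarrow> star (cfc f a)"
    using tendsto_star[OF l] by simp
  with l show ?thesis by (rule LIMSEQ_unique[symmetric])
qed

lemma norm_cfc_le:
  assumes f: "cfc_dom a f" and B: "\<And>t. t \<in> rspec a \<Longrightarrow> \<bar>f t\<bar> \<le> B"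
  shows "norm (cfc f a) \<le> B"
proof (rule field_le_epsilon)
  fix e :: real assume e: "e > 0"
  obtain p where p: "\<And>k. coeff (p k) 0 = 0"
    "uniform_limit (rspec a) (\<lambda>k. poly (p k)) f sequentially"
    using cfc_dom_approx[OF f] by blast
  obtain N where N: "\<forall>n\<ge>N. \<forall>x\<in>rspec a. dist (poly (p n) x) (f x) < e"
    using p(2) e unfolding uniform_limit_sequentially_iff by blast
  have "norm (poly_eval (p n) a) \<le> B + e" if "n \<ge> N" for n
  proof (rule norm_poly_eval_le)
    fix t assume t: "t \<in> rspec a"
    have "dist (poly (p n) t) (f t) < e" using N that t by blast
    with B[OF t] show "\<bar>poly (p n) t\<bar> \<le> B + e" by (simp add: dist_real_def)
  qed (use f p in \<open>auto simp: cfc_dom_def\<close>)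
  then have ev: "\<forall>n\<ge>N. norm (poly_eval (p n) a) \<le> B + e" by blast
  show "norm (cfc f a) \<le> B + e"
    by (rule LIMSEQ_le_const2[OF tendsto_norm[OF cfc_limit[OF f p]]]) (use ev in blast)
qed

lemma cfc_cong:
  assumes f: "cfc_dom a f" and fg: "\<And>t. t \<in> rspec a \<Longrightarrow> f t = g t"
  shows "cfc_dom a g" "cfc g a = cfc f a"
proof -
  show g: "cfc_dom a g"
    using f fg[of 0] continuous_on_eq[of "rspec a" f g] fg unfolding cfc_dom_def by auto
  obtain p where p: "\<And>k. coeff (p k) 0 = 0"
    "uniform_limit (rspec a) (\<lambda>k. poly (p k)) f sequentially"
    using cfc_dom_approx[OF f] by blast
  have "uniform_limit (rspec a) (\<lambda>k. poly (p k)) g sequentially"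
    using p(2) fg unfolding uniform_limit_sequentially_iff by simp
  from cfc_eqI[OF g p(1) this cfc_limit[OF f p]] show "cfc g a = cfc f a" .
qed

lemma cfc_poly:
  assumes "star a = a" "coeff p 0 = 0"
  shows "cfc_dom a (poly p)" "cfc (poly p) a = poly_eval p a"
proof -
  show d: "cfc_dom a (poly p)"
    using assms by (auto simp: cfc_dom_def poly_0_coeff_0 intro: continuous_intros)
  show "cfc (poly p) a = poly_eval p a"
    by (rule cfc_eqI[OF d, where p = "\<lambda>k. p"])
       (use assms in \<open>auto simp: uniform_limit_sequentially_iff\<close>)
qed

lemma cfc_id: "star a = a \<Longrightarrow> cfc (\<lambda>t. t) a = a"
  using cfc_poly(2)[of a "[:0, 1:]"] unfolding poly_fun by (simp add: poly_eval_def)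

lemma cfc_zero: "star a = a \<Longrightarrow> cfc (\<lambda>t. 0) a = 0"
  using cfc_poly(2)[of a 0] by (simp add: poly_eval_def poly_0[abs_def])

lemma cfc_dom_zero: "star a = a \<Longrightarrow> cfc_dom a (\<lambda>t. 0)"
  by (simp add: cfc_dom_def)

lemma cfc_scale:
  assumes f: "cfc_dom a f" shows "cfc (\<lambda>t. r * f t) a = r *\<^sub>R cfc f a"
proof -
  obtain p where p: "\<And>k. coeff (p k) 0 = 0"
    "uniform_limit (rspec a) (\<lambda>k. poly (p k)) f sequentially"
    using cfc_dom_approx[OF f] by blast
  have u: "uniform_limit (rspec a) (\<lambda>k t. r *\<^sub>R poly (p k) t) (\<lambda>t. r *\<^sub>R f t) sequentially"
    by (rule bounded_linear.uniform_limit[OF bounded_linear_scaleR_right p(2)])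
  show ?thesis
  proof (rule cfc_eqI[OF cfc_dom_scale[OF f], where p = "\<lambda>k. smult r (p k)"])
    show "uniform_limit (rspec a) (\<lambda>k. poly (smult r (p k))) (\<lambda>t. r * f t) sequentially"
      using u by (simp add: poly_fun)
    show "(\<lambda>k. poly_eval (smult r (p k)) a) \<longlonglongrightarrow> r *\<^sub>R cfc f a"
      unfolding poly_eval_hom(4)[OF p(1) p(1)] by (intro tendsto_intros cfc_limit f p)
  qed (simp add: p)
qed

lemma cfc_diff:
  assumes f: "cfc_dom a f" and g: "cfc_dom a g"
  shows "cfc (\<lambda>t. f t - g t) a = cfc f a - cfc g a"
  using cfc_add[OF f cfc_dom_scale[OF g, of "-1"]] cfc_scale[OF g, of "-1"] by simp

lemma cfc_npow:
  assumes f: "cfc_dom a f" and n: "n \<ge> 1"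
  shows "cfc_dom a (\<lambda>t. f t ^ n)" "cfc (\<lambda>t. f t ^ n) a = npow (cfc f a) n"
proof -
  have "cfc_dom a (\<lambda>t. f t ^ n) \<and> cfc (\<lambda>t. f t ^ n) a = npow (cfc f a) n"
    using n
  proof (induction n rule: dec_induct)
    case base
    then show ?case using f by simp
  next
    case (step n)
    then show ?case using cfc_mult[OF f, of "\<lambda>t. f t ^ n"] cfc_dom_mult[OF f, of "\<lambda>t. f t ^ n"]
      by (simp add: npow_Suc)
  qed
  then show "cfc_dom a (\<lambda>t. f t ^ n)" "cfc (\<lambda>t. f t ^ n) a = npow (cfc f a) n" by auto
qed

lemma cfc_power: "star a = a \<Longrightarrow> n \<ge> 1 \<Longrightarrow> cfc (\<lambda>t. t ^ n) a = npow a n"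
  using cfc_npow(2)[OF cfc_dom_id, of a n] by (simp add: cfc_id)

lemma cfc_sum:
  assumes "star a = a" "finite S" "\<And>i. i \<in> S \<Longrightarrow> cfc_dom a (f i)"
  shows "cfc_dom a (\<lambda>t. \<Sum>i\<in>S. f i t)" "cfc (\<lambda>t. \<Sum>i\<in>S. f i t) a = (\<Sum>i\<in>S. cfc (f i) a)"
proof -
  have "cfc_dom a (\<lambda>t. \<Sum>i\<in>S. f i t) \<and> cfc (\<lambda>t. \<Sum>i\<in>S. f i t) a = (\<Sum>i\<in>S. cfc (f i) a)"
    using assms(2,3)
  proof (induction S rule: finite_induct)
    case empty
    then show ?case using assms(1) by (simp add: cfc_zero cfc_dom_zero)
  next
    case (insert i S)
    then show ?case
      using cfc_add[of a "f i" "\<lambda>t. \<Sum>i\<in>S. f i t"] cfc_dom_add[of a "f i" "\<lambda>t. \<Sum>i\<in>S. f i t"] by simp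
  qed
  then show "cfc_dom a (\<lambda>t. \<Sum>i\<in>S. f i t)" "cfc (\<lambda>t. \<Sum>i\<in>S. f i t) a = (\<Sum>i\<in>S. cfc (f i) a)" by auto
qed

section \<open>Spectral inclusion and composition\<close>

lemma rspec_cfc:
  assumes f: "cfc_dom a f" shows "rspec (cfc f a) \<subseteq> f ` rspec a"
proof
  fix z assume z: "z \<in> rspec (cfc f a)"
  show "z \<in> f ` rspec a"
  proof (rule ccontr)
    assume nz: "z \<notin> f ` rspec a"
    have f0: "f 0 = 0" using f by (simp add: cfc_dom_def)
    have z0: "z \<noteq> 0" using nz f0 by (metis imageI zero_in_rspec)
    define k where "k t = f t / (z * (z - f t))" for t
    have k: "cfc_dom a k"
      unfolding cfc_dom_def k_def using f nz z0
      by (auto simp: cfc_dom_def intro!: continuous_intros)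
    have fk: "z * k t - f t * k t = (1/z) * f t" if "t \<in> rspec a" for t
    proof -
      have "z - f t \<noteq> 0" using nz that by auto
      then show ?thesis using z0 by (simp add: k_def divide_simps) (simp add: algebra_simps)
    qed
    have d: "cfc_dom a (\<lambda>t. z * k t - f t * k t)"
      by (intro cfc_dom_diff cfc_dom_scale cfc_dom_mult f k)
    have "(1/z) *\<^sub>R cfc f a = cfc (\<lambda>t. (1/z) * f t) a" by (rule cfc_scale[OF f, symmetric])
    also have "\<dots> = cfc (\<lambda>t. z * k t - f t * k t) a" by (rule cfc_cong(2)[OF d fk])
    also have "\<dots> = z *\<^sub>R cfc k a - cfc f a * cfc k a"
      unfolding cfc_diff[OF cfc_dom_scale[OF k, of z] cfc_dom_mult[OF f k]] cfc_scale[OF k]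
        cfc_mult[OF f k] ..
    finally have "z *\<^sub>R cfc k a - cfc f a * cfc k a = (1/z) *\<^sub>R cfc f a" by simp
    moreover have "cfc f a * cfc k a = cfc k a * cfc f a"
      using cfc_mult[OF f k] cfc_mult[OF k f] by (simp add: mult.commute)
    ultimately have e: "z *\<^sub>R emb (cfc k a) - emb (cfc f a) * emb (cfc k a) = (1/z) *\<^sub>R emb (cfc f a)"
      "z *\<^sub>R emb (cfc k a) - emb (cfc k a) * emb (cfc f a) = (1/z) *\<^sub>R emb (cfc f a)"
      by (simp_all flip: emb_simps)
    have "(ofc z - emb (cfc f a)) * ((1/z) *\<^sub>R 1 + emb (cfc k a)) = 1"
      "((1/z) *\<^sub>R 1 + emb (cfc k a)) * (ofc z - emb (cfc f a)) = 1"
      using e z0 by (simp_all add: ofc_simps algebra_simps)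
    then have "of_real z \<notin> spec1 (emb (cfc f a))"
      by (auto simp: spec1_def invertible1_def)
    with z show False by (simp add: rspec_def spectrum_emb)
  qed
qed

text \<open>For polynomials \<open>f\<close> this is algebra. In general one polynomial approximates
  \<open>f\<close> on \<open>K\<close>, the image of the spectrum under \<open>g\<close>; as
  \<open>K\<close> contains \<open>rspec (cfc g a)\<close>, the error is controlled on both sides at
  once.\<close>

lemma cfc_compose:
  assumes g: "cfc_dom a g" and f: "continuous_on (g ` rspec a) f" "f 0 = 0"
  shows "cfc_dom a (\<lambda>t. f (g t))" "cfc_dom (cfc g a) f" "cfc f (cfc g a) = cfc (\<lambda>t. f (g t)) a"
proof -
  have cg: "continuous_on (rspec a) g" "g 0 = 0" "star a = a" using g by (auto simp: cfc_dom_def)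
  define K where "K = g ` rspec a"
  have K: "compact K" "0 \<in> K"
    unfolding K_def using compact_continuous_image[OF cg(1) compact_rspec] cg(2)
    by (auto intro: image_eqI[of _ _ 0])
  show d1: "cfc_dom a (\<lambda>t. f (g t))"
    unfolding cfc_dom_def using cg f continuous_on_compose[OF cg(1) f(1)] by (auto simp: o_def)
  show d2: "cfc_dom (cfc g a) f"
    unfolding cfc_dom_def using star_cfc[OF g] f continuous_on_subset[OF f(1) rspec_cfc[OF g]] by auto
  have polyc: "cfc_dom a (\<lambda>t. poly p (g t)) \<and> poly_eval p (cfc g a) = cfc (\<lambda>t. poly p (g t)) a"
    if p: "coeff p 0 = 0" for p
  proof -
    have e: "poly p x = (\<Sum>i\<in>{1..degree p}. coeff p i * x ^ i)" for x
      unfolding poly_altdef by (rule sum.mono_neutral_right) (use p in \<open>auto simp: Suc_le_eq\<close>)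
    have d: "cfc_dom a (\<lambda>t. coeff p i * g t ^ i)" if "i \<in> {1..degree p}" for i
      using that by (intro cfc_dom_scale cfc_npow(1)[OF g]) auto
    have c: "cfc (\<lambda>t. coeff p i * g t ^ i) a = coeff p i *\<^sub>R npow (cfc g a) i"
      if "i \<in> {1..degree p}" for i
      using that cfc_scale[OF cfc_npow(1)[OF g, of i]] cfc_npow(2)[OF g, of i] by simp
    show ?thesis
      unfolding e poly_eval_def
      using cfc_sum[of a "{1..degree p}" "\<lambda>i t. coeff p i * g t ^ i"] cg(3) d c by simp
  qed
  have fK: "continuous_on K f" using f(1) by (simp add: K_def)
  have approx: "\<exists>p. coeff p 0 = 0 \<and> (\<forall>x\<in>K. \<bar>poly p x - f x\<bar> < e)" if e: "e > 0" for e
  proof -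
    have e2: "e/2 > 0" using e by simp
    obtain h where h: "real_polynomial_function h" "\<And>x. x \<in> K \<Longrightarrow> \<bar>f x - h x\<bar> < e/2"
      using Stone_Weierstrass_real_polynomial_function[OF K(1) fK e2] by blast
    obtain c n where c: "h = (\<lambda>x. \<Sum>i\<le>n. c i * x ^ i)"
      using real_polynomial_function_imp_sum[OF h(1)] by blast
    define q where "q = (\<Sum>i\<le>n. monom (c i) i)"
    have q: "poly q x = h x" for x
      by (simp add: q_def c poly_sum poly_monom)
    define p where "p = q - [:poly q 0:]"
    have "coeff p 0 = 0" by (simp add: p_def poly_0_coeff_0)
    moreover have "\<bar>poly p x - f x\<bar> < e" if "x \<in> K" for x
    proof -
      have "\<bar>f x - h x\<bar> < e/2" "\<bar>h 0\<bar> < e/2" using h(2)[OF that] h(2)[OF K(2)] f(2) by auto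
      then have "\<bar>h x - h 0 - f x\<bar> < e" by linarith
      then show ?thesis by (simp add: p_def q)
    qed
    ultimately show ?thesis by blast
  qed
  have "norm (cfc f (cfc g a) - cfc (\<lambda>t. f (g t)) a) \<le> 0"
  proof (rule field_le_epsilon)
    fix e :: real assume "e > 0"
    then have e: "e/2 > 0" by simp
    obtain p where p: "coeff p 0 = 0" "\<forall>x\<in>K. \<bar>poly p x - f x\<bar> < e/2"
      using approx[OF e] by blast
    have s: "star (cfc g a) = cfc g a" by (rule star_cfc[OF g])
    have "norm (cfc (\<lambda>t. poly p t - f t) (cfc g a)) \<le> e/2"
      by (rule norm_cfc_le[OF cfc_dom_diff[OF cfc_poly(1)[OF s p(1)] d2]])
         (use p(2) rspec_cfc[OF g] in \<open>auto simp: K_def less_imp_le\<close>)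
    then have 1: "norm (poly_eval p (cfc g a) - cfc f (cfc g a)) \<le> e/2"
      using cfc_diff[OF cfc_poly(1)[OF s p(1)] d2] cfc_poly(2)[OF s p(1)] by simp
    have "norm (cfc (\<lambda>t. poly p (g t) - f (g t)) a) \<le> e/2"
      by (rule norm_cfc_le[OF cfc_dom_diff[OF conjunct1[OF polyc[OF p(1)]] d1]])
         (use p(2) in \<open>auto simp: K_def less_imp_le\<close>)
    then have 2: "norm (poly_eval p (cfc g a) - cfc (\<lambda>t. f (g t)) a) \<le> e/2"
      using cfc_diff[OF conjunct1[OF polyc[OF p(1)]] d1] polyc[OF p(1)] by simp
    from norm_triangle_ineq4[of "poly_eval p (cfc g a) - cfc (\<lambda>t. f (g t)) a"
        "poly_eval p (cfc g a) - cfc f (cfc g a)"] 1 2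
    show "norm (cfc f (cfc g a) - cfc (\<lambda>t. f (g t)) a) \<le> 0 + e" by simp
  qed
  then show "cfc f (cfc g a) = cfc (\<lambda>t. f (g t)) a" by simp
qed

section \<open>Positive elements\<close>

lemma positives_iff: "a \<in> positives \<longleftrightarrow> star a = a \<and> (\<forall>t\<in>rspec a. t \<ge> 0)"
proof
  assume a: "a \<in> positives"
  then have "star a = a" "spectrum a \<subseteq> \<real>\<^sub>\<ge>\<^sub>0" by (auto simp: positives_def)
  then show "star a = a \<and> (\<forall>t\<in>rspec a. t \<ge> 0)"
    unfolding rspec_def by (auto simp: subset_iff complex_nonneg_Reals_iff)
next
  assume a: "star a = a \<and> (\<forall>t\<in>rspec a. t \<ge> 0)"
  have "z \<in> \<real>\<^sub>\<ge>\<^sub>0" if "z \<in> spectrum a" for z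
  proof -
    have "z = complex_of_real (Re z)" "Re z \<in> rspec a" using spectrum_real[OF _ that] a by auto
    then show ?thesis using a by (auto simp: complex_nonneg_Reals_iff complex_eq_iff)
  qed
  then show "a \<in> positives" using a by (auto simp: positives_def)
qed

lemma positives_star: "a \<in> positives \<Longrightarrow> star a = a"
  by (simp add: positives_iff)

lemma positives_rspec: "a \<in> positives \<Longrightarrow> t \<in> rspec a \<Longrightarrow> t \<ge> 0"
  by (simp add: positives_iff)

lemma rspec_emb [simp]: "rspec (emb a) = rspec a"
  using zero_in_spectrum[of a] spectrum_unital[of "emb a"]
  by (auto simp: rspec_def spectrum_emb[symmetric] insert_absorb)

lemma emb_positives [simp]: "emb a \<in> positives \<longleftrightarrow> a \<in> positives"
proof -
  have "star (emb a) = emb a \<longleftrightarrow> star a = a" by (simp add: emb_simps)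
  then show ?thesis by (simp add: positives_iff)
qed

lemma spec1_shift: "z \<in> spec1 (t *\<^sub>R 1 - u) \<longleftrightarrow> of_real t - z \<in> spec1 u"
proof -
  have e: "ofc z - (t *\<^sub>R 1 - u) = (-1) *\<^sub>C (ofc (of_real t - z) - u)"
    by (simp add: ofc_simps)
  have "invertible1 ((-1) *\<^sub>C v) \<longleftrightarrow> invertible1 v" for v :: 'a
    using invertible1_scaleC[of "-1" v] invertible1_scaleC[of "-1" "(-1) *\<^sub>C v"] by auto
  then show ?thesis unfolding spec1_def mem_Collect_eq e by blast
qed

text \<open>Translation by \<open>t\<close> turns positivity into a norm inequality, a form that is
  stable under sums and limits.\<close>

lemma positives_iff_norm:
  assumes a: "star a = a" and t: "norm a \<le> t"
  shows "a \<in> positives \<longleftrightarrow> norm (t *\<^sub>R 1 - emb a) \<le> t"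
proof
  assume pos: "a \<in> positives"
  have st: "star (t *\<^sub>R 1 - emb a) = t *\<^sub>R 1 - emb a"
    by (simp add: star_diff star_scaleR emb_simps a)
  obtain z where z: "z \<in> spec1 (t *\<^sub>R 1 - emb a)" "cmod z = norm (t *\<^sub>R 1 - emb a)"
    using spec1_norm_attained[OF st] by blast
  then have "of_real t - z \<in> spectrum a" by (simp add: spec1_shift spectrum_emb)
  with spectrum_real[OF a this] have s: "of_real t - z = of_real (t - Re z)" "t - Re z \<in> rspec a"
    by auto
  have "z = of_real (Re z)" using s(1) by (simp add: complex_eq_iff)
  then have "cmod z = \<bar>Re z\<bar>" by (metis norm_of_real)
  moreover have "t - Re z \<ge> 0" "t - Re z \<le> t"
    using positives_rspec[OF pos s(2)] rspec_bound[OF s(2)] t by auto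
  ultimately have "cmod z \<le> t" using z norm_ge_zero[of a] t
    spec1_bound[of "of_real t - z" "emb a"] \<open>of_real t - z \<in> spectrum a\<close> by simp
  with z show "norm (t *\<^sub>R 1 - emb a) \<le> t" by simp
next
  assume n: "norm (t *\<^sub>R 1 - emb a) \<le> t"
  show "a \<in> positives"
    unfolding positives_iff
  proof (intro conjI a ballI)
    fix s assume "s \<in> rspec a"
    then have "of_real (t - s) \<in> spec1 (t *\<^sub>R 1 - emb a)"
      by (simp add: spec1_shift rspec_def spectrum_emb)
    from spec1_bound[OF this] n have "\<bar>t - s\<bar> \<le> t" unfolding norm_of_real by simp
    then show "s \<ge> 0" by simp
  qed
qed

text \<open>Turns an upper bound on the spectrum into an order relation with a multiple of the unit,
  to be conjugated back into \<open>A\<close>.\<close>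

lemma unit_minus_positive:
  assumes a: "star a = a"
  shows "t *\<^sub>R 1 - emb a \<in> positives \<longleftrightarrow> t \<ge> 0 \<and> (\<forall>s\<in>rspec a. s \<le> t)"
proof -
  have st: "star (t *\<^sub>R 1 - emb a) = t *\<^sub>R 1 - emb a"
    by (simp add: star_diff star_scaleR emb_simps a)
  have mem: "s \<in> rspec (t *\<^sub>R 1 - emb a) \<longleftrightarrow> s = 0 \<or> t - s \<in> rspec a" for s
    using spectrum_unital[of "t *\<^sub>R 1 - emb a"] spec1_shift[of "of_real s" t "emb a"]
    by (auto simp: rspec_def spectrum_emb[symmetric])
  show ?thesis
  proof
    assume p: "t *\<^sub>R 1 - emb a \<in> positives"
    have *: "t - s \<ge> 0" if "s \<in> rspec a" for s
      by (rule positives_rspec[OF p]) (simp add: mem that)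
    show "t \<ge> 0 \<and> (\<forall>s\<in>rspec a. s \<le> t)" using *[of 0] * by simp
  next
    assume p: "t \<ge> 0 \<and> (\<forall>s\<in>rspec a. s \<le> t)"
    have "s \<ge> 0" if "s \<in> rspec (t *\<^sub>R 1 - emb a)" for s
      using that p unfolding mem by force
    then show "t *\<^sub>R 1 - emb a \<in> positives" using st by (simp add: positives_iff)
  qed
qed

text \<open>The triangle inequality, applied to \<open>positives_iff_norm\<close> with
  \<open>t = norm a + norm b\<close>.\<close>

lemma positives_add:
  assumes "a \<in> positives" "b \<in> positives" shows "a + b \<in> positives"
proof -
  have sa: "star a = a" "star b = b" using assms positives_star by auto
  have "norm (norm a *\<^sub>R 1 - emb a) \<le> norm a" "norm (norm b *\<^sub>R 1 - emb b) \<le> norm b"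
    using positives_iff_norm[OF sa(1)] positives_iff_norm[OF sa(2)] assms by blast+
  moreover have "(norm a + norm b) *\<^sub>R 1 - emb (a + b) = (norm a *\<^sub>R 1 - emb a) + (norm b *\<^sub>R 1 - emb b)"
    by (simp add: emb_simps algebra_simps)
  ultimately have "norm ((norm a + norm b) *\<^sub>R 1 - emb (a + b)) \<le> norm a + norm b"
    using norm_triangle_ineq[of "norm a *\<^sub>R 1 - emb a" "norm b *\<^sub>R 1 - emb b"] by simp
  then show ?thesis
    using positives_iff_norm[of "a + b" "norm a + norm b"] sa norm_triangle_ineq[of a b]
    by (simp add: star_add)
qed

lemma positives_0 [simp]: "0 \<in> positives"
  using positives_iff_norm[of 0 0] by (simp add: emb_simps)

lemma positives_scaleR:
  assumes "a \<in> positives" "r \<ge> 0" shows "r *\<^sub>R a \<in> positives"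
proof -
  have sa: "star a = a" using assms positives_star by auto
  have "norm (norm a *\<^sub>R 1 - emb a) \<le> norm a" using positives_iff_norm[OF sa] assms by blast
  then have "norm (r *\<^sub>R (norm a *\<^sub>R 1 - emb a)) \<le> r * norm a" using assms by (simp add: mult_left_mono)
  moreover have "r *\<^sub>R (norm a *\<^sub>R 1 - emb a) = (r * norm a) *\<^sub>R 1 - emb (r *\<^sub>R a)"
    by (simp add: emb_simps scaleR_diff_right)
  ultimately show ?thesis
    using positives_iff_norm[of "r *\<^sub>R a" "r * norm a"] sa assms by (simp add: star_scaleR)
qed

lemma positives_sum: "(\<And>i. i \<in> S \<Longrightarrow> f i \<in> positives) \<Longrightarrow> sum f S \<in> positives"
  by (induction S rule: infinite_finite_induct) (auto intro: positives_add)

lemma positives_limit: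
  assumes p: "\<And>n::nat. X n \<in> positives" and l: "X \<longlonglongrightarrow> a"
  shows "a \<in> positives"
proof -
  have sX: "star (X n) = X n" for n using p positives_star by blast
  have "(\<lambda>n. star (X n)) \<longlonglongrightarrow> star a" by (intro tendsto_star l)
  then have sa: "star a = a" using l sX LIMSEQ_unique by auto
  let ?t = "norm a + 1"
  have "eventually (\<lambda>n. norm (X n) < ?t) sequentially"
    by (rule order_tendstoD(2)[OF tendsto_norm[OF l]]) simp
  then have ev: "eventually (\<lambda>n. norm (?t *\<^sub>R 1 - emb (X n)) \<le> ?t) sequentially"
    by eventually_elim (use positives_iff_norm[OF sX] p in \<open>auto simp: less_imp_le\<close>)
  have "(\<lambda>n. emb (X n)) \<longlonglongrightarrow> emb a"
  proof (rule LIM_zero_cancel, rule tendsto_norm_zero_cancel)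
    have "(\<lambda>n. norm (X n - a)) \<longlonglongrightarrow> 0"
      using tendsto_norm_zero[OF LIM_zero[OF l]] .
    then show "(\<lambda>n. norm (emb (X n) - emb a)) \<longlonglongrightarrow> 0"
      by (simp flip: emb_simps)
  qed
  then have "(\<lambda>n. norm (?t *\<^sub>R 1 - emb (X n))) \<longlonglongrightarrow> norm (?t *\<^sub>R 1 - emb a)"
    by (intro tendsto_intros)
  from tendsto_upperbound[OF this ev] have "norm (?t *\<^sub>R 1 - emb a) \<le> ?t" by simp
  then show ?thesis using positives_iff_norm[OF sa, of ?t] by simp
qed

lemma positives_cfc:
  assumes "cfc_dom a f" "\<And>t. t \<in> rspec a \<Longrightarrow> f t \<ge> 0" shows "cfc f a \<in> positives"
  unfolding positives_iff using star_cfc[OF assms(1)] rspec_cfc[OF assms(1)] assms(2) by blast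

lemma rspec_minus: "star a = a \<Longrightarrow> t \<in> rspec a \<Longrightarrow> - t \<in> rspec (- a)"
proof -
  assume a: "star a = a" and t: "t \<in> rspec a"
  have s: "star (- a) = - a" by (simp add: star_minus a)
  have "cfc (\<lambda>t. (-1) * t) (- a) = a"
    using cfc_scale[OF cfc_dom_id[OF s], of "-1"] cfc_id[OF s] by simp
  moreover have "cfc_dom (- a) (\<lambda>t. (-1) * t)" by (rule cfc_dom_scale[OF cfc_dom_id[OF s]])
  ultimately have "rspec a \<subseteq> (\<lambda>t. (-1) * t) ` rspec (- a)" using rspec_cfc by metis
  with t show ?thesis by auto
qed

lemma positives_antisym:
  assumes "a \<in> positives" "- a \<in> positives" shows "a = 0"
proof -
  have s: "star a = a" using assms positives_star by blast
  obtain t where t: "t \<in> rspec a" "\<bar>t\<bar> = norm a" using rspec_norm_attained[OF s] by blast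
  have "t \<ge> 0" "- t \<ge> 0"
    using positives_rspec[OF assms(1) t(1)] positives_rspec[OF assms(2) rspec_minus[OF s t(1)]] by auto
  with t show ?thesis by simp
qed

text \<open>Apart from \<open>0\<close>, the spectra of \<open>y * star y\<close> and
  \<open>star y * y\<close> coincide.\<close>

lemma positives_rspec_commute:
  assumes "- (y * star y) \<in> positives" shows "- (star y * y) \<in> positives"
proof -
  have s: "star (star y * y) = star y * y" by (simp add: star_mult star_star)
  have "t \<le> 0" if "t \<in> rspec (star y * y)" for t
  proof (cases "t = 0")
    case False
    then have "t \<in> rspec (y * star y)"
      using that spectrum_commute[of "of_real t" "star y" y] by (simp add: rspec_def)
    then have "- t \<in> rspec (- (y * star y))"
      by (intro rspec_minus) (simp add: star_mult star_star)
    with positives_rspec[OF assms] show ?thesis by force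
  qed simp
  moreover have "- t \<in> rspec (star y * y)" if "t \<in> rspec (- (star y * y))" for t
    using rspec_minus[OF _ that] s by (simp add: star_minus)
  ultimately show ?thesis
    unfolding positives_iff using s by (force simp: star_minus)
qed

lemma square_positive: "star h = h \<Longrightarrow> h * h \<in> positives"
  using positives_cfc[OF cfc_dom_mult[OF cfc_dom_id cfc_dom_id], of h]
    cfc_mult[OF cfc_dom_id cfc_dom_id, of h] by (simp add: cfc_id)

text \<open>If \<open>m\<close> is the negative part of \<open>x\<^sup>* x\<close> and \<open>y = x m\<close>, then \<open>y\<^sup>* y = - m\<^sup>3\<close> is negative,
  hence so is \<open>y y\<^sup>*\<close>; but \<open>y\<^sup>* y + y y\<^sup>*\<close> is a sum of squares.\<close>

lemma star_mult_positive: "star x * x \<in> positives"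
proof -
  define a where "a = star x * x"
  have a: "star a = a" by (simp add: a_def star_mult star_star)
  define f where "f t = max (- t) 0" for t :: real
  have f: "cfc_dom a f" using a by (auto simp: cfc_dom_def f_def intro!: continuous_intros)
  define m where "m = cfc f a"
  have m: "star m = m" unfolding m_def by (rule star_cfc[OF f])
  define y where "y = x * m"
  have id: "cfc_dom a (\<lambda>t. t)" by (rule cfc_dom_id[OF a])
  have "star y * y = m * a * m"
    by (simp add: y_def star_mult m a_def mult.assoc)
  also have "\<dots> = cfc (\<lambda>t. f t * t * f t) a"
    using cfc_mult[OF cfc_dom_mult[OF f id] f] cfc_mult[OF f id] by (simp add: m_def cfc_id[OF a])
  also have "\<dots> = - cfc (\<lambda>t. f t * f t * f t) a"
  proof -
    have "cfc (\<lambda>t. (-1) * (f t * f t * f t)) a = cfc (\<lambda>t. f t * t * f t) a"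
      by (rule cfc_cong(2)[OF cfc_dom_mult[OF cfc_dom_mult[OF f id] f]]) (auto simp: f_def max_def)
    then show ?thesis using cfc_scale[OF cfc_dom_mult[OF cfc_dom_mult[OF f f] f], of "-1"] by simp
  qed
  finally have yy: "star y * y = - cfc (\<lambda>t. f t * f t * f t) a" .
  have c3: "cfc (\<lambda>t. f t * f t * f t) a \<in> positives"
    by (rule positives_cfc[OF cfc_dom_mult[OF cfc_dom_mult[OF f f] f]]) (simp add: f_def)
  have neg: "- (star y * y) \<in> positives" using yy c3 by simp
  then have neg': "- (y * star y) \<in> positives"
    using positives_rspec_commute[of "star y"] by (simp add: star_star)
  define h where "h = y + star y"
  define k where "k = imul (y - star y)"
  have sh: "star h = h" "star k = k"
    by (auto simp: h_def k_def star_add star_diff star_star)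
  have "h * h + k * k = 2 *\<^sub>R (star y * y) + 2 *\<^sub>R (y * star y)"
    by (simp add: h_def k_def algebra_simps scaleR_2)
  then have "2 *\<^sub>R (star y * y) = (h * h + k * k) + 2 *\<^sub>R (- (y * star y))"
    by simp
  moreover have "(h * h + k * k) + 2 *\<^sub>R (- (y * star y)) \<in> positives"
    by (intro positives_add positives_scaleR neg' square_positive sh) simp
  ultimately have "2 *\<^sub>R (star y * y) \<in> positives" by simp
  from positives_scaleR[OF this, of "1/2"] have "star y * y \<in> positives" by simp
  with neg have "star y * y = 0" by (rule positives_antisym[rotated])
  then have "cfc (\<lambda>t. f t * f t * f t) a = 0" using yy by simp
  then have "m * m * m = 0"
    using cfc_mult[OF cfc_dom_mult[OF f f] f] cfc_mult[OF f f] by (simp add: m_def)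
  \<comment> \<open>From \<open>m^3 = 0\<close> pass to \<open>m^4 = 0\<close>, so that the
    C*-identity can be applied to \<open>m * m\<close> and then to \<open>m\<close>.\<close>
  then have "norm ((m * m) * (m * m)) = 0" by (simp add: mult.assoc)
  moreover have "star (m * m) = m * m" using m by (simp add: star_mult)
  ultimately have "m = 0"
    using norm_square_selfadjoint[of "m * m"] norm_square_selfadjoint[OF m] by simp
  have "cfc (\<lambda>t. t + f t) a = a"
    using cfc_add[OF id f] \<open>m = 0\<close> by (simp add: m_def cfc_id[OF a])
  moreover have "cfc (\<lambda>t. t + f t) a \<in> positives"
    by (rule positives_cfc[OF cfc_dom_add[OF id f]]) (simp add: f_def)
  ultimately show ?thesis by (simp add: a_def)
qed

lemma mult_star_positive: "x * star x \<in> positives"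
  using star_mult_positive[of "star x"] by (simp add: star_star)

definition positive_sqrt :: "'a::cstar_algebra \<Rightarrow> 'a" where "positive_sqrt a = cfc sqrt a"

lemma cfc_dom_sqrt: "star a = a \<Longrightarrow> cfc_dom a sqrt"
  by (auto simp: cfc_dom_def intro: continuous_intros)

lemma positive_sqrt_positive: "a \<in> positives \<Longrightarrow> positive_sqrt a \<in> positives"
  unfolding positive_sqrt_def by (rule positives_cfc) (auto simp: cfc_dom_sqrt positives_iff)

lemma star_positive_sqrt: "a \<in> positives \<Longrightarrow> star (positive_sqrt a) = positive_sqrt a"
  using positive_sqrt_positive positives_star by blast

lemma positive_sqrt_mult: "a \<in> positives \<Longrightarrow> positive_sqrt a * positive_sqrt a = a"
proof -
  assume a: "a \<in> positives"
  then have s: "star a = a" by (rule positives_star)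
  have "cfc (\<lambda>t. sqrt t * sqrt t) a = cfc (\<lambda>t. t) a"
    by (rule cfc_cong(2)[OF cfc_dom_id[OF s]]) (use positives_rspec[OF a] in simp)
  then show ?thesis
    unfolding positive_sqrt_def using cfc_mult[OF cfc_dom_sqrt[OF s] cfc_dom_sqrt[OF s]] cfc_id[OF s] by simp
qed

lemma positives_conj:
  assumes "a \<in> positives" shows "star z * a * z \<in> positives"
proof -
  have "star z * a * z = star (positive_sqrt a * z) * (positive_sqrt a * z)"
    using positive_sqrt_mult[OF assms] star_positive_sqrt[OF assms] by (simp add: star_mult mult.assoc[symmetric])
       (simp add: mult.assoc)
  then show ?thesis by (simp add: star_mult_positive)
qed

section \<open>Inequalities for the order\<close>

lemma cstar_le_refl [simp]: "cstar_le a a"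
  by (simp add: cstar_le_def)

lemma cstar_le_trans: "cstar_le a b \<Longrightarrow> cstar_le b c \<Longrightarrow> cstar_le a c"
  unfolding cstar_le_def using positives_add[of "b - a" "c - b"] by simp

lemma cstar_le_add: "cstar_le a b \<Longrightarrow> cstar_le c d \<Longrightarrow> cstar_le (a + c) (b + d)"
  unfolding cstar_le_def using positives_add[of "b - a" "d - c"] by (simp add: algebra_simps)

lemma cstar_le_scaleR: "cstar_le a b \<Longrightarrow> r \<ge> 0 \<Longrightarrow> cstar_le (r *\<^sub>R a) (r *\<^sub>R b)"
  unfolding cstar_le_def using positives_scaleR[of "b - a" r] by (simp add: scaleR_diff_right)

lemma cstar_le_conj: "cstar_le a b \<Longrightarrow> cstar_le (star z * a * z) (star z * b * z)"
  unfolding cstar_le_def using positives_conj[of "b - a" z] by (simp add: algebra_simps)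

lemma cstar_le_emb [simp]: "cstar_le (emb a) (emb b) \<longleftrightarrow> cstar_le a b"
  unfolding cstar_le_def by (simp flip: emb_simps)

lemma cstar_le_limit:
  assumes "\<And>n::nat. cstar_le (X n) b" "X \<longlonglongrightarrow> a" shows "cstar_le a b"
  unfolding cstar_le_def
  by (rule positives_limit[of "\<lambda>n. b - X n"]) (use assms in \<open>auto simp: cstar_le_def intro: tendsto_intros\<close>)

text \<open>In the unitization \<open>a \<le> b \<le> norm b\<close>, so the spectrum of
  \<open>a\<close> is bounded by \<open>norm b\<close>.\<close>

lemma norm_mono:
  assumes "a \<in> positives" "cstar_le a b" shows "norm a \<le> norm b"
proof -
  have b: "b \<in> positives" using positives_add[of a "b - a"] assms by (simp add: cstar_le_def)
  have "norm b *\<^sub>R 1 - emb b \<in> positives"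
    using unit_minus_positive[OF positives_star[OF b]] rspec_bound[of _ b] by force
  moreover have "emb (b - a) \<in> positives" using assms by (simp add: cstar_le_def)
  ultimately have "norm b *\<^sub>R 1 - emb b + emb (b - a) \<in> positives" by (rule positives_add)
  then have "norm b *\<^sub>R 1 - emb a \<in> positives" by (simp add: emb_simps)
  then have le: "\<forall>s\<in>rspec a. s \<le> norm b"
    using unit_minus_positive[OF positives_star[OF assms(1)]] by blast
  obtain t where t: "t \<in> rspec a" "\<bar>t\<bar> = norm a"
    using rspec_norm_attained[OF positives_star[OF assms(1)]] by blast
  with le positives_rspec[OF assms(1) t(1)] show ?thesis by force
qed

text \<open>Conjugate \<open>star y * y \<le> (norm y)^2\<close> by \<open>z\<close>; the inequality
  holds in the unitization, but the conjugates lie in \<open>A\<close>.\<close>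

lemma conj_le_norm:
  "cstar_le (star z * (star y * y) * z) ((norm y)\<^sup>2 *\<^sub>R (star z * z))"
proof -
  define a where "a = star y * y"
  have a: "a \<in> positives" by (simp add: a_def star_mult_positive)
  have "(norm y)\<^sup>2 *\<^sub>R 1 - emb a \<in> positives"
    using unit_minus_positive[OF positives_star[OF a], of "(norm y)\<^sup>2"] rspec_bound[of _ a] cstar_identity[of y]
    by (force simp: a_def)
  from positives_conj[OF this, of "emb z"]
  have "emb ((norm y)\<^sup>2 *\<^sub>R (star z * z) - star z * a * z) \<in> positives"
    by (simp add: emb_simps algebra_simps)
  then show ?thesis by (simp add: cstar_le_def a_def)
qed

text \<open>Parallelogram identity: the difference of the two sides is
  \<open>star (z - w) * (z - w)\<close>.\<close>

lemma star_add_le: "cstar_le (star (z + w) * (z + w)) (2 *\<^sub>R (star z * z) + 2 *\<^sub>R (star w * w))"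
proof -
  have "2 *\<^sub>R (star z * z) + 2 *\<^sub>R (star w * w) - star (z + w) * (z + w) = star (z - w) * (z - w)"
    by (simp add: star_add star_diff algebra_simps scaleR_2)
  then show ?thesis by (simp add: cstar_le_def star_mult_positive)
qed

section \<open>Factorizations\<close>

text \<open>By the C*-identity and monotonicity of the norm, \<open>x\<close> may be replaced by
  \<open>d^(1/2)\<close>; what remains is a scalar estimate on the spectrum of
  \<open>d\<close>.\<close>

lemma norm_mult_cfc_le:
  assumes x: "cstar_le (star x * x) d" and g: "cfc_dom d g"
    and B: "B \<ge> 0" "\<And>t. t \<in> rspec d \<Longrightarrow> \<bar>t * (g t)\<^sup>2\<bar> \<le> B\<^sup>2"
  shows "norm (x * cfc g d) \<le> B"
proof -
  have d: "star d = d" using g by (simp add: cfc_dom_def)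
  define G where "G = cfc g d"
  have G: "star G = G" unfolding G_def by (rule star_cfc[OF g])
  have "(norm (x * G))\<^sup>2 = norm (star (x * G) * (x * G))" by (simp add: cstar_identity)
  also have "\<dots> = norm (star G * (star x * x) * G)" by (simp add: star_mult mult.assoc)
  also have "\<dots> \<le> norm (star G * d * G)"
    by (intro norm_mono cstar_le_conj x positives_conj star_mult_positive)
  also have "star G * d * G = cfc (\<lambda>t. g t * t * g t) d"
    using cfc_mult[OF cfc_dom_mult[OF g cfc_dom_id[OF d]] g] cfc_mult[OF g cfc_dom_id[OF d]]
    unfolding G by (simp add: G_def cfc_id[OF d])
  also have "norm \<dots> \<le> B\<^sup>2"
    by (rule norm_cfc_le[OF cfc_dom_mult[OF cfc_dom_mult[OF g cfc_dom_id[OF d]] g]])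
       (use B(2) in \<open>simp add: power2_eq_square ac_simps\<close>)
  finally show ?thesis unfolding G_def using B(1) by (rule power2_le_imp_le)
qed

text \<open>The same estimate for \<open>x * (1 - g(d))\<close>. As the function
  \<open>1 - g\<close> does not vanish at \<open>0\<close>, products are expanded by hand;
  \<open>q\<close> with \<open>star q * q = d - star x * x\<close> shows that replacing
  \<open>star x * x\<close> by \<open>d\<close> only adds a positive term.\<close>

lemma norm_diff_mult_cfc_le:
  assumes x: "cstar_le (star x * x) d" and g: "cfc_dom d g"
    and B: "B \<ge> 0" "\<And>t. t \<in> rspec d \<Longrightarrow> \<bar>t * (1 - g t)\<^sup>2\<bar> \<le> B\<^sup>2"
  shows "norm (x - x * cfc g d) \<le> B"
proof -
  have d: "star d = d" using g by (simp add: cfc_dom_def)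
  note id = cfc_dom_id[OF d]
  define G where "G = cfc g d"
  have G: "star G = G" unfolding G_def by (rule star_cfc[OF g])
  define q where "q = positive_sqrt (d - star x * x)"
  have dx: "d - star x * x \<in> positives" using x by (simp add: cstar_le_def)
  have q: "star q * q = d - star x * x"
    unfolding q_def by (simp add: star_positive_sqrt[OF dx] positive_sqrt_mult[OF dx])
  have ex: "star (x - x * G) * (x - x * G) = star x * x - star x * x * G - G * (star x * x) + G * (star x * x) * G"
    by (simp add: star_diff star_mult G algebra_simps)
  have eq: "star (q - q * G) * (q - q * G) = star q * q - star q * q * G - G * (star q * q) + G * (star q * q) * G"
    by (simp add: star_diff star_mult G algebra_simps)
  have e: "d - d * G - G * d + G * d * G - star (x - x * G) * (x - x * G)
      = star (q - q * G) * (q - q * G)"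
    unfolding ex eq q by (simp add: algebra_simps)
  have "(norm (x - x * G))\<^sup>2 = norm (star (x - x * G) * (x - x * G))" by (simp add: cstar_identity)
  also have "\<dots> \<le> norm (d - d * G - G * d + G * d * G)"
    by (rule norm_mono[OF star_mult_positive]) (simp add: cstar_le_def e star_mult_positive)
  also have "d - d * G - G * d + G * d * G = cfc (\<lambda>t. t - t * g t - g t * t + g t * t * g t) d"
    unfolding G_def
    by (simp only: cfc_add cfc_diff cfc_mult cfc_dom_add cfc_dom_diff cfc_dom_mult id g cfc_id[OF d])
  also have "norm \<dots> \<le> B\<^sup>2"
  proof (rule norm_cfc_le)
    show "cfc_dom d (\<lambda>t. t - t * g t - g t * t + g t * t * g t)"
      by (intro cfc_dom_add cfc_dom_diff cfc_dom_mult id g)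
    fix t assume "t \<in> rspec d"
    moreover have "t - t * g t - g t * t + g t * t * g t = t * (1 - g t)\<^sup>2"
      by (simp add: power2_eq_square algebra_simps)
    ultimately show "\<bar>t - t * g t - g t * t + g t * t * g t\<bar> \<le> B\<^sup>2"
      using B(2) by simp
  qed
  finally show ?thesis unfolding G_def using B(1) by (rule power2_le_imp_le)
qed

lemma cfc_dom_root: "star a = a \<Longrightarrow> n \<ge> 1 \<Longrightarrow> cfc_dom a (root n)"
  by (auto simp: cfc_dom_def intro: continuous_intros)

lemma inverse_Suc_tendsto_0: "(\<lambda>n. c / real (Suc n)) \<longlonglongrightarrow> 0"
  using LIMSEQ_Suc[OF lim_const_over_n[of c]] by simp

lemma Cauchy_inverse_Suc:
  fixes X :: "nat \<Rightarrow> 'b::real_normed_vector"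
  assumes "\<And>m n. norm (X m - X n) \<le> c * (1 / real (Suc m) + 1 / real (Suc n))" "c \<ge> 0"
  shows "Cauchy X"
proof (rule CauchyI)
  fix e :: real assume "e > 0"
  then have "e / (2 * (c + 1)) > 0" using assms(2) by simp
  then obtain N where N: "1 / real (Suc N) < e / (2 * (c + 1))" using nat_approx_posE by blast
  show "\<exists>M. \<forall>m\<ge>M. \<forall>n\<ge>M. norm (X m - X n) < e"
  proof (intro exI[of _ N] allI impI)
    fix m n assume mn: "N \<le> m" "N \<le> n"
    have "1 / real (Suc m) \<le> 1 / real (Suc N)" "1 / real (Suc n) \<le> 1 / real (Suc N)"
      using mn by (auto intro!: divide_left_mono)
    then have "1 / real (Suc m) + 1 / real (Suc n) \<le> 2 * (1 / real (Suc N))" by linarith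
    then have "c * (1 / real (Suc m) + 1 / real (Suc n)) \<le> (c + 1) * (2 * (1 / real (Suc N)))"
      using assms(2) by (intro mult_mono) auto
    also have "\<dots> < (c + 1) * (2 * (e / (2 * (c + 1))))"
      using N assms(2) by (intro mult_strict_left_mono) auto
    also have "\<dots> = e" using assms(2) by (simp add: field_simps)
    finally show "norm (X m - X n) < e" using assms(1)[of m n] by linarith
  qed
qed

text \<open>\<open>u\<close> is the limit of \<open>x * f_n(d)\<close> for regularisations
  \<open>f_n\<close> of \<open>t^(-1/4)\<close>. Because \<open>t^(1/2) * f_n(t)\<close> converges
  uniformly to \<open>t^(1/4)\<close>, this sequence is Cauchy in norm even where \<open>d\<close>
  is not invertible.\<close>

lemma factor_root4:
  assumes x: "cstar_le (star x * x) d" and d: "d \<in> positives"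
  shows "\<exists>u. x = u * cfc (root 4) d"
proof -
  have s: "star d = d" using d positives_star by blast
  define \<eta> where "\<eta> n = 1 / real (Suc n)" for n
  have \<eta>: "\<eta> n > 0" for n by (simp add: \<eta>_def)
  \<comment> \<open>In terms of \<open>s = root 4 t\<close> this is
    \<open>s^3 / (s^4 + \<eta>^4)\<close>, which is \<open>1 / s\<close> regularised so that it
    vanishes at \<open>0\<close>; the homogeneous denominator makes the errors below linear in
    \<open>\<eta>\<close>.\<close>
  define f where "f n t = root 4 t ^ 3 / (t + \<eta> n ^ 4)" for n t
  have tp: "t + \<eta> n ^ 4 > 0" if "t \<in> rspec d" for t n
    using positives_rspec[OF d that] \<eta>[of n] by (simp add: add_nonneg_pos)
  have f: "cfc_dom d (f n)" for n
    unfolding cfc_dom_def f_def using s tp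
    by (auto intro!: continuous_intros simp: less_imp_neq[symmetric])
  define r where "r = cfc (root 4) d"
  have r: "cfc_dom d (root 4)" by (rule cfc_dom_root[OF s]) simp
  have key: "\<bar>s\<^sup>2 * (s ^ 3 / (s ^ 4 + e ^ 4)) - s\<bar> \<le> e" if "s \<ge> 0" "e > 0" for s e :: real
  proof -
    have p: "s ^ 4 + e ^ 4 > 0" using that by (simp add: add_nonneg_pos)
    have "s\<^sup>2 * (s ^ 3 / (s ^ 4 + e ^ 4)) - s = - (s * e ^ 4 / (s ^ 4 + e ^ 4))"
      using p by (simp add: field_simps power_numeral_reduce)
    moreover have "s * e ^ 4 / (s ^ 4 + e ^ 4) \<le> e"
    proof -
      have "s * e ^ 3 \<le> s ^ 4 + e ^ 4"
      proof (cases "s \<le> e")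
        case True
        then have "s * e ^ 3 \<le> e * e ^ 3" using that by (intro mult_right_mono) auto
        also have "\<dots> = e ^ 4" by (simp add: power_numeral_reduce)
        finally show ?thesis using that by (simp add: add_increasing)
      next
        case False
        then have "s * e ^ 3 \<le> s * s ^ 3" using that by (intro mult_left_mono power_mono) auto
        also have "\<dots> = s ^ 4" by (simp add: power_numeral_reduce)
        finally show ?thesis using that by (simp add: add_increasing2)
      qed
      then have "(s * e ^ 3) * e \<le> (s ^ 4 + e ^ 4) * e" using that by (intro mult_right_mono) auto
      then show ?thesis using p by (simp add: field_simps power_numeral_reduce)
    qed
    moreover have "s * e ^ 4 / (s ^ 4 + e ^ 4) \<ge> 0" using that p by simp
    ultimately show ?thesis by simp
  qed
  have key2: "\<bar>t * (f m t - f n t)\<^sup>2\<bar> \<le> (\<eta> m + \<eta> n)\<^sup>2" if t: "t \<in> rspec d" for t m n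
  proof -
    have t0: "t \<ge> 0" using positives_rspec[OF d t] .
    define s where "s = root 4 t"
    have s0: "s \<ge> 0" and ts: "t = s ^ 4" using t0 by (auto simp: s_def)
    have "f k t = s ^ 3 / (s ^ 4 + \<eta> k ^ 4)" for k unfolding f_def s_def[symmetric] ts[symmetric] ..
    then have "\<bar>s\<^sup>2 * f k t - s\<bar> \<le> \<eta> k" for k using key[OF s0 \<eta>] by simp
    from this[of m] this[of n] have "\<bar>s\<^sup>2 * f m t - s\<^sup>2 * f n t\<bar> \<le> \<eta> m + \<eta> n" by linarith
    then have "\<bar>s\<^sup>2 * (f m t - f n t)\<bar>\<^sup>2 \<le> (\<eta> m + \<eta> n)\<^sup>2"
      by (intro power_mono) (auto simp: right_diff_distrib)
    moreover have "\<bar>s\<^sup>2 * (f m t - f n t)\<bar>\<^sup>2 = t * (f m t - f n t)\<^sup>2"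
      by (simp add: ts power_mult_distrib flip: power_mult)
    ultimately show ?thesis using t0 by simp
  qed
  define X where "X n = x * cfc (f n) d" for n
  have "norm (X m - X n) \<le> 1 * (1 / real (Suc m) + 1 / real (Suc n))" for m n
  proof -
    have "X m - X n = x * cfc (\<lambda>t. f m t - f n t) d"
      unfolding X_def cfc_diff[OF f f] by (simp add: right_diff_distrib)
    moreover have "norm (x * cfc (\<lambda>t. f m t - f n t) d) \<le> \<eta> m + \<eta> n"
      by (rule norm_mult_cfc_le[OF x cfc_dom_diff[OF f f] _ key2])
         (use \<eta>[of m] \<eta>[of n] in simp_all)
    ultimately show ?thesis by (simp add: \<eta>_def)
  qed
  then have "Cauchy X" by (rule Cauchy_inverse_Suc) simp
  then obtain u where u: "X \<longlonglongrightarrow> u" using Cauchy_convergent_iff convergent_def by blast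
  have "(\<lambda>n. X n * r) \<longlonglongrightarrow> u * r" by (intro tendsto_intros u)
  moreover have "(\<lambda>n. X n * r) \<longlonglongrightarrow> x"
  proof (rule LIM_zero_cancel, rule Lim_null_comparison)
    show "\<forall>\<^sub>F n in sequentially. norm (X n * r - x) \<le> 1 / real (Suc n)"
    proof (intro always_eventually allI)
      fix n
      have "X n * r = x * cfc (\<lambda>t. f n t * root 4 t) d"
        unfolding X_def r_def cfc_mult[OF f r] by (simp add: mult.assoc)
      then have "norm (X n * r - x) = norm (x - x * cfc (\<lambda>t. f n t * root 4 t) d)"
        by (simp add: norm_minus_commute)
      also have "\<dots> \<le> \<eta> n * \<eta> n"
      proof (rule norm_diff_mult_cfc_le[OF x cfc_dom_mult[OF f r]])
        fix t assume t: "t \<in> rspec d"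
        have t0: "t \<ge> 0" using positives_rspec[OF d t] .
        define s where "s = root 4 t"
        have s0: "s \<ge> 0" and ts: "t = s ^ 4" using t0 by (auto simp: s_def)
        have p: "s ^ 4 + \<eta> n ^ 4 > 0" using tp[OF t, of n] ts by simp
        have "f n t * root 4 t = s ^ 4 / (s ^ 4 + \<eta> n ^ 4)"
          unfolding f_def s_def[symmetric] ts[symmetric] by (simp add: power_numeral_reduce ts)
        then have e: "1 - f n t * root 4 t = \<eta> n ^ 4 / (s ^ 4 + \<eta> n ^ 4)"
          using p by (simp add: field_simps)
        have "s\<^sup>2 * \<eta> n ^ 4 \<le> (\<eta> n * \<eta> n) * (s ^ 4 + \<eta> n ^ 4)"
        proof -
          have "0 \<le> (s\<^sup>2 - (\<eta> n)\<^sup>2)\<^sup>2" by simp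
          then have "s\<^sup>2 * (\<eta> n)\<^sup>2 \<le> s ^ 4 + \<eta> n ^ 4"
            using mult_nonneg_nonneg[of "s\<^sup>2" "(\<eta> n)\<^sup>2"]
            by (simp add: power2_eq_square power_numeral_reduce algebra_simps)
          then have "(\<eta> n * \<eta> n) * (s\<^sup>2 * (\<eta> n)\<^sup>2) \<le> (\<eta> n * \<eta> n) * (s ^ 4 + \<eta> n ^ 4)"
            by (intro mult_left_mono) auto
          then show ?thesis by (simp add: power_numeral_reduce ac_simps power2_eq_square)
        qed
        then have "s\<^sup>2 * (1 - f n t * root 4 t) \<le> \<eta> n * \<eta> n"
          unfolding e using p by (simp add: field_simps)
        moreover have "0 \<le> s\<^sup>2 * (1 - f n t * root 4 t)" unfolding e using p by simp
        ultimately have "(s\<^sup>2 * (1 - f n t * root 4 t))\<^sup>2 \<le> (\<eta> n * \<eta> n)\<^sup>2" by (intro power_mono)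
        moreover have "(s\<^sup>2 * (1 - f n t * root 4 t))\<^sup>2 = t * (1 - f n t * root 4 t)\<^sup>2"
          by (simp add: ts power_mult_distrib flip: power_mult)
        ultimately show "\<bar>t * (1 - f n t * root 4 t)\<^sup>2\<bar> \<le> (\<eta> n * \<eta> n)\<^sup>2" using t0 by simp
      qed simp
      also have "\<dots> \<le> 1 * \<eta> n" by (intro mult_right_mono) (auto simp: \<eta>_def)
      finally show "norm (X n * r - x) \<le> 1 / real (Suc n)" by (simp add: \<eta>_def)
    qed
  qed (rule inverse_Suc_tendsto_0)
  ultimately have "x = u * r" using LIMSEQ_unique by blast
  then show ?thesis unfolding r_def by blast
qed

text \<open>Together with \<open>npow_root\<close> this is existence and uniqueness of positive
  roots, which allows hypotheses on powers and on roots to be exchanged freely.\<close>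

lemma cfc_root_npow:
  assumes "e \<in> positives" "n \<ge> 1" shows "cfc (root n) (npow e n) = e"
proof -
  have s: "star e = e" using assms positives_star by blast
  have "cfc (root n) (npow e n) = cfc (root n) (cfc (\<lambda>t. t ^ n) e)"
    by (simp only: cfc_power[OF s assms(2)])
  also have "\<dots> = cfc (\<lambda>t. root n (t ^ n)) e"
    by (rule cfc_compose(3)[OF cfc_dom_power[OF s assms(2)]])
       (use assms in \<open>auto intro: continuous_intros\<close>)
  also have "\<dots> = cfc (\<lambda>t. t) e"
    by (rule cfc_cong(2)[OF cfc_dom_id[OF s]])
       (use positives_rspec[OF assms(1)] assms(2) in \<open>simp add: real_root_power_cancel\<close>)
  finally show ?thesis by (simp add: cfc_id s)
qed

lemma npow_positive: "e \<in> positives \<Longrightarrow> n \<ge> 1 \<Longrightarrow> npow e n \<in> positives"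
  using positives_cfc[OF cfc_dom_power, of e n] positives_rspec[of e]
  by (simp add: cfc_power positives_star)

lemma npow_root:
  assumes "a \<in> positives" "n \<ge> 1"
  shows "cfc (root n) a \<in> positives" "npow (cfc (root n) a) n = a"
proof -
  have s: "star a = a" using assms positives_star by blast
  note r = cfc_dom_root[OF s assms(2)]
  show "cfc (root n) a \<in> positives"
    by (rule positives_cfc[OF r]) (use positives_rspec[OF assms(1)] assms(2) in simp)
  have "npow (cfc (root n) a) n = cfc (\<lambda>t. root n t ^ n) a"
    by (rule cfc_npow(2)[OF r assms(2), symmetric])
  also have "\<dots> = cfc (\<lambda>t. t) a"
    by (rule cfc_cong(2)[OF cfc_dom_id[OF s]])
       (use positives_rspec[OF assms(1)] assms(2) in simp)
  finally show "npow (cfc (root n) a) n = a" by (simp add: cfc_id s)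
qed

lemma factor_fourth:
  assumes "cstar_le (star x * x) (npow e 4)" "e \<in> positives" shows "\<exists>u. x = u * e"
  using factor_root4[OF assms(1) npow_positive[OF assms(2)]] cfc_root_npow[OF assms(2), of 4] by simp

lemma sqrt_mult_sqrt: "t \<ge> 0 \<Longrightarrow> (sqrt t * x) * (sqrt t * y) = x * t * y" for t x y :: real
proof -
  assume "t \<ge> 0"
  have "(sqrt t * x) * (sqrt t * y) = (sqrt t * sqrt t) * (x * y)" by (simp only: ac_simps)
  also have "\<dots> = t * (x * y)" using \<open>t \<ge> 0\<close> by simp
  finally show ?thesis by (simp only: ac_simps)
qed

text \<open>Pedersen's form of Riesz decomposition: \<open>w\<^sub>i\<close> is the limit of
  \<open>x (d + \<epsilon>)\<^sup>-\<^sup>1 d\<^sup>1\<^sup>/\<^sup>2 z\<^sub>i\<close>, where \<open>d\<close> is the dominating sum.\<close>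

lemma riesz_decomposition:
  assumes fin: "finite S" and x: "cstar_le (star x * x) (\<Sum>i\<in>S. z i * star (z i))"
  shows "\<exists>w. x * star x = (\<Sum>i\<in>S. w i * star (w i)) \<and>
    (\<forall>i\<in>S. cstar_le (star (w i) * w i) (star (z i) * z i))"
proof -
  define d where "d = (\<Sum>i\<in>S. z i * star (z i))"
  have d: "d \<in> positives" unfolding d_def by (intro positives_sum mult_star_positive)
  have s: "star d = d" using d positives_star by blast
  note id = cfc_dom_id[OF s]
  have xd: "cstar_le (star x * x) d" using x by (simp add: d_def)
  have zd: "cstar_le (z i * star (z i)) d" if "i \<in> S" for i
  proof -
    have "d = z i * star (z i) + (\<Sum>j\<in>S - {i}. z j * star (z j))"
      unfolding d_def by (rule sum.remove[OF fin that])
    then show ?thesis by (simp add: cstar_le_def positives_sum mult_star_positive)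
  qed
  define \<eta> where "\<eta> n = 1 / real (Suc n)" for n
  have \<eta>: "\<eta> n > 0" for n by (simp add: \<eta>_def)
  \<comment> \<open>A regularisation of \<open>t^(-1/2)\<close>. The identity
    \<open>sqrt t * f n t = t / (t + \<eta>^2) \<le> 1\<close> yields the order bounds on
    \<open>w i\<close>, while uniform convergence of \<open>t * f n t\<close> to
    \<open>sqrt t\<close> yields the Cauchy property.\<close>
  define f where "f n t = sqrt t / (t + (\<eta> n)\<^sup>2)" for n t
  have tp: "t + (\<eta> n)\<^sup>2 > 0" if "t \<ge> 0" for t n
    using that \<eta>[of n] by (simp add: add_nonneg_pos)
  have f: "cfc_dom d (f n)" for n
    unfolding cfc_dom_def f_def using s tp positives_rspec[OF d]
    by (auto intro!: continuous_intros simp: less_imp_neq[symmetric])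
  note sq = cfc_dom_sqrt[OF s]
  define W where "W n i = x * cfc (f n) d * z i" for n i
  have bound: "\<bar>t * f n t - sqrt t\<bar> \<le> \<eta> n" if "t \<ge> 0" for t n
  proof -
    have "t * f n t - sqrt t = - (sqrt t * (\<eta> n)\<^sup>2 / (t + (\<eta> n)\<^sup>2))"
      using tp[OF that, of n] by (simp add: f_def field_simps)
    moreover have "sqrt t * (\<eta> n)\<^sup>2 / (t + (\<eta> n)\<^sup>2) \<le> \<eta> n"
    proof -
      have "0 \<le> (sqrt t - \<eta> n)\<^sup>2" by simp
      then have "2 * (sqrt t * \<eta> n) \<le> t + (\<eta> n)\<^sup>2"
        using that by (simp add: power2_diff)
      moreover have "0 \<le> sqrt t * \<eta> n" using that \<eta>[of n] by simp
      ultimately have "sqrt t * \<eta> n \<le> t + (\<eta> n)\<^sup>2" by linarith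
      then have "(sqrt t * \<eta> n) * \<eta> n \<le> (t + (\<eta> n)\<^sup>2) * \<eta> n"
        using \<eta>[of n] by (intro mult_right_mono) auto
      then show ?thesis using tp[OF that, of n] by (simp add: field_simps power2_eq_square)
    qed
    moreover have "0 \<le> sqrt t * (\<eta> n)\<^sup>2 / (t + (\<eta> n)\<^sup>2)" using tp[OF that, of n] that by simp
    ultimately show ?thesis by linarith
  qed
  have cauchy: "norm (W m i - W n i) \<le> 1 * (1 / real (Suc m) + 1 / real (Suc n))" if i: "i \<in> S" for m n i
  proof -
    define g where "g t = f m t - f n t" for t
    have g: "cfc_dom d g" unfolding g_def by (rule cfc_dom_diff[OF f f])
    define k where "k = cfc (\<lambda>t. sqrt t * g t) d"
    have kd: "cfc_dom d (\<lambda>t. sqrt t * g t)" by (rule cfc_dom_mult[OF sq g])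
    have sk: "star k = k" unfolding k_def by (rule star_cfc[OF kd])
    define G where "G = cfc g d"
    have sG: "star G = G" unfolding G_def by (rule star_cfc[OF g])
    have kk: "k * k = G * d * G"
    proof -
      have "k * k = cfc (\<lambda>t. (sqrt t * g t) * (sqrt t * g t)) d"
        unfolding k_def by (rule cfc_mult[OF kd kd, symmetric])
      also have "\<dots> = cfc (\<lambda>t. g t * t * g t) d"
        by (rule cfc_cong(2)[OF cfc_dom_mult[OF cfc_dom_mult[OF g id] g]])
           (use positives_rspec[OF d] in \<open>simp only: sqrt_mult_sqrt\<close>)
      also have "\<dots> = G * d * G"
        unfolding G_def using cfc_mult[OF cfc_dom_mult[OF g id] g] cfc_mult[OF g id] by (simp add: cfc_id[OF s])
      finally show ?thesis .
    qed
    have W: "W m i - W n i = x * G * z i"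
      unfolding W_def G_def g_def cfc_diff[OF f f] by (simp add: algebra_simps)
    have "(norm (x * G * z i))\<^sup>2 = norm (star (G * z i) * (star x * x) * (G * z i))"
      unfolding cstar_identity[symmetric] by (simp add: star_mult mult.assoc)
    also have "\<dots> \<le> norm (star (G * z i) * d * (G * z i))"
      by (intro norm_mono cstar_le_conj xd positives_conj star_mult_positive)
    also have "star (G * z i) * d * (G * z i) = star (k * z i) * (k * z i)"
    proof -
      have "star (k * z i) * (k * z i) = star (z i) * (k * k) * z i"
        by (simp add: star_mult sk mult.assoc)
      then show ?thesis unfolding kk by (simp add: star_mult sG mult.assoc)
    qed
    \<comment> \<open>After \<open>star x * x \<le> d\<close> has removed \<open>x\<close>, the
      equality of the norms of \<open>star v * v\<close> and \<open>v * star v\<close> brings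
      \<open>z i * star (z i)\<close> to the middle, where it too is dominated by
      \<open>d\<close>.\<close>
    also have "norm (star (k * z i) * (k * z i)) = norm (star k * (z i * star (z i)) * k)"
      unfolding cstar_identity using norm_mult_star[of "k * z i"] by (simp add: star_mult sk mult.assoc)
    also have "\<dots> \<le> norm (star k * d * k)"
      by (intro norm_mono cstar_le_conj zd[OF i] positives_conj mult_star_positive)
    also have "star k * d * k = cfc (\<lambda>t. (sqrt t * g t) * t * (sqrt t * g t)) d"
      unfolding sk unfolding k_def using cfc_mult[OF cfc_dom_mult[OF kd id] kd] cfc_mult[OF kd id]
      by (simp add: cfc_id[OF s])
    also have "norm \<dots> \<le> (\<eta> m + \<eta> n)\<^sup>2"
    proof (rule norm_cfc_le[OF cfc_dom_mult[OF cfc_dom_mult[OF kd id] kd]])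
      fix t assume "t \<in> rspec d"
      then have t: "t \<ge> 0" using positives_rspec[OF d] by blast
      from bound[OF t, of m] bound[OF t, of n] have "\<bar>t * f m t - t * f n t\<bar> \<le> \<eta> m + \<eta> n" by linarith
      then have "\<bar>t * g t\<bar>\<^sup>2 \<le> (\<eta> m + \<eta> n)\<^sup>2"
        by (intro power_mono) (auto simp: g_def right_diff_distrib)
      moreover have "(sqrt t * g t) * t * (sqrt t * g t) = (t * g t)\<^sup>2"
      proof -
        have "(sqrt t * g t) * t * (sqrt t * g t) = ((sqrt t * g t) * (sqrt t * g t)) * t"
          by (simp only: ac_simps)
        then show ?thesis unfolding sqrt_mult_sqrt[OF t] by (simp add: power2_eq_square)
      qed
      ultimately show "\<bar>(sqrt t * g t) * t * (sqrt t * g t)\<bar> \<le> (\<eta> m + \<eta> n)\<^sup>2" by simp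
    qed
    finally have "norm (x * G * z i) \<le> \<eta> m + \<eta> n"
      by (rule power2_le_imp_le) (use \<eta>[of m] \<eta>[of n] in simp)
    then show ?thesis by (simp add: W \<eta>_def)
  qed
  have "\<exists>w. (\<lambda>n. W n i) \<longlonglongrightarrow> w" if i: "i \<in> S" for i
    using Cauchy_inverse_Suc[of "\<lambda>n. W n i" 1, OF cauchy[OF i]] Cauchy_convergent_iff convergent_def by force
  then obtain w where w: "\<And>i. i \<in> S \<Longrightarrow> (\<lambda>n. W n i) \<longlonglongrightarrow> w i" by metis
  have ff: "cfc_dom d (\<lambda>t. f n t * t * f n t)" for n
    by (intro cfc_dom_mult f id)
  have ffeq: "cfc (\<lambda>t. f n t * t * f n t) d = cfc (f n) d * d * cfc (f n) d" for n
    using cfc_mult[OF cfc_dom_mult[OF f id] f] cfc_mult[OF f id] by (simp add: cfc_id[OF s])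
  have sf: "star (cfc (f n) d) = cfc (f n) d" for n by (rule star_cfc[OF f])
  have le: "cstar_le (star (W n i) * W n i) (star (z i) * z i)" for n i
  proof -
    define F where "F = cfc (f n) d"
    define h where "h = cfc (\<lambda>t. sqrt t * f n t) d"
    have hd: "cfc_dom d (\<lambda>t. sqrt t * f n t)" by (rule cfc_dom_mult[OF sq f])
    have sh: "star h = h" unfolding h_def by (rule star_cfc[OF hd])
    have "norm h \<le> 1" unfolding h_def
    proof (rule norm_cfc_le[OF hd])
      fix t assume "t \<in> rspec d"
      then have t: "t \<ge> 0" using positives_rspec[OF d] by blast
      have "sqrt t * f n t = t / (t + (\<eta> n)\<^sup>2)" using t by (simp add: f_def)
      then show "\<bar>sqrt t * f n t\<bar> \<le> 1" using t tp[OF t, of n] by simp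
    qed
    then have n1: "(norm h)\<^sup>2 \<le> 1" by (simp add: power_le_one)
    have hh: "star h * h = F * d * F"
    proof -
      have "star h * h = cfc (\<lambda>t. (sqrt t * f n t) * (sqrt t * f n t)) d"
        unfolding sh unfolding h_def by (rule cfc_mult[OF hd hd, symmetric])
      also have "\<dots> = cfc (\<lambda>t. f n t * t * f n t) d"
        by (rule cfc_cong(2)[OF ff])
           (use positives_rspec[OF d] in \<open>simp only: sqrt_mult_sqrt\<close>)
      finally show ?thesis by (simp add: ffeq F_def)
    qed
    have "star (W n i) * W n i = star (F * z i) * (star x * x) * (F * z i)"
      by (simp add: W_def F_def star_mult mult.assoc)
    moreover have "cstar_le (star (F * z i) * (star x * x) * (F * z i)) (star (F * z i) * d * (F * z i))"
      by (rule cstar_le_conj[OF xd])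
    moreover have "star (F * z i) * d * (F * z i) = star (z i) * (star h * h) * z i"
      unfolding hh by (simp add: star_mult F_def sf mult.assoc)
    moreover have "cstar_le (star (z i) * (star h * h) * z i) ((norm h)\<^sup>2 *\<^sub>R (star (z i) * z i))"
      by (rule conj_le_norm)
    moreover have "cstar_le ((norm h)\<^sup>2 *\<^sub>R (star (z i) * z i)) (star (z i) * z i)"
      unfolding cstar_le_def using positives_scaleR[OF star_mult_positive[of "z i"], of "1 - (norm h)\<^sup>2"] n1
      by (simp add: scaleR_diff_left)
    ultimately show ?thesis using cstar_le_trans by metis
  qed
  have "cstar_le (star (w i) * w i) (star (z i) * z i)" if i: "i \<in> S" for i
    by (rule cstar_le_limit[OF le, of "\<lambda>n. n" i]) (intro tendsto_intros w i)
  moreover have "x * star x = (\<Sum>i\<in>S. w i * star (w i))"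
  proof (rule LIMSEQ_unique)
    show "(\<lambda>n. \<Sum>i\<in>S. W n i * star (W n i)) \<longlonglongrightarrow> (\<Sum>i\<in>S. w i * star (w i))"
      by (intro tendsto_intros w)
    \<comment> \<open>The sum over \<open>i\<close> collapses to \<open>d\<close>, leaving
      \<open>t * (f n t)^2\<close>. This tends to \<open>1\<close> only away from \<open>0\<close>;
      the factor \<open>t\<close> in the hypothesis of \<open>norm_diff_mult_cfc_le\<close>
      compensates near \<open>0\<close>.\<close>
    have e: "(\<Sum>i\<in>S. W n i * star (W n i)) = x * cfc (\<lambda>t. f n t * t * f n t) d * star x" for n
    proof -
      have "(\<Sum>i\<in>S. W n i * star (W n i)) = (\<Sum>i\<in>S. x * cfc (f n) d * (z i * star (z i)) * (cfc (f n) d * star x))"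
        by (simp add: W_def star_mult sf mult.assoc)
      also have "\<dots> = x * cfc (f n) d * d * (cfc (f n) d * star x)"
        by (simp add: d_def sum_distrib_left sum_distrib_right)
      finally show ?thesis unfolding ffeq by (simp add: mult.assoc)
    qed
    show "(\<lambda>n. \<Sum>i\<in>S. W n i * star (W n i)) \<longlonglongrightarrow> x * star x"
    proof (rule LIM_zero_cancel, rule Lim_null_comparison)
      show "\<forall>\<^sub>F n in sequentially. norm ((\<Sum>i\<in>S. W n i * star (W n i)) - x * star x) \<le> (2 * norm x) / real (Suc n)"
      proof (intro always_eventually allI)
        fix n
        have "norm (x - x * cfc (\<lambda>t. f n t * t * f n t) d) \<le> 2 * \<eta> n"
        proof (rule norm_diff_mult_cfc_le[OF xd ff])
          fix t assume "t \<in> rspec d"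
          then have t: "t \<ge> 0" using positives_rspec[OF d] by blast
          define r where "r = t / (t + (\<eta> n)\<^sup>2)"
          have r: "0 \<le> r" "r \<le> 1" using t tp[OF t, of n] by (auto simp: r_def)
          have r1: "1 - r = (\<eta> n)\<^sup>2 / (t + (\<eta> n)\<^sup>2)" using tp[OF t, of n] by (simp add: r_def field_simps)
          have "f n t * t * f n t = r * r"
            using t by (simp add: f_def r_def power2_eq_square)
          then have "1 - f n t * t * f n t = (1 - r) * (1 + r)" by (simp add: algebra_simps)
          moreover have "(1 - r) * (1 + r) \<le> (1 - r) * 2" using r by (intro mult_left_mono) auto
          moreover have "0 \<le> (1 - r) * (1 + r)" using r by simp
          ultimately have "(1 - f n t * t * f n t)\<^sup>2 \<le> ((1 - r) * 2)\<^sup>2" by (intro power_mono) auto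
          then have "t * (1 - f n t * t * f n t)\<^sup>2 \<le> t * ((1 - r) * 2)\<^sup>2" using t by (intro mult_left_mono)
          also have "\<dots> = 4 * (t * (1 - r)) * (1 - r)" by (simp add: power2_eq_square algebra_simps)
          also have "\<dots> \<le> 4 * (t * (1 - r)) * 1" using r t by (intro mult_left_mono) auto
          also have "t * (1 - r) = r * (\<eta> n)\<^sup>2" unfolding r1 by (simp add: r_def)
          also have "4 * (r * (\<eta> n)\<^sup>2) * 1 \<le> 4 * (1 * (\<eta> n)\<^sup>2)" using mult_right_mono[OF r(2), of "(\<eta> n)\<^sup>2"] by simp
          also have "\<dots> = (2 * \<eta> n)\<^sup>2" by (simp add: power2_eq_square)
          finally show "\<bar>t * (1 - f n t * t * f n t)\<^sup>2\<bar> \<le> (2 * \<eta> n)\<^sup>2" using t by simp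
        qed (use \<eta>[of n] in simp)
        then have "norm ((x - x * cfc (\<lambda>t. f n t * t * f n t) d) * star x) \<le> (2 * \<eta> n) * norm x"
          using norm_mult_ineq[of "x - x * cfc (\<lambda>t. f n t * t * f n t) d" "star x"]
            mult_right_mono[of _ "2 * \<eta> n" "norm x"] by fastforce
        then show "norm ((\<Sum>i\<in>S. W n i * star (W n i)) - x * star x) \<le> (2 * norm x) / real (Suc n)"
          unfolding e by (simp add: \<eta>_def left_diff_distrib norm_minus_commute)
      qed
    qed (rule inverse_Suc_tendsto_0)
  qed
  ultimately show ?thesis by blast
qed

section \<open>Prime ideals and roots of positive elements\<close>

lemma alg_ideal_0: "alg_ideal I \<Longrightarrow> 0 \<in> I"
  by (simp add: alg_ideal_def additive_subgroup_def)

lemma alg_ideal_diff: "alg_ideal I \<Longrightarrow> x \<in> I \<Longrightarrow> y \<in> I \<Longrightarrow> x - y \<in> I"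
  by (simp add: alg_ideal_def additive_subgroup_def)

lemma alg_ideal_add: "alg_ideal I \<Longrightarrow> x \<in> I \<Longrightarrow> y \<in> I \<Longrightarrow> x + y \<in> I"
  using alg_ideal_diff[of I x "0 - y"] alg_ideal_diff[of I 0 y] alg_ideal_0[of I] by simp

lemma alg_ideal_mult: "alg_ideal I \<Longrightarrow> x \<in> I \<Longrightarrow> a * x \<in> I" "alg_ideal I \<Longrightarrow> x \<in> I \<Longrightarrow> x * a \<in> I"
  by (auto simp: alg_ideal_def)

lemma alg_idealI:
  assumes "0 \<in> I" "\<And>x y. x \<in> I \<Longrightarrow> y \<in> I \<Longrightarrow> x - y \<in> I"
    "\<And>a x. x \<in> I \<Longrightarrow> a * x \<in> I" "\<And>a x. x \<in> I \<Longrightarrow> x * a \<in> I"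
  shows "alg_ideal I"
  using assms by (simp add: alg_ideal_def additive_subgroup_def)

lemma alg_ideal_npow: "alg_ideal I \<Longrightarrow> x \<in> I \<Longrightarrow> n \<ge> 1 \<Longrightarrow> npow x n \<in> I"
  by (cases "n = 1") (auto simp: npow_Suc[of "n - 1" x, simplified] alg_ideal_mult)

lemma alg_ideal_npow_mono:
  assumes "alg_ideal I" "npow x m \<in> I" "1 \<le> m" "m \<le> n" shows "npow x n \<in> I"
proof (cases "m = n")
  case False
  then have "npow x n = npow x m * npow x (n - m)"
    using assms npow_add[of m "n - m" x] by simp
  then show ?thesis using assms alg_ideal_mult(2) by simp
qed (use assms in simp)

text \<open>A discrete version of the Lyapunov equation: \<open>e\<^sup>2 q e\<^sup>2 = e\<^sup>3 r + r' e\<^sup>3\<close> is solved by telescoping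
  \<open>p\<^sub>n q p\<^sub>n\<close> for \<open>p\<^sub>n = e\<^sup>2 (1 + 8\<^sup>n e\<^sup>3)\<^sup>-\<^sup>1\<close>, whose consecutive differences are divisible by \<open>e\<^sup>3\<close>.\<close>

lemma ideal_sandwich:
  assumes I: "alg_ideal I" and e: "e \<in> positives" and e3: "npow e 3 \<in> I"
  shows "npow e 2 * q * npow e 2 \<in> I"
proof -
  have s: "star e = e" using e positives_star by blast
  define p where "p n t = t\<^sup>2 / (1 + 8 ^ n * t ^ 3)" for n and t :: real
  define r where "r n t = 7 * 8 ^ n * t\<^sup>2 / ((1 + 8 ^ n * t ^ 3) * (1 + 8 ^ Suc n * t ^ 3))" for n and t :: real
  have pos: "1 + 8 ^ n * t ^ 3 > 0" if "t \<ge> 0" for t :: real and n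
    using that by (simp add: add_pos_nonneg)
  have t0: "t \<in> rspec e \<Longrightarrow> t \<ge> 0" for t using positives_rspec[OF e] .
  have pd: "cfc_dom e (p n)" for n
    unfolding cfc_dom_def p_def using s pos t0
    by (auto intro!: continuous_intros simp: less_imp_neq[symmetric])
  have rd: "cfc_dom e (r n)" for n
    unfolding cfc_dom_def r_def using s pos[of _ n] pos[of _ "Suc n"] t0
    by (auto intro!: continuous_intros simp: less_imp_neq[symmetric])
  define P where "P n = cfc (p n) e" for n
  define R where "R n = cfc (r n) e" for n
  define b where "b = npow e 3"
  have cd: "cfc_dom e (\<lambda>t. t ^ 3)" by (rule cfc_dom_power[OF s]) simp
  have b: "b = cfc (\<lambda>t. t ^ 3) e" unfolding b_def by (rule cfc_power[OF s, symmetric]) simp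
  have diff: "P n - P (Suc n) = b * R n" "P n - P (Suc n) = R n * b" for n
  proof -
    have *: "p n t - p (Suc n) t = t ^ 3 * r n t" if "t \<in> rspec e" for t
    proof -
      define x y where "x = 1 + 8 ^ n * t ^ 3" and "y = 1 + 8 ^ Suc n * t ^ 3"
      have "x > 0" "y > 0" using pos[OF t0[OF that]] unfolding x_def y_def by blast+
      then have "t\<^sup>2 / x - t\<^sup>2 / y = t\<^sup>2 * (y - x) / (x * y)" by (simp add: field_simps)
      also have "y - x = t ^ 3 * (7 * 8 ^ n)" by (simp add: x_def y_def)
      finally show ?thesis by (simp add: p_def r_def x_def y_def)
    qed
    have "P n - P (Suc n) = cfc (\<lambda>t. p n t - p (Suc n) t) e"
      unfolding P_def by (rule cfc_diff[OF pd pd, symmetric])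
    also have "\<dots> = cfc (\<lambda>t. t ^ 3 * r n t) e"
      by (rule cfc_cong(2)[OF cfc_dom_mult[OF cd rd]]) (simp add: *)
    finally have "P n - P (Suc n) = cfc (\<lambda>t. t ^ 3 * r n t) e" .
    then show "P n - P (Suc n) = b * R n" "P n - P (Suc n) = R n * b"
      using cfc_mult[OF cd rd, of n] cfc_mult[OF rd cd, of n] by (simp_all add: b R_def mult.commute)
  qed
  \<comment> \<open>With \<open>u = 2^n * t\<close> this is \<open>u^2 \<le> 1 + u^3\<close>. So
    \<open>P n\<close> has size at most \<open>4^(-n)\<close> while \<open>R n\<close> grows at most
    like \<open>2^n\<close>, and the terms of both series decay like \<open>2^(-n)\<close>.\<close>
  have key: "4 ^ n * t\<^sup>2 \<le> 1 + 8 ^ n * t ^ 3" if "t \<ge> 0" for t :: real and n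
  proof -
    define u where "u = 2 ^ n * t"
    have "u \<ge> 0" using that by (simp add: u_def)
    have "u\<^sup>2 \<le> 1 + u ^ 3"
    proof (cases "u \<le> 1")
      case True
      then have "u\<^sup>2 \<le> 1" using \<open>u \<ge> 0\<close> by (simp add: power_le_one)
      then show ?thesis using \<open>u \<ge> 0\<close> by (simp add: add_increasing2)
    next
      case False
      then have "u\<^sup>2 \<le> u ^ 3" by (intro power_increasing) auto
      then show ?thesis by simp
    qed
    moreover have "u\<^sup>2 = 4 ^ n * t\<^sup>2" "u ^ 3 = 8 ^ n * t ^ 3"
      unfolding u_def power_mult_distrib power_mult[symmetric] mult.commute[of n]
      unfolding power_mult by simp_all
    ultimately show ?thesis by simp
  qed
  have pn: "p n t \<le> 1 / 4 ^ n" if "t \<ge> 0" for t n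
    using key[OF that, of n] pos[OF that, of n] by (simp add: p_def field_simps)
  have nP: "norm (P n) \<le> (1/4) ^ n" for n
    unfolding P_def
  proof (rule norm_cfc_le[OF pd])
    fix t assume "t \<in> rspec e"
    then have t: "t \<ge> 0" by (rule t0)
    have "p n t \<le> 1 / 4 ^ n" by (rule pn[OF t])
    moreover have "p n t \<ge> 0" using pos[OF t, of n] by (simp add: p_def)
    ultimately show "\<bar>p n t\<bar> \<le> (1/4) ^ n" by (simp add: power_one_over)
  qed
  have nR: "norm (R n) \<le> 7 * 2 ^ n" for n
    unfolding R_def
  proof (rule norm_cfc_le[OF rd])
    fix t assume "t \<in> rspec e"
    then have t: "t \<ge> 0" by (rule t0)
    have "r n t = 7 * 8 ^ n * p n t / (1 + 8 ^ Suc n * t ^ 3)" by (simp add: r_def p_def)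
    also have "\<dots> \<le> 7 * 8 ^ n * p n t / 1"
      using t pos[OF t, of n] pos[OF t, of "Suc n"] by (intro divide_left_mono) (auto simp: p_def)
    also have "\<dots> \<le> 7 * 8 ^ n * (1 / 4 ^ n)"
      using mult_left_mono[OF pn[OF t, of n], of "7 * 8 ^ n"] by simp
    also have "\<dots> = 7 * (8 ^ n / 4 ^ n)" by simp
    also have "(8 :: real) ^ n / 4 ^ n = 2 ^ n" by (simp flip: power_divide)
    finally have "r n t \<le> 7 * 2 ^ n" .
    moreover have "r n t \<ge> 0" using pos[OF t, of n] pos[OF t, of "Suc n"] by (simp add: r_def)
    ultimately show "\<bar>r n t\<bar> \<le> 7 * 2 ^ n" by simp
  qed
  have half: "(7 * 2 ^ n) * c * (1/4) ^ n = 7 * c * (1/2) ^ n"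
    "(1/4) ^ n * c * (7 * 2 ^ n) = 7 * c * (1/2) ^ n" for n and c :: real
  proof -
    have "(2 :: real) ^ n * (1/4) ^ n = (1/2) ^ n" by (simp flip: power_mult_distrib)
    moreover have "(7 * 2 ^ n) * c * (1/4) ^ n = 7 * c * (2 ^ n * (1/4) ^ n)" by (simp only: ac_simps)
    ultimately show "(7 * 2 ^ n) * c * (1/4) ^ n = 7 * c * (1/2) ^ n" by simp
    then show "(1/4) ^ n * c * (7 * 2 ^ n) = 7 * c * (1/2) ^ n" by (simp only: ac_simps)
  qed
  have sm: "summable (\<lambda>n. 7 * norm q * (1/2 :: real) ^ n)"
    by (intro summable_mult summable_geometric) simp
  have s1: "summable (\<lambda>n. R n * q * P n)"
  proof (rule summable_comparison_test'[OF sm])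
    fix n :: nat
    have "norm (R n * q * P n) \<le> norm (R n) * norm q * norm (P n)"
      using norm_mult_ineq[of "R n * q" "P n"] mult_right_mono[OF norm_mult_ineq[of "R n" q], of "norm (P n)"] by simp
    also have "\<dots> \<le> (7 * 2 ^ n) * norm q * (1/4) ^ n"
      by (intro mult_mono nR nP) auto
    finally show "norm (R n * q * P n) \<le> 7 * norm q * (1/2) ^ n" unfolding half .
  qed
  have s2: "summable (\<lambda>n. P (Suc n) * q * R n)"
  proof (rule summable_comparison_test'[OF sm])
    fix n :: nat
    have "norm (P (Suc n) * q * R n) \<le> norm (P (Suc n)) * norm q * norm (R n)"
      using norm_mult_ineq[of "P (Suc n) * q" "R n"]
        mult_right_mono[OF norm_mult_ineq[of "P (Suc n)" q], of "norm (R n)"] by simp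
    also have "\<dots> \<le> (1/4) ^ n * norm q * (7 * 2 ^ n)"
    proof (intro mult_mono nR)
      have "norm (P (Suc n)) \<le> (1/4) ^ Suc n" by (rule nP)
      also have "\<dots> \<le> (1/4) ^ n" by simp
      finally show "norm (P (Suc n)) \<le> (1/4) ^ n" .
    qed auto
    finally show "norm (P (Suc n) * q * R n) \<le> 7 * norm q * (1/2) ^ n" unfolding half .
  qed
  have step: "P n * q * P n - P (Suc n) * q * P (Suc n) = b * (R n * q * P n) + (P (Suc n) * q * R n) * b" for n
  proof -
    have "P n * q * P n - P (Suc n) * q * P (Suc n)
        = (P n - P (Suc n)) * q * P n + P (Suc n) * q * (P n - P (Suc n))"
      by (simp add: algebra_simps)
    also have "(P n - P (Suc n)) * q * P n = b * (R n * q * P n)"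
      unfolding diff(1) by (simp add: mult.assoc)
    also have "P (Suc n) * q * (P n - P (Suc n)) = (P (Suc n) * q * R n) * b"
      unfolding diff(2) by (simp add: mult.assoc)
    finally show ?thesis .
  qed
  have P0: "P \<longlonglongrightarrow> 0"
    by (rule Lim_null_comparison[of _ "\<lambda>n. (1/4) ^ n"]) (auto simp: nP intro: LIMSEQ_power_zero)
  have "(\<lambda>n. P n * q * P n) \<longlonglongrightarrow> 0 * q * 0" by (intro tendsto_mult P0 tendsto_const)
  then have "(\<lambda>n. P n * q * P n) \<longlonglongrightarrow> 0" by simp
  from telescope_sums'[OF this]
  have "(\<lambda>n. P n * q * P n - P (Suc n) * q * P (Suc n)) sums (P 0 * q * P 0 - 0)" .
  moreover have "(\<lambda>n. b * (R n * q * P n) + (P (Suc n) * q * R n) * b) sums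
      (b * (\<Sum>n. R n * q * P n) + (\<Sum>n. P (Suc n) * q * R n) * b)"
    by (intro sums_add sums_mult sums_mult2 summable_sums s1 s2)
  ultimately have "P 0 * q * P 0 = b * (\<Sum>n. R n * q * P n) + (\<Sum>n. P (Suc n) * q * R n) * b"
    unfolding step using sums_unique2 by force
  then have PI: "P 0 * q * P 0 \<in> I"
    using I e3 by (simp add: alg_ideal_add alg_ideal_mult b_def)
  \<comment> \<open>The telescoping sum starts at \<open>P 0 = e^2 * (1 + e^3)^(-1)\<close> rather
    than at \<open>e^2\<close>; the two differ by a multiple of \<open>b\<close>, which is harmless
    in the ideal.\<close>
  have "npow e 2 = P 0 + b * P 0" "npow e 2 = P 0 + P 0 * b"
  proof -
    have *: "t ^ 2 = p 0 t + t ^ 3 * p 0 t" if "t \<in> rspec e" for t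
    proof -
      have "1 + t ^ 3 > 0" using pos[OF t0[OF that], of 0] by simp
      moreover have "p 0 t + t ^ 3 * p 0 t = (1 + t ^ 3) * p 0 t" by (simp add: algebra_simps)
      ultimately show ?thesis by (simp add: p_def)
    qed
    have d: "cfc_dom e (\<lambda>t. p 0 t + t ^ 3 * p 0 t)" by (intro cfc_dom_add cfc_dom_mult pd cd)
    have "npow e 2 = cfc (\<lambda>t. t ^ 2) e" by (rule cfc_power[OF s, symmetric]) simp
    also have "\<dots> = cfc (\<lambda>t. p 0 t + t ^ 3 * p 0 t) e" by (rule cfc_cong(2)[OF d]) (rule *[symmetric])
    also have "\<dots> = P 0 + b * P 0"
      unfolding b P_def cfc_add[OF pd cfc_dom_mult[OF cd pd]] cfc_mult[OF cd pd] ..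
    finally show "npow e 2 = P 0 + b * P 0" .
    moreover have "b * P 0 = P 0 * b"
      unfolding b P_def cfc_mult[OF cd pd, symmetric] cfc_mult[OF pd cd, symmetric] by (simp add: mult.commute)
    ultimately show "npow e 2 = P 0 + P 0 * b" by simp
  qed
  then have "npow e 2 * q * npow e 2 = (P 0 + b * P 0) * q * (P 0 + P 0 * b)" by metis
  also have "\<dots> = P 0 * q * P 0 + b * (P 0 * q * (P 0 + P 0 * b)) + (P 0 * q * P 0) * b"
    by (simp add: algebra_simps)
  finally show ?thesis
    using I PI e3 by (simp add: alg_ideal_add alg_ideal_mult b_def)
qed

lemma prime_ideal_alg: "prime_ideal P \<Longrightarrow> alg_ideal P"
  by (simp add: prime_ideal_def)

lemma alg_ideal_Inter: "(\<And>L. L \<in> F \<Longrightarrow> alg_ideal L) \<Longrightarrow> alg_ideal (\<Inter>F)"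
  by (auto simp: alg_ideal_def additive_subgroup_def)

text \<open>Without a unit, the ideal \<open>L\<close> generated by \<open>y\<close> also contains
  integer multiples of \<open>y\<close> and one-sided products, hence the condition on
  \<open>y * y\<close> next to that on \<open>y * a * y\<close>. No description of \<open>L\<close>
  is needed for \<open>L * L \<subseteq> P\<close>: the conditions on the left and on the right
  factor define ideals \<open>T\<close> and \<open>T'\<close>, and each contains
  \<open>y\<close>.\<close>

lemma prime_ideal_sandwich:
  assumes P: "prime_ideal P" and yy: "y * y \<in> P" and y: "\<And>a. y * a * y \<in> P"
  shows "y \<in> P"
proof -
  define L where "L = \<Inter>{L. alg_ideal L \<and> y \<in> L}"
  have aP: "alg_ideal P" using P prime_ideal_alg by blast
  have aL: "alg_ideal L" unfolding L_def by (rule alg_ideal_Inter) simp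
  have L_min: "L \<subseteq> T" if "alg_ideal T" "y \<in> T" for T using that by (auto simp: L_def)
  note P0 = alg_ideal_0[OF aP] and Pd = alg_ideal_diff[OF aP] and Pm = alg_ideal_mult[OF aP]
  define T where "T = {u. u * y \<in> P \<and> (\<forall>a. u * a * y \<in> P)}"
  have "alg_ideal T"
  proof (rule alg_idealI)
    show "0 \<in> T" using P0 by (simp add: T_def)
    show "u - v \<in> T" if "u \<in> T" "v \<in> T" for u v
      using that Pd by (simp add: T_def left_diff_distrib)
    show "u * b \<in> T" if u: "u \<in> T" for u b
    proof -
      have "u * (b * a) * y \<in> P" for a using u unfolding T_def by blast
      then show ?thesis using u by (simp add: T_def mult.assoc)
    qed
    show "b * u \<in> T" if u: "u \<in> T" for u b
    proof -
      have "b * (u * y) \<in> P" "b * (u * a * y) \<in> P" for a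
        using u by (auto simp: T_def intro: Pm)
      then show ?thesis by (simp add: T_def mult.assoc)
    qed
  qed
  moreover have "y \<in> T" using yy y by (simp add: T_def)
  ultimately have LT: "L \<subseteq> T" by (rule L_min)
  define T' where "T' = {v. \<forall>u\<in>L. u * v \<in> P}"
  have "alg_ideal T'"
  proof (rule alg_idealI)
    show "0 \<in> T'" using P0 by (simp add: T'_def)
    show "u - v \<in> T'" if "u \<in> T'" "v \<in> T'" for u v
      using that Pd by (simp add: T'_def right_diff_distrib)
    show "v * a \<in> T'" if v: "v \<in> T'" for v a
    proof -
      have "u * v * a \<in> P" if "u \<in> L" for u using v that by (auto simp: T'_def intro: Pm)
      then show ?thesis by (simp add: T'_def mult.assoc)
    qed
    show "a * v \<in> T'" if v: "v \<in> T'" for v a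
    proof -
      have "(u * a) * v \<in> P" if "u \<in> L" for u
        using v alg_ideal_mult(2)[OF aL that, of a] by (auto simp: T'_def)
      then show ?thesis by (simp add: T'_def mult.assoc)
    qed
  qed
  moreover have "y \<in> T'" using LT by (auto simp: T'_def T_def)
  ultimately have "L \<subseteq> T'" by (rule L_min)
  then have "{x * y | x y. x \<in> L \<and> y \<in> L} \<subseteq> P" by (auto simp: T'_def)
  then have "ideal_prod L L \<subseteq> P"
    unfolding ideal_prod_def by (rule hull_minimal) (use aP in \<open>simp add: alg_ideal_def\<close>)
  then have "L \<subseteq> P" using P aL by (auto simp: prime_ideal_def)
  then show ?thesis by (auto simp: L_def)
qed

lemma prime_ideal_npow:
  assumes P: "prime_ideal P" and a: "a \<in> positives" and n: "n \<ge> 1" "npow a n \<in> P"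
  shows "a \<in> P"
  using n
proof (induction n rule: dec_induct)
  case (step n)
  have aP: "alg_ideal P" using P prime_ideal_alg by blast
  have sq: "npow e 2 \<in> P" if e: "e \<in> positives" "npow e 3 \<in> P" for e
  proof (rule prime_ideal_sandwich[OF P])
    have "npow e 2 * npow e 2 = npow e 3 * e"
      using npow_add[of 2 2 e] npow_add[of 3 1 e] by simp
    then show "npow e 2 * npow e 2 \<in> P" using alg_ideal_mult(2)[OF aP e(2)] by simp
    show "npow e 2 * q * npow e 2 \<in> P" for q by (rule ideal_sandwich[OF aP e])
  qed
  \<comment> \<open>Two applications of \<open>sq\<close> multiply the exponent by
    \<open>4/9\<close>: from \<open>a^(n + 1) = c^(9 * (n + 1))\<close> to
    \<open>c^(4 * (n + 1))\<close>, and \<open>4 * (n + 1) \<le> 9 * n\<close>. One application,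
    with factor \<open>2/3\<close>, would not get from \<open>a^2\<close> to
    \<open>a\<close>.\<close>
  define c where "c = cfc (root 9) a"
  have c: "c \<in> positives" "npow c 9 = a" unfolding c_def using npow_root[OF a, of 9] by auto
  let ?m = "Suc n"
  have "npow (npow c (3 * ?m)) 3 = npow a ?m"
    unfolding c(2)[symmetric] by (simp add: npow_mult[symmetric])
  then have "npow (npow c (3 * ?m)) 2 \<in> P" using step sq npow_positive[OF c(1)] by simp
  then have "npow (npow c (2 * ?m)) 3 \<in> P" by (simp add: npow_mult[symmetric])
  then have "npow (npow c (2 * ?m)) 2 \<in> P" using sq npow_positive[OF c(1)] by simp
  moreover have "npow c (2 * ?m * 2) = npow (npow c (2 * ?m)) 2" by (rule npow_mult) auto
  moreover have "2 * ?m * 2 = 4 * ?m" by simp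
  ultimately have "npow c (4 * ?m) \<in> P" by (simp only:)
  then have "npow c (9 * n) \<in> P" by (rule alg_ideal_npow_mono[OF aP]) (use step in auto)
  moreover have "npow c (9 * n) = npow a n" using npow_mult[of 9 n c] step c(2) by simp
  ultimately show ?case using step by simp
qed simp

text \<open>As in commutative algebra, an ideal maximal among those avoiding the powers of \<open>x\<close> is prime.\<close>

lemma prime_ideal_avoiding:
  assumes I: "alg_ideal I" and x: "\<And>n. n \<ge> 1 \<Longrightarrow> npow x n \<notin> I"
  shows "\<exists>P. prime_ideal P \<and> I \<subseteq> P \<and> x \<notin> P"
proof -
  define F where "F = {P. alg_ideal P \<and> I \<subseteq> P \<and> (\<forall>n\<ge>1. npow x n \<notin> P)}"
  have "\<exists>M\<in>F. \<forall>X\<in>F. M \<subseteq> X \<longrightarrow> X = M"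
  proof (rule subset_Zorn_nonempty)
    show "F \<noteq> {}" using I x by (auto simp: F_def)
    fix C assume C: "C \<noteq> {}" "subset.chain F C"
    then have CF: "C \<subseteq> F" and ch: "\<And>X Y. X \<in> C \<Longrightarrow> Y \<in> C \<Longrightarrow> X \<subseteq> Y \<or> Y \<subseteq> X"
      by (auto simp: subset.chain_def subset_chain_def)
    have "u - v \<in> \<Union>C" if uv: "u \<in> \<Union>C" "v \<in> \<Union>C" for u v
    proof -
      obtain X Y where XY: "X \<in> C" "Y \<in> C" "u \<in> X" "v \<in> Y" using uv by blast
      with ch[of X Y] obtain Z where "Z \<in> C" "u \<in> Z" "v \<in> Z" by blast
      with CF show ?thesis using alg_ideal_diff[of Z u v] by (auto simp: F_def)
    qed
    moreover have "0 \<in> \<Union>C" using C(1) CF alg_ideal_0 by (auto simp: F_def)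
    moreover have "a * u \<in> \<Union>C \<and> u * a \<in> \<Union>C" if "u \<in> \<Union>C" for a u
      using that CF alg_ideal_mult by (force simp: F_def)
    ultimately have "alg_ideal (\<Union>C)" by (auto simp: alg_ideal_def additive_subgroup_def)
    then show "\<Union>C \<in> F" using C(1) CF by (auto simp: F_def)
  qed
  then obtain P where PF: "P \<in> F" and max: "\<And>X. X \<in> F \<Longrightarrow> P \<subseteq> X \<Longrightarrow> X = P" by blast
  then have P: "alg_ideal P" "I \<subseteq> P" "\<And>n. n \<ge> 1 \<Longrightarrow> npow x n \<notin> P" by (auto simp: F_def)
  have big: "\<exists>n\<ge>1. \<exists>u\<in>L. \<exists>v\<in>P. npow x n = u + v" if L: "alg_ideal L" "\<not> L \<subseteq> P" for L
  proof (rule ccontr)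
    assume neg: "\<not> ?thesis"
    define X where "X = {u + v | u v. u \<in> L \<and> v \<in> P}"
    have "alg_ideal X"
      unfolding alg_ideal_def additive_subgroup_def
    proof (intro conjI ballI allI)
      show "0 \<in> X" unfolding X_def using alg_ideal_0[OF L(1)] alg_ideal_0[OF P(1)] by force
      fix a b assume "a \<in> X" "b \<in> X"
      then obtain u v u' v' where "a = u + v" "b = u' + v'" "u \<in> L" "v \<in> P" "u' \<in> L" "v' \<in> P"
        by (auto simp: X_def)
      then have "a - b = (u - u') + (v - v')" "u - u' \<in> L" "v - v' \<in> P"
        using alg_ideal_diff L P by auto
      then show "a - b \<in> X" by (auto simp: X_def)
    next
      fix a b assume "b \<in> X"
      then obtain u v where uv: "b = u + v" "u \<in> L" "v \<in> P" by (auto simp: X_def)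
      then show "a * b \<in> X" "b * a \<in> X"
        using alg_ideal_mult[OF L(1), of u a] alg_ideal_mult[OF P(1), of v a]
        by (auto simp: X_def distrib_left distrib_right)
    qed
    moreover have PX: "P \<subseteq> X" unfolding X_def using alg_ideal_0[OF L(1)] by force
    moreover have "npow x n \<notin> X" if "n \<ge> 1" for n using neg that by (auto simp: X_def)
    ultimately have "X \<in> F" using P(2) by (auto simp: F_def)
    with max PX have "X = P" by blast
    moreover have "L \<subseteq> X" unfolding X_def using alg_ideal_0[OF P(1)] by force
    ultimately show False using L(2) by blast
  qed
  have "L \<subseteq> P \<or> L' \<subseteq> P" if L: "alg_ideal L" "alg_ideal L'" "ideal_prod L L' \<subseteq> P" for L L'
  proof (rule ccontr)
    assume "\<not> (L \<subseteq> P \<or> L' \<subseteq> P)"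
    with big[of L] big[of L'] L obtain m u v n u' v' where
      *: "m \<ge> 1" "u \<in> L" "v \<in> P" "npow x m = u + v" "n \<ge> 1" "u' \<in> L'" "v' \<in> P" "npow x n = u' + v'"
      by metis
    have "u * u' \<in> ideal_prod L L'"
      unfolding ideal_prod_def by (rule hull_inc) (use * in blast)
    then have "u * u' \<in> P" using L by blast
    moreover have "npow x (m + n) = u * u' + (u * v' + v * (u' + v'))"
      using * by (simp add: npow_add algebra_simps)
    ultimately have "npow x (m + n) \<in> P"
      using * P(1) by (simp add: alg_ideal_add alg_ideal_mult)
    then show False using P(3)[of "m + n"] * by simp
  qed
  moreover have "x \<notin> P" using P(3)[of 1] by simp
  then have "P \<noteq> UNIV" by blast
  ultimately have "prime_ideal P" using P by (simp add: prime_ideal_def)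
  then show ?thesis using P \<open>x \<notin> P\<close> by blast
qed

section \<open>Elements of the semiprime closure\<close>

lemma npow_in_of_semiprime_closure:
  assumes "alg_ideal I" "x \<in> semiprime_closure I" shows "\<exists>n\<ge>1. npow x n \<in> I"
  using prime_ideal_avoiding[OF assms(1), of x] assms(2) by (auto simp: semiprime_closure_def)

lemma alg_ideal_semiprime_closure: "alg_ideal (semiprime_closure I)"
  unfolding semiprime_closure_def by (rule alg_ideal_Inter) (simp add: prime_ideal_alg)

lemma semiprime_closure_superset: "I \<subseteq> semiprime_closure I"
  by (auto simp: semiprime_closure_def)

lemma semiprime_closure_mono: "I \<subseteq> I' \<Longrightarrow> semiprime_closure I \<subseteq> semiprime_closure I'"
  by (auto simp: semiprime_closure_def)

lemma semiprime_closure_npow: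
  assumes "a \<in> positives" "n \<ge> 1" "npow a n \<in> semiprime_closure I"
  shows "a \<in> semiprime_closure I"
  using prime_ideal_npow[OF _ assms(1,2)] assms(3) by (auto simp: semiprime_closure_def)

text \<open>Take \<open>e = (star x * x)^(1/4)\<close>: its fourth power is in the closure, hence so
  is \<open>e\<close> itself. This is what makes membership of \<open>x\<close> and of
  \<open>star x * x\<close> equivalent.\<close>

lemma semiprime_closure_factor:
  assumes "star x * x \<in> semiprime_closure I"
  shows "\<exists>u e. e \<in> semiprime_closure I \<and> x = u * e"
proof -
  define a where "a = star x * x"
  have a: "a \<in> positives" by (simp add: a_def star_mult_positive)
  obtain u where u: "x = u * cfc (root 4) a"
    using factor_root4[of x a, OF _ a] by (auto simp: a_def)
  have "npow (cfc (root 4) a) 4 = a" "cfc (root 4) a \<in> positives" using npow_root[OF a, of 4] by auto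
  then have "cfc (root 4) a \<in> semiprime_closure I"
    using semiprime_closure_npow[of "cfc (root 4) a" 4 I] assms by (simp add: a_def)
  with u show ?thesis by blast
qed

lemma semiprime_closure_star_mult: "star x * x \<in> semiprime_closure I \<longleftrightarrow> x \<in> semiprime_closure I"
  using semiprime_closure_factor alg_ideal_mult(1)[OF alg_ideal_semiprime_closure] by metis

lemma semiprime_closure_mult_star: "x * star x \<in> semiprime_closure I \<longleftrightarrow> x \<in> semiprime_closure I"
proof
  assume "x * star x \<in> semiprime_closure I"
  then have "star x \<in> semiprime_closure I"
    using semiprime_closure_star_mult[of "star x"] by (simp add: star_star)
  then have "star x * x \<in> semiprime_closure I"
    by (rule alg_ideal_mult(2)[OF alg_ideal_semiprime_closure])
  then show "x \<in> semiprime_closure I" by (simp add: semiprime_closure_star_mult)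
qed (rule alg_ideal_mult(2)[OF alg_ideal_semiprime_closure])

lemma semiprime_closure_star: "x \<in> semiprime_closure I \<Longrightarrow> star x \<in> semiprime_closure I"
  using semiprime_closure_mult_star[of x I] semiprime_closure_star_mult[of "star x" I] by (simp add: star_star)

lemma semiprime_closure_eq:
  assumes I: "alg_ideal I"
  shows "semiprime_closure I = {x. \<exists>n\<ge>1. npow (star x * x) n \<in> I \<inter> positives}"
    "semiprime_closure I = {x. \<exists>n\<ge>1. npow (x * star x) n \<in> I \<inter> positives}"
proof -
  have *: "a \<in> semiprime_closure I \<longleftrightarrow> (\<exists>n\<ge>1. npow a n \<in> I \<inter> positives)" if a: "a \<in> positives" for a
    using npow_in_of_semiprime_closure[OF I, of a] npow_positive[OF a]
      semiprime_closure_npow[OF a] semiprime_closure_superset[of I] by blast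
  show "semiprime_closure I = {x. \<exists>n\<ge>1. npow (star x * x) n \<in> I \<inter> positives}"
    using *[OF star_mult_positive] semiprime_closure_star_mult by blast
  show "semiprime_closure I = {x. \<exists>n\<ge>1. npow (x * star x) n \<in> I \<inter> positives}"
    using *[OF mult_star_positive] semiprime_closure_mult_star by blast
qed

text \<open>Prime ideals are not assumed stable under complex scalars, and without a unit
  \<open>c\<close> is not an element of the algebra; it is absorbed into the left factor of
  \<open>x = u * e\<close>.\<close>

lemma semiprime_closure_scaleC:
  assumes "x \<in> semiprime_closure I" shows "c *\<^sub>C x \<in> semiprime_closure I"
proof -
  obtain u e where ue: "e \<in> semiprime_closure I" "x = u * e"
    using semiprime_closure_factor semiprime_closure_star_mult assms by metis
  have "(c *\<^sub>C u) * e \<in> semiprime_closure I"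
    by (rule alg_ideal_mult(1)[OF alg_ideal_semiprime_closure ue(1)])
  then show ?thesis by (simp add: ue(2) mult_scaleC_left)
qed

text \<open>The product equations put the squares of \<open>p\<close> and \<open>q\<close> into
  every ideal containing \<open>h\<close>, whereas \<open>p\<close> and \<open>q\<close> themselves
  may lie outside.\<close>

lemma positive_negative_part:
  assumes h: "star h = h"
  shows "\<exists>p q. p \<in> positives \<and> q \<in> positives \<and> h = p - q \<and> p * p = h * p \<and> q * q = - (h * q)"
proof -
  define f g where "f t = max t 0" and "g t = max (- t) 0" for t :: real
  have d: "cfc_dom h f" "cfc_dom h g"
    using h by (auto simp: cfc_dom_def f_def g_def intro!: continuous_intros)
  note id = cfc_dom_id[OF h]
  have "cfc f h \<in> positives" "cfc g h \<in> positives"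
    by (rule positives_cfc[OF d(1)], simp add: f_def) (rule positives_cfc[OF d(2)], simp add: g_def)
  moreover have "h = cfc f h - cfc g h"
  proof -
    have "cfc (\<lambda>t. f t - g t) h = cfc (\<lambda>t. t) h" by (rule cfc_cong(2)[OF id]) (simp add: f_def g_def)
    then show ?thesis using cfc_diff[OF d] cfc_id[OF h] by simp
  qed
  moreover have "cfc f h * cfc f h = h * cfc f h"
  proof -
    have "cfc (\<lambda>t. f t * f t) h = cfc (\<lambda>t. t * f t) h"
      by (rule cfc_cong(2)[OF cfc_dom_mult[OF id d(1)]]) (simp add: f_def max_def)
    then show ?thesis using cfc_mult[OF d(1) d(1)] cfc_mult[OF id d(1)] cfc_id[OF h] by simp
  qed
  moreover have "cfc g h * cfc g h = - (h * cfc g h)"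
  proof -
    have "cfc (\<lambda>t. g t * g t) h = cfc (\<lambda>t. (-1) * (t * g t)) h"
      by (rule cfc_cong(2)[OF cfc_dom_scale[OF cfc_dom_mult[OF id d(2)]]]) (simp add: g_def max_def)
    then show ?thesis
      using cfc_mult[OF d(2) d(2)] cfc_mult[OF id d(2)] cfc_id[OF h]
        cfc_scale[OF cfc_dom_mult[OF id d(2)], of "-1"] by simp
  qed
  ultimately show ?thesis by blast
qed

lemma complex_span_scaleR: "x \<in> complex_span S \<Longrightarrow> r *\<^sub>R x \<in> complex_span S"
  by (metis complex_vector.span_scale scaleC_of_real)

lemma complex_span_imul: "x \<in> complex_span S \<Longrightarrow> imul x \<in> complex_span S"
  unfolding imul_def by (rule complex_vector.span_scale)

lemma cartesian_decomposition:
  "\<exists>h k. star h = h \<and> star k = k \<and> x = h + imul k \<and>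
     h = (1/2) *\<^sub>R (x + star x) \<and> k = - ((1/2) *\<^sub>R imul (x - star x))"
proof -
  let ?h = "(1/2) *\<^sub>R (x + star x)" and ?k = "- ((1/2) *\<^sub>R imul (x - star x))"
  have "?h + imul ?k = (1/2) *\<^sub>R x + (1/2) *\<^sub>R x"
    by (simp add: algebra_simps)
  then have "x = ?h + imul ?k" by (simp flip: scaleR_add_left)
  moreover have "star ?h = ?h" "star ?k = ?k"
    by (simp_all add: star_scaleR star_add star_diff star_minus star_star algebra_simps)
  ultimately show ?thesis by blast
qed

lemma dixmier_ideal_semiprime_closure:
  fixes I :: "'a::cstar_algebra set" shows "dixmier_ideal (semiprime_closure I)"
proof -
  define N where "N = semiprime_closure I"
  have aN: "alg_ideal N" unfolding N_def by (rule alg_ideal_semiprime_closure)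
  have scC: "c *\<^sub>C x \<in> N" if "x \<in> N" for c x using that semiprime_closure_scaleC by (simp add: N_def)
  have scR: "r *\<^sub>R x \<in> N" if "x \<in> N" for r x using scC[OF that, of "of_real r"] by (simp add: scaleC_of_real)
  have stN: "star x \<in> N" if "x \<in> N" for x using that semiprime_closure_star by (simp add: N_def)
  have sub: "complex_vector.subspace N"
    by (rule complex_vector.subspaceI) (use aN scC in \<open>auto intro: alg_ideal_0 alg_ideal_add\<close>)
  \<comment> \<open>The squares of the positive and negative part of \<open>h\<close> are multiples
    of \<open>h\<close>, and \<open>N\<close> contains \<open>p\<close> as soon as it contains
    \<open>star p * p\<close>.\<close>
  have sa: "h \<in> complex_span (N \<inter> positives)" if h: "h \<in> N" "star h = h" for h
  proof -
    obtain p q where pq: "p \<in> positives" "q \<in> positives" "h = p - q" "p * p = h * p" "q * q = - (h * q)"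
      using positive_negative_part[OF h(2)] by blast
    have "h * p \<in> N" "0 - h * q \<in> N"
      using alg_ideal_mult(2)[OF aN h(1)] alg_ideal_diff[OF aN alg_ideal_0[OF aN]] by auto
    then have "star p * p \<in> N" "star q * q \<in> N"
      unfolding positives_star[OF pq(1)] positives_star[OF pq(2)] pq(4,5) by simp_all
    then have "p \<in> N" "q \<in> N" by (simp_all add: N_def semiprime_closure_star_mult)
    then show ?thesis
      unfolding pq(3) using pq(1,2)
      by (intro complex_vector.span_diff complex_vector.span_base) auto
  qed
  have "x \<in> complex_span (N \<inter> positives)" if x: "x \<in> N" for x
  proof -
    obtain h k where hk: "star h = h" "star k = k" "x = h + imul k"
      "h = (1/2) *\<^sub>R (x + star x)" "k = - ((1/2) *\<^sub>R imul (x - star x))"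
      using cartesian_decomposition by blast
    have "h \<in> N" unfolding hk(4) using x aN by (intro scR alg_ideal_add stN) auto
    moreover have "k \<in> N"
    proof -
      have "imul (x - star x) \<in> N"
        unfolding imul_def using x aN by (intro scC alg_ideal_diff stN) auto
      from scR[OF this, of "- 1/2"] show ?thesis unfolding hk(5) by simp
    qed
    ultimately show ?thesis
      unfolding hk(3) using sa hk(1,2) by (intro complex_vector.span_add complex_span_imul) auto
  qed
  moreover have "complex_span (N \<inter> positives) \<subseteq> N"
    by (rule complex_vector.span_minimal[OF _ sub]) simp
  ultimately have sp: "N = complex_span (N \<inter> positives)" by blast
  \<comment> \<open>Factor \<open>sqrt a\<close> through \<open>b^(1/4)\<close>, which belongs to
    \<open>N\<close> because its fourth power does.\<close>
  have her: "a \<in> N" if a: "a \<in> positives" "b \<in> positives" "cstar_le a b" "b \<in> N" for a b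
  proof -
    have "cstar_le (star (positive_sqrt a) * positive_sqrt a) b" using a by (simp add: star_positive_sqrt positive_sqrt_mult)
    then obtain u where u: "positive_sqrt a = u * cfc (root 4) b" using factor_root4[OF _ a(2)] by blast
    have "cfc (root 4) b \<in> N"
      using semiprime_closure_npow[of "cfc (root 4) b" 4 I] npow_root[OF a(2), of 4] a(4) by (simp add: N_def)
    then have "positive_sqrt a \<in> N" using u alg_ideal_mult(1)[OF aN] by simp
    then have "positive_sqrt a * positive_sqrt a \<in> N" by (rule alg_ideal_mult(1)[OF aN])
    then show ?thesis using a by (simp add: positive_sqrt_mult)
  qed
  have "order_ideal (N \<inter> positives)"
    unfolding order_ideal_def using aN her by (auto intro: alg_ideal_0 alg_ideal_add positives_add)
  moreover have "strongly_invariant (N \<inter> positives)"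
    unfolding strongly_invariant_def N_def
    by (auto simp: semiprime_closure_star_mult semiprime_closure_mult_star star_mult_positive mult_star_positive)
  ultimately show ?thesis
    unfolding dixmier_ideal_def N_def[symmetric] using aN sp by blast
qed

section \<open>The Loewner--Heinz inequality for dyadic exponents\<close>

lemma cfc_dom_powr: "a \<in> positives \<Longrightarrow> s > 0 \<Longrightarrow> cfc_dom a (\<lambda>t. t powr s)"
proof -
  assume a: "a \<in> positives" and s: "s > 0"
  have "continuous_on (rspec a) (\<lambda>t. t powr s)"
    by (rule continuous_on_powr') (use positives_rspec[OF a] s in \<open>auto intro: continuous_intros\<close>)
  then show ?thesis using positives_star[OF a] by (simp add: cfc_dom_def)
qed

lemma npow_2: "npow a 2 = a * a"
  by (simp add: numeral_2_eq_2 npow_Suc)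

lemma star_mult_mult: "star (u * v) * (u' * v') = star v * (star u * u') * v'"
  by (simp only: star_mult mult.assoc)

text \<open>Exponent \<open>0\<close> must give the unit, as the starting point of the interpolation
  below, and a calculus of functions vanishing at \<open>0\<close> cannot supply it.\<close>

definition gpow :: "'u \<Rightarrow> real \<Rightarrow> 'u::cstar_algebra_1" where
  "gpow a s = (if s = 0 then 1 else cfc (\<lambda>t. t powr s) a)"

lemma gpow_0 [simp]: "gpow a 0 = 1"
  by (simp add: gpow_def)

lemma gpow_1: "a \<in> positives \<Longrightarrow> gpow a 1 = a"
proof -
  assume a: "a \<in> positives"
  have "cfc (\<lambda>t. t powr 1) a = cfc (\<lambda>t. t) a"
    by (rule cfc_cong(2)[OF cfc_dom_id[OF positives_star[OF a]]])
       (use positives_rspec[OF a] in simp)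
  then show ?thesis using cfc_id[OF positives_star[OF a]] by (simp add: gpow_def)
qed

lemma gpow_add:
  assumes "a \<in> positives" "s \<ge> 0" "t \<ge> 0" shows "gpow a s * gpow a t = gpow a (s + t)"
proof (cases "s = 0 \<or> t = 0")
  case False
  then have st: "s > 0" "t > 0" using assms by auto
  note d = cfc_dom_powr[OF assms(1)]
  have "cfc (\<lambda>x. x powr (s + t)) a = cfc (\<lambda>x. x powr s * x powr t) a"
    by (rule cfc_cong(2)[OF cfc_dom_mult[OF d[OF st(1)] d[OF st(2)]]]) (simp add: powr_add)
  then show ?thesis using st cfc_mult[OF d[OF st(1)] d[OF st(2)]] by (simp add: gpow_def)
qed auto

lemma star_gpow: "a \<in> positives \<Longrightarrow> s \<ge> 0 \<Longrightarrow> star (gpow a s) = gpow a s"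
  using star_cfc[OF cfc_dom_powr, of a s] by (auto simp: gpow_def)

lemma invertible1_factor:
  assumes "x * y = c" "y * x = c" "invertible1 c" shows "invertible1 x"
proof (rule invertible1I)
  have r: "x * (y * inv1 c) = 1" using inv1(1)[OF assms(3)] assms(1) by (simp flip: mult.assoc)
  have l: "(inv1 c * y) * x = 1" using inv1(2)[OF assms(3)] assms(2) by (simp add: mult.assoc)
  show "x * (y * inv1 c) = 1" by (rule r)
  have "inv1 c * y = (inv1 c * y) * (x * (y * inv1 c))" using r by simp
  also have "\<dots> = y * inv1 c" using l by (simp flip: mult.assoc)
  finally show "(y * inv1 c) * x = 1" using l by simp
qed

lemma bounded_powers_le_1:
  fixes x :: real
  assumes "x \<ge> 0" "\<And>m. x ^ (2 ^ m) \<le> C" shows "x \<le> 1"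
proof (rule ccontr)
  assume "\<not> x \<le> 1"
  then have x: "x > 1" by simp
  then obtain n where "C < x ^ n" using real_arch_pow by blast
  also have "x ^ n \<le> x ^ (2 ^ n)" using x by (intro power_increasing) (auto simp: less_imp_le)
  finally show False using assms(2)[of n] by simp
qed

section \<open>Comparison with an invertible upper bound\<close>

context
  fixes a c :: "'u::cstar_algebra_1"
  assumes a: "a \<in> positives" and c: "c \<in> positives" and ac: "cstar_le a c" and inv: "invertible1 c"
begin

abbreviation cinv where "cinv s \<equiv> inv1 (gpow c s)"

lemma invertible1_gpow: "0 \<le> s \<Longrightarrow> s \<le> 1 \<Longrightarrow> invertible1 (gpow c s)"
  using gpow_add[OF c, of s "1 - s"] gpow_add[OF c, of "1 - s" s] gpow_1[OF c]
  by (intro invertible1_factor[OF _ _ inv, of _ "gpow c (1 - s)"]) auto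

lemma cinv_star: "0 \<le> s \<Longrightarrow> s \<le> 1 \<Longrightarrow> star (cinv s) = cinv s"
proof -
  assume s: "0 \<le> s" "s \<le> 1"
  have "gpow c s * star (cinv s) = 1" "star (cinv s) * gpow c s = 1"
    using inv1[OF invertible1_gpow[OF s]] star_gpow[OF c s(1)] by (metis star_1 star_mult)+
  then show ?thesis using inv1_unique by metis
qed

text \<open>Conjugating by \<open>c\<^sup>\<delta>\<close> turns the self-adjoint element \<open>h\<close> below into a contraction, and
  for self-adjoint elements the norm is determined by the growth of the powers.\<close>

lemma loewner_midpoint:
  assumes st: "0 \<le> t" "t \<le> s" "s \<le> 1"
    and s: "norm (gpow a (s / 2) * cinv (s / 2)) \<le> 1"
    and t: "norm (gpow a (t / 2) * cinv (t / 2)) \<le> 1"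
  shows "norm (gpow a ((s + t) / 4) * cinv ((s + t) / 4)) \<le> 1"
proof -
  \<comment> \<open>\<open>\<gamma>\<close> is the midpoint of \<open>\<alpha>\<close> and
    \<open>\<beta>\<close>, and \<open>\<delta>\<close> is half their distance, so that
    \<open>X = gpow c \<delta>\<close> moves the exponents \<open>\<alpha>\<close> and
    \<open>\<beta>\<close> of \<open>c\<close> in \<open>k\<close> to the common exponent
    \<open>\<gamma>\<close> in \<open>h\<close>.\<close>
  define \<alpha> \<beta> \<gamma> \<delta> where "\<alpha> = s / 2" and "\<beta> = t / 2" and "\<gamma> = (s + t) / 4" and "\<delta> = (s - t) / 4"
  have r: "0 \<le> \<alpha>" "\<alpha> \<le> 1" "0 \<le> \<beta>" "\<beta> \<le> 1" "0 \<le> \<gamma>" "\<gamma> \<le> 1" "0 \<le> \<delta>" "\<delta> \<le> 1"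
    and e: "\<delta> + \<gamma> = \<alpha>" "\<beta> + \<delta> = \<gamma>" "\<gamma> + \<gamma> = \<alpha> + \<beta>"
    using st by (auto simp: \<alpha>_def \<beta>_def \<gamma>_def \<delta>_def field_simps)
  define X where "X = gpow c \<delta>"
  note iX = inv1[OF invertible1_gpow[OF r(7,8)], folded X_def]
  note i\<alpha> = inv1[OF invertible1_gpow[OF r(1,2)]]
  note i\<beta> = inv1[OF invertible1_gpow[OF r(3,4)]]
  note i\<gamma> = inv1[OF invertible1_gpow[OF r(5,6)]]
  have D1: "cinv \<gamma> = X * cinv \<alpha>"
  proof (rule inv1_unique)
    have "gpow c \<gamma> * X = gpow c \<alpha>" "X * gpow c \<gamma> = gpow c \<alpha>"
      using gpow_add[OF c] r e by (auto simp: X_def add.commute)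
    then show "gpow c \<gamma> * (X * cinv \<alpha>) = 1" using i\<alpha> by (simp flip: mult.assoc)
    have "cinv \<alpha> * X * gpow c \<gamma> = 1"
      using i\<alpha> \<open>X * gpow c \<gamma> = gpow c \<alpha>\<close> by (simp add: mult.assoc)
    have "X * cinv \<alpha> = (cinv \<alpha> * X * gpow c \<gamma>) * (X * cinv \<alpha>)"
      using \<open>cinv \<alpha> * X * gpow c \<gamma> = 1\<close> by simp
    also have "\<dots> = cinv \<alpha> * X"
      using \<open>gpow c \<gamma> * (X * cinv \<alpha>) = 1\<close> by (simp add: mult.assoc)
    finally show "X * cinv \<alpha> * gpow c \<gamma> = 1" using \<open>cinv \<alpha> * X * gpow c \<gamma> = 1\<close> by simp
  qed
  have D2: "cinv \<gamma> = cinv \<beta> * inv1 X"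
  proof (rule inv1_unique)
    have g: "gpow c \<gamma> = X * gpow c \<beta>" "gpow c \<gamma> = gpow c \<beta> * X"
      using gpow_add[OF c] r e by (auto simp: X_def add.commute)
    have "gpow c \<gamma> * (cinv \<beta> * inv1 X) = X * (gpow c \<beta> * cinv \<beta>) * inv1 X"
      unfolding g(1) by (simp only: mult.assoc)
    then show "gpow c \<gamma> * (cinv \<beta> * inv1 X) = 1" using i\<beta> iX by simp
    have "cinv \<beta> * inv1 X * gpow c \<gamma> = cinv \<beta> * (inv1 X * X) * gpow c \<beta>"
      unfolding g(1) by (simp only: mult.assoc)
    then show "cinv \<beta> * inv1 X * gpow c \<gamma> = 1" using i\<beta> iX by simp
  qed
  define k where "k = star (gpow a \<alpha> * cinv \<alpha>) * (gpow a \<beta> * cinv \<beta>)"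
  define h where "h = star (gpow a \<gamma> * cinv \<gamma>) * (gpow a \<gamma> * cinv \<gamma>)"
  have "norm k \<le> norm (gpow a \<alpha> * cinv \<alpha>) * norm (gpow a \<beta> * cinv \<beta>)"
    unfolding k_def by (metis norm_mult_ineq norm_star)
  also have "\<dots> \<le> 1 * 1" using s t by (intro mult_mono) (auto simp: \<alpha>_def \<beta>_def)
  finally have nk: "norm k \<le> 1" by simp
  have h1: "h = cinv \<gamma> * (gpow a (\<alpha> + \<beta>)) * cinv \<gamma>"
    unfolding h_def star_mult_mult cinv_star[OF r(5,6)] star_gpow[OF a r(5)] gpow_add[OF a r(5) r(5)] e ..
  have k1: "k = cinv \<alpha> * (gpow a (\<alpha> + \<beta>)) * cinv \<beta>"
    unfolding k_def star_mult_mult cinv_star[OF r(1,2)] star_gpow[OF a r(1)] gpow_add[OF a r(1) r(3)] ..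
  have "h = (X * cinv \<alpha>) * gpow a (\<alpha> + \<beta>) * (cinv \<beta> * inv1 X)"
    unfolding h1 by (simp only: D1[symmetric] D2[symmetric])
  then have hX: "h = X * k * inv1 X" unfolding k1 by (simp only: mult.assoc)
  have hpow: "h ^ n = X * k ^ n * inv1 X" for n
  proof (induction n)
    case (Suc n)
    have "h ^ Suc n = X * k * (inv1 X * X) * k ^ n * inv1 X"
      unfolding power_Suc Suc unfolding hX by (simp only: mult.assoc)
    then show ?case using iX by (simp add: mult.assoc)
  qed (use iX in simp)
  have sh: "star h = h" by (simp add: h_def star_mult star_star)
  have "norm h ^ (2 ^ m) \<le> norm X * norm (inv1 X)" for m
  proof -
    have "norm h ^ (2 ^ m) = norm (X * k ^ (2 ^ m) * inv1 X)"
      by (simp only: norm_pow2_selfadjoint[OF sh, symmetric] hpow)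
    also have "\<dots> \<le> norm X * norm (k ^ (2 ^ m)) * norm (inv1 X)"
      using norm_mult_ineq[of "X * k ^ (2 ^ m)" "inv1 X"]
        mult_right_mono[OF norm_mult_ineq[of X "k ^ (2 ^ m)"], of "norm (inv1 X)"] by simp
    also have "norm (k ^ (2 ^ m)) \<le> 1"
      using norm_power_ineq[of k "2 ^ m"] power_le_one[OF norm_ge_zero nk, of "2 ^ m"] by simp
    finally show ?thesis by (simp add: mult_left_mono mult_right_mono)
  qed
  then have "norm h \<le> 1" by (rule bounded_powers_le_1[OF norm_ge_zero])
  then have "(norm (gpow a \<gamma> * cinv \<gamma>))\<^sup>2 \<le> 1\<^sup>2" by (simp add: h_def cstar_identity)
  then have "norm (gpow a \<gamma> * cinv \<gamma>) \<le> 1" by (rule power2_le_imp_le) simp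
  then show ?thesis by (simp add: \<gamma>_def)
qed

text \<open>The bound at exponent \<open>s / 2\<close> encodes \<open>a^s \<le> c^s\<close>. It is
  trivial for \<open>s = 0\<close>; for \<open>s = 1\<close> it follows from
  \<open>D * a * D \<le> D * c * D = 1\<close> with \<open>D = c^(-1/2)\<close>. An odd numerator
  \<open>2 * m + 1\<close> over \<open>2^(k + 1)\<close> is the midpoint of \<open>m / 2^k\<close>
  and \<open>(m + 1) / 2^k\<close>.\<close>

lemma loewner_dyadic_norm:
  "n \<le> 2 ^ k \<Longrightarrow> norm (gpow a (real n / 2 ^ k / 2) * cinv (real n / 2 ^ k / 2)) \<le> 1"
proof (induction k arbitrary: n)
  case 0
  show ?case
  proof (cases "n = 0")
    case True
    have "inv1 (1 :: 'u) = 1" by (rule inv1_unique) auto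
    then show ?thesis using True by simp
  next
    case False
    then have n: "n = 1" using 0 by simp
    define D where "D = cinv (1/2)"
    have D: "star D = D" unfolding D_def by (rule cinv_star) auto
    have g: "gpow a (1/2) * gpow a (1/2) = a" "gpow c (1/2) * gpow c (1/2) = c"
      using gpow_add[OF a, of "1/2" "1/2"] gpow_add[OF c, of "1/2" "1/2"] gpow_1 a c by auto
    have i: "gpow c (1/2) * D = 1" "D * gpow c (1/2) = 1"
      unfolding D_def by (rule inv1[OF invertible1_gpow]; simp)+
    have e1: "star (gpow a (1/2) * D) * (gpow a (1/2) * D) = star D * a * D"
    proof -
      have "star (gpow a (1/2)) = gpow a (1/2)" by (rule star_gpow[OF a]) simp
      then show ?thesis unfolding star_mult_mult by (simp only: g(1))
    qed
    have "star D * (gpow c (1/2) * gpow c (1/2)) * D = (D * gpow c (1/2)) * (gpow c (1/2) * D)"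
      by (simp only: D mult.assoc)
    then have e2: "star D * c * D = 1" unfolding g(2) i by simp
    have "norm (star D * a * D) \<le> norm (star D * c * D)"
      by (intro norm_mono positives_conj a cstar_le_conj ac)
    then have "(norm (gpow a (1/2) * D))\<^sup>2 \<le> 1\<^sup>2" unfolding e2 e1[symmetric] cstar_identity by simp
    then have "norm (gpow a (1/2) * D) \<le> 1" by (rule power2_le_imp_le) simp
    then show ?thesis by (simp add: n D_def)
  qed
next
  case (Suc k)
  show ?case
  proof (cases "even n")
    case True
    then obtain m where m: "n = 2 * m" by blast
    then show ?thesis using Suc.IH[of m] Suc.prems by simp
  next
    case False
    then obtain m where m: "n = 2 * m + 1" using oddE by blast
    then have le: "m + 1 \<le> 2 ^ k" using Suc.prems by simp
    then have "real (m + 1) \<le> real (2 ^ k)" by (simp only: of_nat_le_iff)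
    then have r: "real (m + 1) / 2 ^ k \<le> 1" by simp
    have "norm (gpow a ((real (m + 1) / 2 ^ k + real m / 2 ^ k) / 4) *
        cinv ((real (m + 1) / 2 ^ k + real m / 2 ^ k) / 4)) \<le> 1"
    proof (rule loewner_midpoint[OF _ _ r])
      show "real m / 2 ^ k \<le> real (m + 1) / 2 ^ k" by (intro divide_right_mono) auto
    qed (use Suc.IH[of "m + 1"] Suc.IH[of m] le in auto)
    moreover have "(real (m + 1) / 2 ^ k + real m / 2 ^ k) / 4 = real n / 2 ^ Suc k / 2"
      by (simp add: m add_divide_distrib)
    ultimately show ?thesis by (simp only:)
  qed
qed

text \<open>With the contraction \<open>y = a^s * c^(-s)\<close> for half the exponent,
  \<open>a^(2 * s) = c^s * (star y * y) * c^s \<le> c^(2 * s)\<close>.\<close>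

lemma loewner_dyadic_invertible:
  assumes "n \<le> 2 ^ k" shows "cstar_le (gpow a (real n / 2 ^ k)) (gpow c (real n / 2 ^ k))"
proof -
  define s where "s = real n / 2 ^ k / 2"
  have "real n / 2 ^ k \<le> 1" using assms by (simp add: divide_le_eq)
  moreover have "s + s = real n / 2 ^ k" "0 \<le> s" by (simp_all add: s_def)
  ultimately have s: "0 \<le> s" "s \<le> 1" "s + s = real n / 2 ^ k" by linarith+
  define X where "X = gpow c s"
  define y where "y = gpow a s * cinv s"
  have sX: "star X = X" unfolding X_def by (rule star_gpow[OF c s(1)])
  have "y * X = gpow a s"
    using inv1(2)[OF invertible1_gpow[OF s(1,2)]] by (simp add: y_def X_def mult.assoc)
  then have "star X * (star y * y) * X = star (gpow a s) * gpow a s"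
    by (metis mult.assoc star_mult)
  then have e1: "star X * (star y * y) * X = gpow a (s + s)"
    using gpow_add[OF a s(1) s(1)] star_gpow[OF a s(1)] by simp
  have e2: "star X * X = gpow c (s + s)"
    unfolding sX using gpow_add[OF c s(1) s(1)] by (simp add: X_def)
  have "cstar_le (gpow a (s + s)) ((norm y)\<^sup>2 *\<^sub>R gpow c (s + s))"
    using conj_le_norm[of X y] by (simp only: e1 e2)
  moreover have "(norm y)\<^sup>2 \<le> 1"
    using loewner_dyadic_norm[OF assms] by (simp add: y_def s_def power_le_one)
  then have "cstar_le ((norm y)\<^sup>2 *\<^sub>R gpow c (s + s)) (gpow c (s + s))"
    unfolding cstar_le_def using positives_scaleR[OF star_mult_positive[of X], of "1 - (norm y)\<^sup>2"]
    by (simp add: e2 scaleR_diff_left)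
  ultimately show ?thesis unfolding s(3) by (rule cstar_le_trans)
qed

end

section \<open>Removing invertibility and the unit\<close>

lemma powr_subadditive:
  fixes x y s :: real
  assumes "x \<ge> 0" "y \<ge> 0" "0 < s" "s \<le> 1"
  shows "(x + y) powr s \<le> x powr s + y powr s"
proof (cases "x + y = 0")
  case False
  define z where "z = x + y"
  have z: "z > 0" using False assms by (simp add: z_def)
  have *: "w / z \<le> (w / z) powr s" if "0 \<le> w" "w \<le> z" for w
  proof (cases "w = 0")
    case False
    have "w / z = (w / z) powr 1" using that z by simp
    also have "\<dots> \<le> (w / z) powr s"
      using that z False assms by (intro powr_mono') auto
    finally show ?thesis .
  qed simp
  have "1 = x / z + y / z" using z by (simp add: z_def add_divide_distrib[symmetric])
  also have "\<dots> \<le> (x / z) powr s + (y / z) powr s"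
    using assms by (intro add_mono *) (auto simp: z_def)
  also have "\<dots> = (x powr s + y powr s) / z powr s"
    using assms z by (simp add: powr_divide add_divide_distrib)
  finally show ?thesis using z by (simp add: z_def)
qed (use assms in simp)

text \<open>Exhibits \<open>b\<close> as a function of \<open>c\<close>, so that powers of both can
  be compared within one functional calculus.\<close>

lemma unital_shift:
  fixes b :: "'u::cstar_algebra_1"
  assumes b: "b \<in> positives" and e: "e > 0"
  defines "c \<equiv> b + e *\<^sub>R 1"
  shows "invertible1 c" "c \<in> positives" "\<And>t. t \<in> rspec c \<Longrightarrow> t = 0 \<or> t \<ge> e"
    "cfc (\<lambda>t. max (t - e) 0) c = b"
proof -
  have sb: "star b = b" using b positives_star by blast
  have sc: "star c = c" by (simp add: c_def star_add star_scaleR sb)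
  have sp: "t \<ge> e" if "of_real t \<in> spec1 c" for t
  proof -
    have "ofc (of_real t) - c = ofc (of_real (t - e)) - b"
      by (simp add: c_def ofc_simps algebra_simps)
    then have "of_real (t - e) \<in> spec1 b" using that unfolding spec1_def by simp
    then have "t - e \<in> rspec b" by (simp add: rspec_def spectrum_unital)
    then show ?thesis using positives_rspec[OF b] by force
  qed
  show i: "invertible1 c"
  proof (rule ccontr)
    assume "\<not> invertible1 c"
    moreover have "invertible1 (- c) \<Longrightarrow> invertible1 c"
      using invertible1_scaleC[of "-1" "- c"] by simp
    ultimately have "of_real 0 \<in> spec1 c" by (auto simp: spec1_def ofc_simps)
    from sp[OF this] e show False by simp
  qed
  show rs: "t = 0 \<or> t \<ge> e" if "t \<in> rspec c" for t
    using that sp[of t] by (auto simp: rspec_def spectrum_unital)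
  show c: "c \<in> positives" unfolding positives_iff using sc rs e by force
  \<comment> \<open>\<open>\<kappa>\<close> equals \<open>1\<close> on the spectrum of
    \<open>c\<close> except at \<open>0\<close>. Thus \<open>c * \<kappa>(c) = c\<close>, and
    invertibility of \<open>c\<close> gives \<open>\<kappa>(c) = 1\<close>, which expresses the unit
    by a function vanishing at \<open>0\<close>.\<close>
  define \<kappa> where "\<kappa> t = min (t / e) 1" for t
  have \<kappa>: "cfc_dom c \<kappa>" using sc e by (auto simp: cfc_dom_def \<kappa>_def intro!: continuous_intros)
  note id = cfc_dom_id[OF sc]
  have "cfc (\<lambda>t. t * \<kappa> t) c = cfc (\<lambda>t. t) c"
    by (rule cfc_cong(2)[OF id]) (use rs e in \<open>force simp: \<kappa>_def min_def\<close>)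
  then have "c * cfc \<kappa> c = c" using cfc_mult[OF id \<kappa>] cfc_id[OF sc] by simp
  then have "inv1 c * (c * cfc \<kappa> c) = inv1 c * c" by simp
  then have one: "cfc \<kappa> c = 1" using inv1(2)[OF i] by (simp flip: mult.assoc)
  have "cfc (\<lambda>t. max (t - e) 0) c = cfc (\<lambda>t. t - e * \<kappa> t) c"
    by (rule cfc_cong(2)[OF cfc_dom_diff[OF id cfc_dom_scale[OF \<kappa>]]])
       (use rs e in \<open>force simp: \<kappa>_def min_def max_def\<close>)
  also have "\<dots> = b"
    using cfc_diff[OF id cfc_dom_scale[OF \<kappa>, of e]] cfc_scale[OF \<kappa>, of e]
    by (simp add: one cfc_id[OF sc]) (simp add: c_def)
  finally show "cfc (\<lambda>t. max (t - e) 0) c = b" .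
qed

text \<open>Adding \<open>e m\<close> to \<open>b\<close> makes the upper bound invertible. By
  subadditivity of \<open>t powr s\<close> the powers of \<open>c m\<close> and \<open>b\<close>
  differ in norm by at most \<open>e m powr s\<close>, and the inequality survives the
  limit.\<close>

lemma loewner_dyadic_unital:
  fixes a b :: "'u::cstar_algebra_1"
  assumes a: "a \<in> positives" and b: "b \<in> positives" and ab: "cstar_le a b"
    and n: "1 \<le> n" "n \<le> 2 ^ k"
  defines "s \<equiv> real n / 2 ^ k"
  shows "cstar_le (cfc (\<lambda>t. t powr s) a) (cfc (\<lambda>t. t powr s) b)"
proof -
  have "real n \<le> real (2 ^ k)" using n by (simp only: of_nat_le_iff)
  then have s: "0 < s" "s \<le> 1" using n by (auto simp: s_def)
  define e where "e m = 1 / real (Suc m)" for m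
  have e: "e m > 0" for m by (simp add: e_def)
  define c where "c m = b + e m *\<^sub>R 1" for m
  note sh = unital_shift[OF b e, folded c_def]
  have ac: "cstar_le a (c m)" for m
  proof -
    have "e m *\<^sub>R (star 1 * (1 :: 'u)) \<in> positives"
      by (rule positives_scaleR[OF star_mult_positive less_imp_le[OF e]])
    then have "e m *\<^sub>R (1 :: 'u) \<in> positives" by simp
    from positives_add[OF _ this, of "b - a"] ab show ?thesis
      by (simp add: cstar_le_def c_def algebra_simps)
  qed
  have le: "cstar_le (cfc (\<lambda>t. t powr s) a) (cfc (\<lambda>t. t powr s) (c m))" for m
    using loewner_dyadic_invertible[OF a sh(2) ac sh(1) n(2), of m] s
    by (simp add: gpow_def flip: s_def)
  have near: "norm (cfc (\<lambda>t. t powr s) (c m) - cfc (\<lambda>t. t powr s) b) \<le> e m powr s" for m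
  proof -
    define \<phi> where "\<phi> t = max (t - e m) 0" for t
    have sc: "star (c m) = c m" using sh(2) positives_star by blast
    have \<phi>: "cfc_dom (c m) \<phi>"
      using sc e[of m] by (auto simp: cfc_dom_def \<phi>_def intro!: continuous_intros)
    have co: "continuous_on (\<phi> ` rspec (c m)) (\<lambda>t. t powr s)"
      using s by (intro continuous_on_powr' continuous_intros) (auto simp: \<phi>_def)
    note comp = cfc_compose[OF \<phi> co, simplified]
    have "cfc (\<lambda>t. t powr s) b = cfc (\<lambda>t. \<phi> t powr s) (c m)"
      using comp(3) sh(4)[of m] unfolding \<phi>_def[abs_def] by simp
    then have "cfc (\<lambda>t. t powr s) (c m) - cfc (\<lambda>t. t powr s) b = cfc (\<lambda>t. t powr s - \<phi> t powr s) (c m)"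
      using cfc_diff[OF cfc_dom_powr[OF sh(2) s(1)] comp(1)] by simp
    moreover have "norm (cfc (\<lambda>t. t powr s - \<phi> t powr s) (c m)) \<le> e m powr s"
    proof (rule norm_cfc_le[OF cfc_dom_diff[OF cfc_dom_powr[OF sh(2) s(1)] comp(1)]])
      fix t assume t: "t \<in> rspec (c m)"
      then consider "t = 0" | "t \<ge> e m" using sh(3) by blast
      then show "\<bar>t powr s - \<phi> t powr s\<bar> \<le> e m powr s"
      proof cases
        case 2
        have "(t - e m + e m) powr s \<le> (t - e m) powr s + e m powr s"
          by (rule powr_subadditive) (use 2 e[of m] s in auto)
        moreover have "(t - e m) powr s \<le> t powr s"
          by (rule powr_mono2) (use 2 e[of m] s in auto)
        ultimately show ?thesis using 2 by (simp add: \<phi>_def)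
      qed (use e[of m] in \<open>simp add: \<phi>_def\<close>)
    qed
    ultimately show ?thesis by simp
  qed
  have "e \<longlonglongrightarrow> 0" unfolding e_def by (rule inverse_Suc_tendsto_0)
  then have "(\<lambda>m. e m powr s) \<longlonglongrightarrow> 0 powr s"
    using s e by (intro tendsto_powr2 tendsto_const) (auto intro!: always_eventually less_imp_le)
  then have "(\<lambda>m. e m powr s) \<longlonglongrightarrow> 0" by simp
  then have "(\<lambda>m. cfc (\<lambda>t. t powr s) (c m) - cfc (\<lambda>t. t powr s) b) \<longlonglongrightarrow> 0"
    by (rule Lim_null_comparison[rotated]) (simp add: near)
  then have "(\<lambda>m. cfc (\<lambda>t. t powr s) (c m)) \<longlonglongrightarrow> cfc (\<lambda>t. t powr s) b" by (rule LIM_zero_cancel)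
  then have "(\<lambda>m. cfc (\<lambda>t. t powr s) (c m) - cfc (\<lambda>t. t powr s) a) \<longlonglongrightarrow>
      cfc (\<lambda>t. t powr s) b - cfc (\<lambda>t. t powr s) a" by (intro tendsto_intros)
  from positives_limit[OF _ this] show ?thesis using le by (simp add: cstar_le_def)
qed

lemma emb_cfc:
  assumes f: "cfc_dom a f" shows "cfc f (emb a) = emb (cfc f a)"
proof -
  have f': "cfc_dom (emb a) f" using f by (simp add: cfc_dom_def emb_simps)
  obtain p where p: "\<And>k. coeff (p k) 0 = 0"
    "uniform_limit (rspec a) (\<lambda>k. poly (p k)) f sequentially"
    using cfc_dom_approx[OF f] by blast
  have np: "npow (emb a) n = emb (npow a n)" if "n \<ge> 1" for n
    using that
  proof (induction n rule: dec_induct)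
    case (step n)
    then show ?case by (simp add: npow_Suc emb_simps)
  qed simp
  have "poly_eval q (emb a) = emb (poly_eval q a)" for q
    unfolding poly_eval_def emb_sum by (intro sum.cong) (auto simp: np emb_simps)
  moreover have "(\<lambda>k. emb (poly_eval (p k) a)) \<longlonglongrightarrow> emb (cfc f a)"
  proof (rule LIM_zero_cancel, rule tendsto_norm_zero_cancel)
    have "(\<lambda>k. norm (poly_eval (p k) a - cfc f a)) \<longlonglongrightarrow> 0"
      by (rule tendsto_norm_zero[OF LIM_zero[OF cfc_limit[OF f p]]])
    then show "(\<lambda>k. norm (emb (poly_eval (p k) a) - emb (cfc f a))) \<longlonglongrightarrow> 0"
      by (simp flip: emb_simps)
  qed
  ultimately have l: "(\<lambda>k. poly_eval (p k) (emb a)) \<longlonglongrightarrow> emb (cfc f a)" by simp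
  show ?thesis by (rule cfc_eqI[OF f' p(1) _ l]) (use p(2) in simp)
qed

lemma loewner_dyadic:
  assumes a: "a \<in> positives" and b: "b \<in> positives" and ab: "cstar_le a b"
    and n: "1 \<le> n" "n \<le> 2 ^ k"
  defines "s \<equiv> real n / 2 ^ k"
  shows "cstar_le (cfc (\<lambda>t. t powr s) a) (cfc (\<lambda>t. t powr s) b)"
proof -
  have s: "s > 0" using n by (simp add: s_def)
  have "cstar_le (cfc (\<lambda>t. t powr s) (emb a)) (cfc (\<lambda>t. t powr s) (emb b))"
    unfolding s_def by (rule loewner_dyadic_unital[OF _ _ _ n]) (use a b ab in auto)
  then show ?thesis
    using emb_cfc[OF cfc_dom_powr[OF a s]] emb_cfc[OF cfc_dom_powr[OF b s]] by simp
qed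

section \<open>Dixmier ideals\<close>

text \<open>Additivity is left out so that the notion covers sets of roots and unions of positive
  parts, whose closure under sums is not evident. One implication suffices for strong invariance, as
  \<open>x\<close> may be replaced by \<open>star x\<close>.\<close>

definition sinv_hereditary :: "'a::cstar_algebra set \<Rightarrow> bool" where
  "sinv_hereditary Q \<longleftrightarrow> Q \<subseteq> positives \<and>
     (\<forall>a\<in>positives. \<forall>b\<in>Q. cstar_le a b \<longrightarrow> a \<in> Q) \<and>
     (\<forall>x. star x * x \<in> Q \<longrightarrow> x * star x \<in> Q)"

lemma sinv_hereditaryD:
  assumes "sinv_hereditary Q"
  shows "a \<in> Q \<Longrightarrow> a \<in> positives" "a \<in> positives \<Longrightarrow> b \<in> Q \<Longrightarrow> cstar_le a b \<Longrightarrow> a \<in> Q"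
    "star x * x \<in> Q \<Longrightarrow> x * star x \<in> Q"
  using assms unfolding sinv_hereditary_def by blast+

lemma sinv_hereditary_positive_part:
  "order_ideal M \<Longrightarrow> strongly_invariant M \<Longrightarrow> sinv_hereditary M"
  unfolding sinv_hereditary_def order_ideal_def strongly_invariant_def by blast

text \<open>From \<open>g \<le> h\<close> one cannot conclude \<open>g^2 \<le> h^2\<close>. Instead
  \<open>h^(1/2) * g * h^(1/2) \<le> h^2\<close>, strong invariance exchanges the left side for
  \<open>g^(1/2) * h * g^(1/2)\<close>, and this dominates \<open>g^2\<close>.\<close>

lemma sinv_hereditary_square:
  assumes M: "sinv_hereditary M" shows "sinv_hereditary {a \<in> positives. npow a 2 \<in> M}"
  unfolding sinv_hereditary_def
proof (intro conjI ballI allI impI)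
  note sq = npow_2
  fix g h assume g: "g \<in> positives" and h: "h \<in> {a \<in> positives. npow a 2 \<in> M}" and gh: "cstar_le g h"
  then have hp: "h \<in> positives" and hM: "h * h \<in> M" by (auto simp: sq)
  define u v where "u = positive_sqrt g" and "v = positive_sqrt h"
  have uv: "star u = u" "star v = v" "u * u = g" "v * v = h"
    using g hp by (simp_all add: u_def v_def star_positive_sqrt positive_sqrt_mult)
  have e1: "star (u * v) * (u * v) = star v * g * v" "(u * v) * star (u * v) = star u * h * u"
    using uv by (metis star_mult mult.assoc)+
  have "star v * h * v = h * h" "star u * g * u = g * g" using uv by (metis mult.assoc)+
  then have "cstar_le (star v * g * v) (h * h)" "cstar_le (g * g) (star u * h * u)"
    using cstar_le_conj[OF gh, of v] cstar_le_conj[OF gh, of u] by auto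
  then have "star v * g * v \<in> M"
    using sinv_hereditaryD(2)[OF M positives_conj[OF g] hM] by blast
  then have "star u * h * u \<in> M" using sinv_hereditaryD(3)[OF M, of "u * v"] by (simp only: e1)
  then have "g * g \<in> M"
    using sinv_hereditaryD(2)[OF M square_positive[OF positives_star[OF g]]] \<open>cstar_le (g * g) (star u * h * u)\<close> by blast
  then show "g \<in> {a \<in> positives. npow a 2 \<in> M}" using g by (simp add: sq)
next
  note sq = npow_2
  fix x assume "star x * x \<in> {a \<in> positives. npow a 2 \<in> M}"
  then have M': "(star x * x) * (star x * x) \<in> M" by (simp add: sq)
  \<comment> \<open>Chosen so that \<open>x * u\<close> has \<open>(star x * x)^2\<close> and
    \<open>(x * star x)^2\<close> as its two products with its adjoint.\<close>
  define u where "u = positive_sqrt (star x * x)"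
  have u: "star u = u" "u * u = star x * x"
    by (simp_all add: u_def star_positive_sqrt positive_sqrt_mult star_mult_positive)
  have "star (x * u) * (x * u) = u * (star x * x) * u" by (simp add: star_mult u mult.assoc)
  also have "\<dots> = (star x * x) * (star x * x)" unfolding u(2)[symmetric] by (simp only: mult.assoc)
  finally have "(x * u) * star (x * u) \<in> M" using sinv_hereditaryD(3)[OF M, of "x * u"] M' by simp
  moreover have "(x * u) * star (x * u) = x * (u * u) * star x" by (simp add: star_mult u(1) mult.assoc)
  moreover have "x * (u * u) * star x = (x * star x) * (x * star x)" unfolding u(2) by (simp only: mult.assoc)
  ultimately show "x * star x \<in> {a \<in> positives. npow a 2 \<in> M}" by (simp add: sq mult_star_positive)
qed auto

lemma sinv_hereditary_pow2:
  assumes M: "sinv_hereditary M" shows "sinv_hereditary {a \<in> positives. npow a (2 ^ k) \<in> M}"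
proof (induction k)
  case 0
  have "{a \<in> positives. npow a (2 ^ 0) \<in> M} = M" using sinv_hereditaryD(1)[OF M] by auto
  then show ?case using M by simp
next
  case (Suc k)
  have "{a \<in> positives. npow a 2 \<in> {a \<in> positives. npow a (2 ^ k) \<in> M}}
      = {a \<in> positives. npow a (2 ^ Suc k) \<in> M}"
    using npow_positive[of _ 2] by (auto simp: npow_mult[symmetric])
  then show ?case using sinv_hereditary_square[OF Suc] by simp
qed

text \<open>With \<open>s = n / 2^n\<close>, the \<open>n\<close>-th power of \<open>a\<close> is
  the \<open>2^n\<close>-th power of \<open>a^s\<close>. As \<open>s \<le> 1\<close>, Loewner--Heinz
  passes from \<open>g \<le> h\<close> to \<open>g^s \<le> h^s\<close>, and the case of exponents
  \<open>2^k\<close> applies.\<close>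

lemma sinv_hereditary_npow:
  assumes M: "sinv_hereditary M" and n: "n \<ge> 1"
  shows "sinv_hereditary {a \<in> positives. npow a n \<in> M}"
  unfolding sinv_hereditary_def
proof (intro conjI ballI allI impI)
  fix g h assume g: "g \<in> positives" and h: "h \<in> {a \<in> positives. npow a n \<in> M}" and gh: "cstar_le g h"
  then have hp: "h \<in> positives" and hM: "npow h n \<in> M" by auto
  have k: "n \<le> 2 ^ n" by simp
  define s where "s = real n / 2 ^ n"
  have s: "s > 0" using n by (simp add: s_def)
  define r where "r a = cfc (\<lambda>t. t powr s) a" for a :: 'a
  have r: "r a \<in> positives" "npow (r a) (2 ^ n) = npow a n" if a: "a \<in> positives" for a
  proof -
    note d = cfc_dom_powr[OF a s]
    show "r a \<in> positives" unfolding r_def by (rule positives_cfc[OF d]) simp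
    have "npow (r a) (2 ^ n) = cfc (\<lambda>t. (t powr s) ^ (2 ^ n)) a"
      unfolding r_def by (rule cfc_npow(2)[OF d, symmetric]) simp
    also have "\<dots> = cfc (\<lambda>t. t ^ n) a"
    proof (rule cfc_cong(2)[OF cfc_dom_power[OF positives_star[OF a] n]])
      fix t assume "t \<in> rspec a"
      then have t: "t \<ge> 0" using positives_rspec[OF a] by blast
      show "t ^ n = (t powr s) ^ (2 ^ n)"
      proof (cases "t = 0")
        case False
        then have "(t powr s) ^ (2 ^ n) = t powr (s * 2 ^ n)"
          using t by (simp add: powr_powr flip: powr_realpow)
        also have "s * 2 ^ n = real n" by (simp add: s_def)
        finally show ?thesis using t False by (simp add: powr_realpow)
      qed (use n in \<open>simp add: power_0_left\<close>)
    qed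
    finally show "npow (r a) (2 ^ n) = npow a n" using cfc_power[OF positives_star[OF a] n] by simp
  qed
  have "cstar_le (r g) (r h)"
    unfolding r_def s_def by (rule loewner_dyadic[OF g hp gh n k])
  then have "npow (r g) (2 ^ n) \<in> M"
    using sinv_hereditaryD(2)[OF sinv_hereditary_pow2[OF M, of n] r(1)[OF g], of "r h"] r[OF hp] hM by simp
  then show "g \<in> {a \<in> positives. npow a n \<in> M}" using g r(2) by simp
next
  fix x assume "star x * x \<in> {a \<in> positives. npow a n \<in> M}"
  then have nM: "npow (star x * x) n \<in> M" by simp
  have "npow (x * star x) n \<in> M"
  proof (cases "n = 1")
    case True
    then show ?thesis using nM sinv_hereditaryD(3)[OF M] by simp
  next
    case False
    then obtain m where m: "n = Suc m" "m \<ge> 1" using n by (cases n) auto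
    \<comment> \<open>Strong invariance is applied to \<open>x * v\<close> with
      \<open>v = (star x * x)^(m / 2)\<close>; the square root makes sense of this for odd
      \<open>m\<close> as well.\<close>
    define u where "u = positive_sqrt (star x * x)"
    have u: "star u = u" "npow u 2 = star x * x"
      by (simp_all add: u_def npow_2 star_positive_sqrt positive_sqrt_mult star_mult_positive)
    define v where "v = npow u m"
    have v: "star v = v" using m u by (simp add: v_def star_npow)
    have vv: "v * v = npow (star x * x) m"
      using m npow_add[of m m u] npow_mult[of 2 m u] u by (simp add: v_def mult_2)
    have "star (x * v) * (x * v) = v * (star x * x) * v" by (simp add: star_mult v mult.assoc)
    also have "\<dots> = npow u (m + 2 + m)"
    proof -
      have "npow u (m + 2 + m) = npow u (m + 2) * npow u m" by (rule npow_add) (use m in auto)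
      moreover have "npow u (m + 2) = npow u m * npow u 2" by (rule npow_add) (use m in auto)
      ultimately show ?thesis unfolding u(2)[symmetric] v_def by simp
    qed
    also have "m + 2 + m = 2 * n" using m by simp
    also have "npow u (2 * n) = npow (star x * x) n" using npow_mult[of 2 n u] n u by simp
    finally have "(x * v) * star (x * v) \<in> M" using sinv_hereditaryD(3)[OF M, of "x * v"] nM by simp
    moreover have "(x * v) * star (x * v) = x * (v * v) * star x" by (simp add: star_mult v mult.assoc)
    ultimately show ?thesis using npow_mult_star[OF m(2), of x "star x"] by (simp add: vv m)
  qed
  then show "x * star x \<in> {a \<in> positives. npow a n \<in> M}" by (simp add: mult_star_positive)
qed auto

section \<open>Order ideals generated by finite sums\<close>

definition finite_sums :: "'a::cstar_algebra set \<Rightarrow> 'a set" where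
  "finite_sums Q = {sum_list ps | ps. set ps \<subseteq> Q}"

lemma finite_sums_add: "a \<in> finite_sums Q \<Longrightarrow> b \<in> finite_sums Q \<Longrightarrow> a + b \<in> finite_sums Q"
proof -
  assume "a \<in> finite_sums Q" "b \<in> finite_sums Q"
  then obtain ps qs where "a = sum_list ps" "b = sum_list qs" "set ps \<subseteq> Q" "set qs \<subseteq> Q"
    by (auto simp: finite_sums_def)
  then have "a + b = sum_list (ps @ qs)" "set (ps @ qs) \<subseteq> Q" by auto
  then show ?thesis unfolding finite_sums_def by blast
qed

lemma finite_sums_0: "0 \<in> finite_sums Q"
  unfolding finite_sums_def by (intro CollectI exI[of _ "[]"]) simp

lemma finite_sums_base: "Q \<subseteq> finite_sums Q"
proof
  fix a assume "a \<in> Q"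
  then show "a \<in> finite_sums Q" unfolding finite_sums_def by (intro CollectI exI[of _ "[a]"]) simp
qed

lemma finite_sums_sum: "(\<And>i. i \<in> S \<Longrightarrow> f i \<in> Q) \<Longrightarrow> sum f S \<in> finite_sums Q"
proof (induction S rule: infinite_finite_induct)
  case (insert x F)
  then show ?case using finite_sums_add[of "f x" Q "sum f F"] finite_sums_base[of Q] by auto
qed (simp_all add: finite_sums_0)

text \<open>Riesz decomposition distributes \<open>x * star x\<close> over the summands of a bound
  for \<open>star x * x\<close>, each piece landing in \<open>Q\<close>. For
  \<open>x = sqrt a\<close> this is heredity, for the bound \<open>star x * x\<close> itself it is
  strong invariance.\<close>

lemma finite_sums_order_ideal:
  assumes Q: "sinv_hereditary Q"
  shows "order_ideal (finite_sums Q)" "strongly_invariant (finite_sums Q)"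
proof -
  have sub: "finite_sums Q \<subseteq> positives"
  proof
    fix a assume "a \<in> finite_sums Q"
    then obtain ps where ps: "a = sum_list ps" "set ps \<subseteq> Q" by (auto simp: finite_sums_def)
    have "sum_list ps \<in> positives" using ps(2)
      by (induction ps) (use sinv_hereditaryD(1)[OF Q] in \<open>auto intro: positives_add\<close>)
    then show "a \<in> positives" by (simp add: ps)
  qed
  have main: "x * star x \<in> finite_sums Q" if x: "cstar_le (star x * x) b" "b \<in> finite_sums Q" for x b
  proof -
    obtain ps where ps: "b = sum_list ps" "set ps \<subseteq> Q" using x by (auto simp: finite_sums_def)
    define z where "z i = positive_sqrt (ps ! i)" for i
    have pi: "ps ! i \<in> Q" if "i \<in> {0..<length ps}" for i using that ps(2) by auto
    then have z: "star (z i) = z i" "z i * z i = ps ! i" if "i \<in> {0..<length ps}" for i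
      using that sinv_hereditaryD(1)[OF Q] by (auto simp: z_def star_positive_sqrt positive_sqrt_mult)
    have "b = (\<Sum>i\<in>{0..<length ps}. z i * star (z i))"
      unfolding ps(1) sum_list_sum_nth by (intro sum.cong) (simp_all add: z)
    with riesz_decomposition[of "{0..<length ps}" x z] x(1) obtain w where
      w: "x * star x = (\<Sum>i\<in>{0..<length ps}. w i * star (w i))"
         "\<And>i. i \<in> {0..<length ps} \<Longrightarrow> cstar_le (star (w i) * w i) (star (z i) * z i)" by auto
    have "w i * star (w i) \<in> Q" if i: "i \<in> {0..<length ps}" for i
    proof (rule sinv_hereditaryD(3)[OF Q])
      show "star (w i) * w i \<in> Q"
        by (rule sinv_hereditaryD(2)[OF Q star_mult_positive pi[OF i]]) (use w(2)[OF i] z[OF i] in simp)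
    qed
    then show ?thesis unfolding w(1) by (intro finite_sums_sum)
  qed
  show "order_ideal (finite_sums Q)"
    unfolding order_ideal_def
  proof (intro conjI ballI impI)
    fix a b assume "a \<in> positives" "b \<in> positives" "cstar_le a b \<and> b \<in> finite_sums Q"
    then show "a \<in> finite_sums Q" using main[of "positive_sqrt a" b] by (simp add: star_positive_sqrt positive_sqrt_mult)
  qed (use sub in \<open>auto intro: finite_sums_add finite_sums_0\<close>)
  have si: "x * star x \<in> finite_sums Q" if "star x * x \<in> finite_sums Q" for x
    by (rule main[OF _ that]) simp
  show "strongly_invariant (finite_sums Q)"
    unfolding strongly_invariant_def using si by (metis star_star)
qed

text \<open>Integer multiples are sums, and \<open>r *\<^sub>R a\<close> lies below one of
  them.\<close>

lemma order_ideal_scaleR: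
  assumes M: "order_ideal M" and a: "a \<in> M" "r \<ge> 0" shows "r *\<^sub>R a \<in> M"
proof -
  have ap: "a \<in> positives" using M a by (auto simp: order_ideal_def)
  have n: "real n *\<^sub>R a \<in> M" for n
  proof (induction n)
    case 0
    then show ?case using M by (simp add: order_ideal_def)
  next
    case (Suc n)
    then have "a + real n *\<^sub>R a \<in> M" using M a by (simp add: order_ideal_def)
    then show ?case by (simp add: algebra_simps)
  qed
  obtain n where "r \<le> real n" using real_arch_simple by blast
  then have "cstar_le (r *\<^sub>R a) (real n *\<^sub>R a)"
    unfolding cstar_le_def using positives_scaleR[OF ap, of "real n - r"] by (simp add: scaleR_diff_left)
  moreover have "r *\<^sub>R a \<in> positives" "real n *\<^sub>R a \<in> positives" using ap a by (auto intro: positives_scaleR)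
  ultimately show ?thesis using M n[of n] unfolding order_ideal_def by blast
qed

section \<open>Complex spans of sets of positive elements\<close>

text \<open>For \<open>w = sqrt c\<close> and \<open>y = x * w\<close>, polarization writes
  \<open>4 * x * c = 4 * y * w\<close> as a combination of four terms
  \<open>(y + v) * star (y + v)\<close> with \<open>star v * v = c\<close>. Each lies in
  \<open>M\<close>, since \<open>star (y + v) * (y + v)\<close> is at most a real multiple of
  \<open>c\<close>. Closure of \<open>M\<close> under sums never enters.\<close>

lemma alg_ideal_complex_span:
  assumes M: "sinv_hereditary M" and sc: "\<And>a r. a \<in> M \<Longrightarrow> r \<ge> 0 \<Longrightarrow> r *\<^sub>R a \<in> M"
  shows "alg_ideal (complex_span M)"
proof -
  let ?S = "complex_span M"
  have left1: "x * c \<in> ?S" if c: "c \<in> M" for x c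
  proof -
    have cp: "c \<in> positives" using sinv_hereditaryD(1)[OF M c] .
    define w where "w = positive_sqrt c"
    have w: "star w = w" "w * w = c" using cp by (simp_all add: w_def star_positive_sqrt positive_sqrt_mult)
    define y where "y = x * w"
    have in_M: "(y + v) * star (y + v) \<in> M" if v: "star v * v = c" for v
    proof (rule sinv_hereditaryD(3)[OF M], rule sinv_hereditaryD(2)[OF M star_mult_positive])
      show "(2 * (norm x)\<^sup>2 + 2) *\<^sub>R c \<in> M" by (rule sc[OF c]) simp
      have "cstar_le (star y * y) ((norm x)\<^sup>2 *\<^sub>R c)"
        using conj_le_norm[of w x] w by (simp add: y_def star_mult mult.assoc)
      then have "cstar_le (2 *\<^sub>R (star y * y) + 2 *\<^sub>R (star v * v)) (2 *\<^sub>R (norm x)\<^sup>2 *\<^sub>R c + 2 *\<^sub>R c)"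
        unfolding v by (intro cstar_le_add cstar_le_scaleR) auto
      from cstar_le_trans[OF star_add_le this]
      show "cstar_le (star (y + v) * (y + v)) ((2 * (norm x)\<^sup>2 + 2) *\<^sub>R c)"
        by (simp add: scaleR_add_left)
    qed
    define q where "q v = (y + v) * star (y + v)" for v
    have "q w \<in> M" "q (- w) \<in> M" "q (imul w) \<in> M" "q (- imul w) \<in> M"
      unfolding q_def by (intro in_M; simp add: w star_minus)+
    then have "q w - q (- w) + imul (q (imul w)) - imul (q (- imul w)) \<in> ?S"
      by (intro complex_vector.span_diff complex_vector.span_add complex_span_imul complex_vector.span_base)
    moreover have "q w - q (- w) + imul (q (imul w)) - imul (q (- imul w)) = 4 *\<^sub>R (x * c)"
    proof -
      have "q w - q (- w) + imul (q (imul w)) - imul (q (- imul w))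
          = y * w + y * w + y * w + y * w"
        by (simp add: q_def star_add star_minus star_diff w(1) algebra_simps)
      moreover have "y * w = x * c" by (simp add: y_def mult.assoc w)
      moreover have "(4 :: real) = 1 + 1 + 1 + 1" by simp
      ultimately show ?thesis by (simp only: scaleR_add_left scaleR_one)
    qed
    ultimately have "(1/4) *\<^sub>R (4 *\<^sub>R (x * c)) \<in> ?S" by (metis complex_span_scaleR)
    then show ?thesis by simp
  qed
  have left: "x * s \<in> ?S" if "s \<in> ?S" for x s
  proof -
    have "complex_vector.subspace {s. x * s \<in> ?S}"
      by (rule complex_vector.subspaceI)
         (auto simp: distrib_left mult_scaleC_right complex_vector.span_zero
           intro: complex_vector.span_add complex_vector.span_scale)
    then have "?S \<subseteq> {s. x * s \<in> ?S}" using left1 by (intro complex_vector.span_minimal) auto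
    then show ?thesis using that by blast
  qed
  have st: "star s \<in> ?S" if "s \<in> ?S" for s
  proof -
    have "complex_vector.subspace {s. star s \<in> ?S}"
      by (rule complex_vector.subspaceI)
         (auto simp: star_add star_scaleC complex_vector.span_zero
           intro: complex_vector.span_add complex_vector.span_scale)
    then have "?S \<subseteq> {s. star s \<in> ?S}"
      using sinv_hereditaryD(1)[OF M]
      by (intro complex_vector.span_minimal) (auto simp: positives_star complex_vector.span_base)
    then show ?thesis using that by blast
  qed
  show ?thesis
  proof (rule alg_idealI)
    show "x * a \<in> ?S" if "x \<in> ?S" for a x
      using st[OF left[OF st[OF that], of "star a"]] by (simp add: star_mult star_star)
  qed (auto intro: complex_vector.span_zero complex_vector.span_diff left)
qed

text \<open>The span sits inside \<open>(M - M) + imul (M - M)\<close>. A positive element of it is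
  self-adjoint, hence of the form \<open>p - q \<le> p\<close> with \<open>p\<close> in
  \<open>M\<close>, and heredity applies.\<close>

lemma complex_span_order_ideal:
  assumes M: "order_ideal M" shows "complex_span M \<inter> positives = M"
proof -
  have Mp: "M \<subseteq> positives" and M0: "0 \<in> M" and Ma: "\<And>a b. a \<in> M \<Longrightarrow> b \<in> M \<Longrightarrow> a + b \<in> M"
    using M by (auto simp: order_ideal_def)
  note sc = order_ideal_scaleR[OF M]
  define D where "D = {p - q | p q. p \<in> M \<and> q \<in> M}"
  have D0: "p \<in> D" if "p \<in> M" for p using that M0 unfolding D_def by force
  have Dadd: "x + y \<in> D" if xy: "x \<in> D" "y \<in> D" for x y
  proof -
    obtain p q p' q' where "x = p - q" "y = p' - q'" "p \<in> M" "q \<in> M" "p' \<in> M" "q' \<in> M"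
      using xy by (auto simp: D_def)
    then have "x + y = (p + p') - (q + q')" "p + p' \<in> M" "q + q' \<in> M" using Ma by auto
    then show ?thesis unfolding D_def by blast
  qed
  have Dsc: "r *\<^sub>R x \<in> D" if x: "x \<in> D" for x r
  proof -
    obtain p q where pq: "x = p - q" "p \<in> M" "q \<in> M" using x by (auto simp: D_def)
    show ?thesis
    proof (cases "r \<ge> 0")
      case True
      then have "r *\<^sub>R x = r *\<^sub>R p - r *\<^sub>R q" "r *\<^sub>R p \<in> M" "r *\<^sub>R q \<in> M"
        using pq sc by (auto simp: scaleR_diff_right)
      then show ?thesis unfolding D_def by blast
    next
      case False
      then have "r *\<^sub>R x = (- r) *\<^sub>R q - (- r) *\<^sub>R p" "(- r) *\<^sub>R p \<in> M" "(- r) *\<^sub>R q \<in> M"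
        using pq sc[of p "- r"] sc[of q "- r"] by (auto simp: scaleR_diff_right)
      then show ?thesis unfolding D_def by blast
    qed
  qed
  have Dst: "star x = x" if x: "x \<in> D" for x
  proof -
    obtain p q where "x = p - q" "p \<in> M" "q \<in> M" using x by (auto simp: D_def)
    moreover have "star p = p" "star q = q" using calculation Mp positives_star by blast+
    ultimately show ?thesis by (simp add: star_diff)
  qed
  define E where "E = {h + imul k | h k. h \<in> D \<and> k \<in> D}"
  have "complex_vector.subspace E"
  proof (rule complex_vector.subspaceI)
    show "0 \<in> E" using D0[OF M0] unfolding E_def by force
    fix x y assume "x \<in> E" "y \<in> E"
    then obtain h k h' k' where "x = h + imul k" "y = h' + imul k'" "h \<in> D" "k \<in> D" "h' \<in> D" "k' \<in> D"
      by (auto simp: E_def)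
    then have "x + y = (h + h') + imul (k + k')" "h + h' \<in> D" "k + k' \<in> D" using Dadd by auto
    then show "x + y \<in> E" unfolding E_def by blast
  next
    fix c x assume "x \<in> E"
    then obtain h k where hk: "x = h + imul k" "h \<in> D" "k \<in> D" by (auto simp: E_def)
    have "c *\<^sub>C x = (Re c *\<^sub>R h + (- Im c) *\<^sub>R k) + imul (Im c *\<^sub>R h + Re c *\<^sub>R k)"
      unfolding scaleC_eq[of c] hk(1) by (simp add: scaleR_add_right scaleR_diff_right)
    moreover have "Re c *\<^sub>R h + (- Im c) *\<^sub>R k \<in> D" "Im c *\<^sub>R h + Re c *\<^sub>R k \<in> D"
      using hk Dadd Dsc by blast+
    ultimately show "c *\<^sub>C x \<in> E" unfolding E_def by blast
  qed
  moreover have "M \<subseteq> E" using D0 D0[OF M0] unfolding E_def by force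
  ultimately have SE: "complex_span M \<subseteq> E" by (intro complex_vector.span_minimal)
  have "a \<in> M" if a: "a \<in> complex_span M" "a \<in> positives" for a
  proof -
    obtain h k where hk: "a = h + imul k" "h \<in> D" "k \<in> D" using a SE by (auto simp: E_def)
    have "star a = h - imul k" using Dst hk by (simp add: star_add)
    then have "a + star a = h + h" using hk(1) by simp
    then have "2 *\<^sub>R a = 2 *\<^sub>R h"
      using positives_star[OF a(2)] by (simp add: scaleR_2)
    then have "a = h" by simp
    then obtain p q where pq: "a = p - q" "p \<in> M" "q \<in> M" using hk by (auto simp: D_def)
    then have "cstar_le a p" using Mp by (auto simp: cstar_le_def)
    then show ?thesis using M a pq Mp unfolding order_ideal_def by blast
  qed
  then show ?thesis using Mp complex_vector.span_superset[of M] by blast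
qed

lemma dixmier_ideal_complex_span:
  assumes "order_ideal M" "strongly_invariant M" shows "dixmier_ideal (complex_span M)"
  unfolding dixmier_ideal_def complex_span_order_ideal[OF assms(1)]
  using assms alg_ideal_complex_span[OF sinv_hereditary_positive_part[OF assms]]
    order_ideal_scaleR[OF assms(1)] by blast

text \<open>Every \<open>z\<close> with \<open>z\<^sup>* z \<le> C e\<^sup>4\<close> factors as \<open>u e\<close>, so that \<open>z z\<^sup>* = u e\<^sup>2 u\<^sup>*\<close>.\<close>

lemma dixmier_ideal_fourth_power:
  assumes I: "alg_ideal I" and e: "e \<in> positives" "npow e 2 \<in> I"
  shows "\<exists>L. dixmier_ideal L \<and> L \<subseteq> I \<and> npow e 4 \<in> L"
proof -
  \<comment> \<open>The elements obtained from multiples of \<open>e^4\<close> by one flip from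
    \<open>star z * z\<close> to \<open>z * star z\<close>; Riesz decomposition with a single
    summand shows that a second flip gives nothing new.\<close>
  define Q where "Q = {z * star z | z C. C \<ge> 0 \<and> cstar_le (star z * z) (C *\<^sub>R npow e 4)}"
  have flip: "x * star x \<in> Q" if x: "cstar_le (star x * x) q" "q \<in> Q" for x q
  proof -
    obtain z C where z: "q = z * star z" "C \<ge> 0" "cstar_le (star z * z) (C *\<^sub>R npow e 4)"
      using x by (auto simp: Q_def)
    from riesz_decomposition[of "{()}" x "\<lambda>_. z"] x z obtain w where
      "x * star x = w * star w" "cstar_le (star w * w) (star z * z)" by auto
    then show ?thesis using z cstar_le_trans unfolding Q_def by blast
  qed
  have Q: "sinv_hereditary Q"
    unfolding sinv_hereditary_def
  proof (intro conjI ballI allI impI)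
    show "Q \<subseteq> positives" by (auto simp: Q_def mult_star_positive)
    fix a q assume "a \<in> positives" "q \<in> Q" "cstar_le a q"
    then show "a \<in> Q" using flip[of "positive_sqrt a" q] by (simp add: star_positive_sqrt positive_sqrt_mult)
  next
    fix x assume "star x * x \<in> Q"
    then show "x * star x \<in> Q" using flip[of x "star x * x"] by simp
  qed
  note fs = finite_sums_order_ideal[OF Q]
  have e4: "npow e 4 \<in> positives" by (rule npow_positive[OF e(1)]) simp
  have QI: "c *\<^sub>C q \<in> I" if q: "q \<in> Q" for c q
  proof -
    obtain z C where z: "q = z * star z" "C \<ge> 0" "cstar_le (star z * z) (C *\<^sub>R npow e 4)"
      using q unfolding Q_def by blast
    define r where "r = root 4 C"
    have "r ^ 4 = C" "r \<ge> 0" using z by (auto simp: r_def)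
    then have "npow (r *\<^sub>R e) 4 = C *\<^sub>R npow e 4" "r *\<^sub>R e \<in> positives"
      using e by (auto simp: npow_scaleR intro: positives_scaleR)
    then obtain u where u: "z = u * (r *\<^sub>R e)" using factor_fourth[of z "r *\<^sub>R e"] z by auto
    have "z * star z = (r *\<^sub>R u) * npow e 2 * star (r *\<^sub>R u)"
      using positives_star[OF e(1)] by (simp add: u npow_2 star_mult star_scaleR mult.assoc)
    then have "c *\<^sub>C q = (c *\<^sub>C (r *\<^sub>R u)) * npow e 2 * star (r *\<^sub>R u)"
      unfolding z(1) by (simp only: mult_scaleC_left)
    then show ?thesis using alg_ideal_mult[OF I] e(2) by simp
  qed
  \<comment> \<open>\<open>I\<close> need not be a complex subspace, so the span is compared with
    the elements all of whose complex multiples lie in \<open>I\<close>.\<close>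
  have sub: "complex_vector.subspace {s. \<forall>c. c *\<^sub>C s \<in> I}"
    by (rule complex_vector.subspaceI)
       (auto simp: scaleC_add_right scaleC_scaleC alg_ideal_0[OF I] intro: alg_ideal_add[OF I])
  have "c *\<^sub>C s \<in> I" if s: "s \<in> finite_sums Q" for c s
  proof -
    obtain ps where ps: "s = sum_list ps" "set ps \<subseteq> Q" using s by (auto simp: finite_sums_def)
    have "c *\<^sub>C sum_list ps \<in> I" using ps(2)
      by (induction ps) (auto simp: alg_ideal_0[OF I] scaleC_add_right intro: alg_ideal_add[OF I] QI)
    then show ?thesis by (simp add: ps)
  qed
  then have "complex_span (finite_sums Q) \<subseteq> {s. \<forall>c. c *\<^sub>C s \<in> I}"
    by (intro complex_vector.span_minimal sub) auto
  then have "1 *\<^sub>C s \<in> I" if "s \<in> complex_span (finite_sums Q)" for s using that by blast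
  then have "complex_span (finite_sums Q) \<subseteq> I" by auto
  moreover have "npow e 4 \<in> Q"
  proof -
    define z where "z = positive_sqrt (npow e 4)"
    have "z * star z = npow e 4" "star z * z = npow e 4"
      using e4 by (simp_all add: z_def star_positive_sqrt positive_sqrt_mult)
    then have "npow e 4 = z * star z \<and> (1::real) \<ge> 0 \<and> cstar_le (star z * z) (1 *\<^sub>R npow e 4)" by simp
    then show ?thesis unfolding Q_def by blast
  qed
  then have "npow e 4 \<in> complex_span (finite_sums Q)"
    using finite_sums_base complex_vector.span_base by blast
  ultimately show ?thesis using dixmier_ideal_complex_span[OF fs] by blast
qed

section \<open>The Dixmier interior\<close>

lemma dixmier_idealD:
  assumes "dixmier_ideal L"
  shows "alg_ideal L" "L = complex_span (L \<inter> positives)" "sinv_hereditary (L \<inter> positives)"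
  using assms sinv_hereditary_positive_part[of "L \<inter> positives"] unfolding dixmier_ideal_def by auto

lemma dixmier_interior_subset:
  assumes I: "alg_ideal I" shows "dixmier_interior I \<subseteq> I"
proof
  fix x assume "x \<in> dixmier_interior I"
  then obtain xs where xs: "x = sum_list xs" "set xs \<subseteq> \<Union>{L. dixmier_ideal L \<and> L \<subseteq> I}"
    by (auto simp: dixmier_interior_def)
  then have "set xs \<subseteq> I" by blast
  then have "sum_list xs \<in> I"
    by (induction xs) (auto simp: alg_ideal_0[OF I] intro: alg_ideal_add[OF I])
  then show "x \<in> I" by (simp add: xs)
qed

lemma dixmier_ideal_subset_interior:
  assumes "dixmier_ideal L" "L \<subseteq> I" shows "L \<subseteq> dixmier_interior I"
proof
  fix x assume "x \<in> L"
  then show "x \<in> dixmier_interior I"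
    unfolding dixmier_interior_def by (intro CollectI exI[of _ "[x]"] conjI) (use assms in auto)
qed

text \<open>The positive parts of the ideals in question have a hereditary, strongly invariant
  union. Its finite sums form an order ideal by Riesz decomposition, and the interior is the complex
  span of that order ideal.\<close>

lemma dixmier_ideal_interior: "dixmier_ideal (dixmier_interior I)"
proof -
  define F where "F = {L. dixmier_ideal L \<and> L \<subseteq> I}"
  define Q where "Q = (\<Union>L\<in>F. L \<inter> positives)"
  have "sinv_hereditary Q"
    unfolding sinv_hereditary_def
  proof (intro conjI ballI allI impI)
    fix a b assume ab: "a \<in> positives" "b \<in> Q" "cstar_le a b"
    then obtain L where L: "L \<in> F" "b \<in> L \<inter> positives" unfolding Q_def by blast
    have "sinv_hereditary (L \<inter> positives)"
      by (rule dixmier_idealD(3)) (use L(1) in \<open>simp add: F_def\<close>)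
    then have "a \<in> L \<inter> positives" using ab(1) L(2) ab(3) by (rule sinv_hereditaryD(2))
    then show "a \<in> Q" using L(1) unfolding Q_def by blast
  next
    fix x assume "star x * x \<in> Q"
    then obtain L where L: "L \<in> F" "star x * x \<in> L \<inter> positives" unfolding Q_def by blast
    have "sinv_hereditary (L \<inter> positives)"
      by (rule dixmier_idealD(3)) (use L(1) in \<open>simp add: F_def\<close>)
    then have "x * star x \<in> L \<inter> positives" using L(2) by (rule sinv_hereditaryD(3))
    then show "x * star x \<in> Q" using L(1) unfolding Q_def by blast
  next
    show "Q \<subseteq> positives" unfolding Q_def by blast
  qed
  note fs = finite_sums_order_ideal[OF this]
  have scF: "c *\<^sub>C x \<in> \<Union>F" if x: "x \<in> \<Union>F" for c x
  proof -
    obtain L where L: "L \<in> F" "x \<in> L" using x by blast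
    then have "L = complex_span (L \<inter> positives)" using dixmier_idealD(2) by (auto simp: F_def)
    then have "c *\<^sub>C x \<in> L" using L(2) complex_vector.span_scale by metis
    then show ?thesis using L by blast
  qed
  have J: "dixmier_interior I = finite_sums (\<Union>F)"
    by (simp add: dixmier_interior_def finite_sums_def F_def)
  have sub: "complex_vector.subspace (finite_sums (\<Union>F))"
  proof (rule complex_vector.subspaceI)
    fix c x assume "x \<in> finite_sums (\<Union>F)"
    then obtain ps where ps: "x = sum_list ps" "set ps \<subseteq> \<Union>F" by (auto simp: finite_sums_def)
    have "c *\<^sub>C sum_list ps \<in> finite_sums (\<Union>F)" using ps(2)
    proof (induction ps)
      case (Cons p ps)
      then have "c *\<^sub>C p \<in> finite_sums (\<Union>F)" using scF finite_sums_base[of "\<Union>F"] by force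
      then show ?case using Cons by (simp add: scaleC_add_right finite_sums_add)
    qed (simp add: finite_sums_0)
    then show "c *\<^sub>C x \<in> finite_sums (\<Union>F)" by (simp add: ps)
  qed (auto intro: finite_sums_0 finite_sums_add)
  have "finite_sums Q \<subseteq> finite_sums (\<Union>F)"
    unfolding finite_sums_def Q_def by blast
  then have "complex_span (finite_sums Q) \<subseteq> finite_sums (\<Union>F)"
    by (rule complex_vector.span_minimal[OF _ sub])
  moreover have "finite_sums (\<Union>F) \<subseteq> complex_span (finite_sums Q)"
  proof
    fix x assume "x \<in> finite_sums (\<Union>F)"
    then obtain ps where ps: "x = sum_list ps" "set ps \<subseteq> \<Union>F" by (auto simp: finite_sums_def)
    have base: "p \<in> complex_span (finite_sums Q)" if p: "p \<in> \<Union>F" for p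
    proof -
      obtain L where L: "L \<in> F" "p \<in> L" using p by blast
      then have "L = complex_span (L \<inter> positives)" using dixmier_idealD(2) by (auto simp: F_def)
      then have "p \<in> complex_span (L \<inter> positives)" using L by blast
      moreover have "L \<inter> positives \<subseteq> finite_sums Q" using finite_sums_base[of Q] L by (auto simp: Q_def)
      ultimately show ?thesis using complex_vector.span_mono by blast
    qed
    have "sum_list ps \<in> complex_span (finite_sums Q)" using ps(2)
      by (induction ps) (auto intro: complex_vector.span_zero complex_vector.span_add base)
    then show "x \<in> complex_span (finite_sums Q)" by (simp add: ps)
  qed
  ultimately have "dixmier_interior I = complex_span (finite_sums Q)" using J by blast
  then show ?thesis using dixmier_ideal_complex_span[OF fs] by simp
qed

section \<open>Fractional powers of Dixmier ideals\<close>

text \<open>Existence and uniqueness of positive roots replace real exponents by a condition on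
  integer powers, the form treated by \<open>sinv_hereditary_npow\<close>.\<close>

lemma ideal_powr_eq:
  assumes n: "n \<ge> 1"
  shows "ideal_powr J (1 / real n) = complex_span {a \<in> positives. npow a n \<in> J \<inter> positives}"
proof -
  have r: "cstar_powr a (1 / real n) = cfc (root n) a" if a: "a \<in> positives" for a :: 'a
    unfolding cstar_powr_def
  proof (rule cfc_cong(2)[OF cfc_dom_root[OF positives_star[OF a] n]])
    fix t assume "t \<in> rspec a"
    then have "t \<ge> 0" using positives_rspec[OF a] by blast
    then show "root n t = t powr (1 / real n)"
      using n root_powr_inverse[of n t] by (cases "t = 0") auto
  qed
  have "{cstar_powr a (1 / real n) | a. a \<in> J \<inter> positives} = {a \<in> positives. npow a n \<in> J \<inter> positives}"
  proof (intro equalityI subsetI)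
    fix x assume "x \<in> {cstar_powr a (1 / real n) | a. a \<in> J \<inter> positives}"
    then obtain a where "x = cfc (root n) a" "a \<in> J" "a \<in> positives" using r by auto
    then show "x \<in> {a \<in> positives. npow a n \<in> J \<inter> positives}" using npow_root[of a n] n by simp
  next
    fix x assume "x \<in> {a \<in> positives. npow a n \<in> J \<inter> positives}"
    then have x: "x \<in> positives" "npow x n \<in> J \<inter> positives" by auto
    then have "x = cstar_powr (npow x n) (1 / real n)" using r cfc_root_npow[OF x(1) n] by simp
    then show "x \<in> {cstar_powr a (1 / real n) | a. a \<in> J \<inter> positives}" using x by blast
  qed
  then show ?thesis by (simp add: ideal_powr_def)
qed

lemma alg_ideal_ideal_powr:
  assumes J: "dixmier_ideal J" and n: "n \<ge> 1"
  shows "alg_ideal (ideal_powr J (1 / real n))"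
  unfolding ideal_powr_eq[OF n]
proof (rule alg_ideal_complex_span[OF sinv_hereditary_npow[OF dixmier_idealD(3)[OF J] n]])
  have oi: "order_ideal (J \<inter> positives)" using J by (simp add: dixmier_ideal_def)
  fix a and r :: real assume "a \<in> {a \<in> positives. npow a n \<in> J \<inter> positives}" "r \<ge> 0"
  then show "r *\<^sub>R a \<in> {a \<in> positives. npow a n \<in> J \<inter> positives}"
    using order_ideal_scaleR[OF oi, of "npow a n" "r ^ n"] n
    by (simp add: npow_scaleR positives_scaleR)
qed

lemma ideal_powr_mono:
  assumes J: "alg_ideal J" and n: "1 \<le> m" "m \<le> n"
  shows "ideal_powr J (1 / real m) \<subseteq> ideal_powr J (1 / real n)"
proof -
  have "ideal_powr J (1 / real m) = complex_span {a \<in> positives. npow a m \<in> J \<inter> positives}"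
    "ideal_powr J (1 / real n) = complex_span {a \<in> positives. npow a n \<in> J \<inter> positives}"
    by (rule ideal_powr_eq, use n in simp)+
  moreover have "{a \<in> positives. npow a m \<in> J \<inter> positives} \<subseteq> {a \<in> positives. npow a n \<in> J \<inter> positives}"
    using alg_ideal_npow_mono[OF J _ n] npow_positive[of _ n] n by auto
  ultimately show ?thesis using complex_vector.span_mono by metis
qed

lemma ideal_powr_subset:
  assumes J: "J \<subseteq> semiprime_closure I" and n: "n \<ge> 1"
  shows "ideal_powr J (1 / real n) \<subseteq> semiprime_closure I"
proof -
  have "complex_vector.subspace (semiprime_closure I)"
    by (rule complex_vector.subspaceI)
       (auto intro: alg_ideal_0 alg_ideal_add alg_ideal_semiprime_closure semiprime_closure_scaleC)
  moreover have "{a \<in> positives. npow a n \<in> J \<inter> positives} \<subseteq> semiprime_closure I"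
    using semiprime_closure_npow[OF _ n] J by blast
  ultimately show ?thesis unfolding ideal_powr_eq[OF n] by (intro complex_vector.span_minimal)
qed

text \<open>If \<open>e = a^n\<close> lies in \<open>I\<close>, then so does \<open>e^2\<close>, and
  \<open>e^4 = a^(4 * n)\<close> belongs to a Dixmier ideal inside \<open>I\<close>.\<close>

lemma npow_in_dixmier_interior:
  assumes I: "alg_ideal I" and a: "a \<in> positives" "a \<in> semiprime_closure I"
  shows "\<exists>n\<ge>1. npow a n \<in> dixmier_interior I"
proof -
  obtain n where n: "n \<ge> 1" "npow a n \<in> I" using npow_in_of_semiprime_closure[OF I a(2)] by blast
  have e: "npow a n \<in> positives" by (rule npow_positive[OF a(1) n(1)])
  have "npow (npow a n) 2 \<in> I" by (rule alg_ideal_npow[OF I n(2)]) simp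
  from dixmier_ideal_fourth_power[OF I e this]
  have "npow (npow a n) 4 \<in> dixmier_interior I" using dixmier_ideal_subset_interior by blast
  moreover have "npow (npow a n) 4 = npow a (n * 4)" using n npow_mult[of n 4 a] by simp
  ultimately show ?thesis using n by (intro exI[of _ "n * 4"]) auto
qed

text \<open>The union is increasing, hence a complex subspace; as the semiprime closure is spanned
  by its positive elements, only these have to be placed in it.\<close>

lemma semiprime_closure_subset_Union_ideal_powr:
  assumes I: "alg_ideal I"
  shows "semiprime_closure I \<subseteq> (\<Union>n\<in>{1::nat..}. ideal_powr (dixmier_interior I) (1 / real n))"
proof -
  let ?J = "dixmier_interior I"
  let ?U = "\<Union>n\<in>{1::nat..}. ideal_powr ?J (1 / real n)"
  have aJ: "alg_ideal ?J" by (rule dixmier_idealD(1)[OF dixmier_ideal_interior])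
  have "complex_vector.subspace ?U"
  proof (rule complex_vector.subspaceI)
    show "0 \<in> ?U" unfolding ideal_powr_def using complex_vector.span_zero by (auto intro: bexI[of _ 1])
    fix x y assume "x \<in> ?U" "y \<in> ?U"
    then obtain m n where mn: "m \<ge> 1" "n \<ge> 1" "x \<in> ideal_powr ?J (1 / real m)" "y \<in> ideal_powr ?J (1 / real n)"
      by auto
    let ?k = "max m n"
    have "x \<in> ideal_powr ?J (1 / real ?k)" "y \<in> ideal_powr ?J (1 / real ?k)"
      using ideal_powr_mono[OF aJ mn(1), of ?k] ideal_powr_mono[OF aJ mn(2), of ?k] mn(3,4) by auto
    then have "x + y \<in> ideal_powr ?J (1 / real ?k)"
      unfolding ideal_powr_def by (rule complex_vector.span_add)
    then show "x + y \<in> ?U" using mn by (intro UN_I[of ?k]) auto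
  next
    fix c x assume "x \<in> ?U"
    then show "c *\<^sub>C x \<in> ?U" unfolding ideal_powr_def using complex_vector.span_scale by blast
  qed
  moreover have "semiprime_closure I \<inter> positives \<subseteq> ?U"
  proof
    fix a assume "a \<in> semiprime_closure I \<inter> positives"
    then obtain n where n: "n \<ge> 1" "npow a n \<in> ?J" "a \<in> positives"
      using npow_in_dixmier_interior[OF I] by blast
    then have "a \<in> ideal_powr ?J (1 / real n)"
      unfolding ideal_powr_eq[OF n(1)] using npow_positive by (intro complex_vector.span_base) auto
    then show "a \<in> ?U" using n by auto
  qed
  ultimately have "complex_span (semiprime_closure I \<inter> positives) \<subseteq> ?U"
    by (rule complex_vector.span_minimal[rotated])
  then show ?thesis using dixmier_idealD(2)[OF dixmier_ideal_semiprime_closure[of I]] by simp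
qed

theorem theorem5p9:
  fixes I J K :: "'a::cstar_algebra set"
  assumes "alg_ideal I"
    and "J = dixmier_interior I"
    and "K = dixmier_closure I"
  shows "semiprime_closure I = semiprime_closure J \<and>
    semiprime_closure I = semiprime_closure K \<and>
    semiprime_closure I = (\<Union>n\<in>{1::nat..}. ideal_powr J (1 / real n)) \<and>
    semiprime_closure I = (\<Union>n\<in>{1::nat..}. ideal_powr K (1 / real n)) \<and>
    semiprime_closure I = {x. \<exists>n\<ge>1. npow (star x * x) n \<in> I \<inter> positives} \<and>
    semiprime_closure I = {x. \<exists>n\<ge>1. npow (x * star x) n \<in> I \<inter> positives} \<and>
    (\<forall>n\<ge>1::nat. alg_ideal (ideal_powr J (1 / real n)) \<and>
       ideal_powr J (1 / real n) \<subseteq> ideal_powr J (1 / real (n + 1)) \<and>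
       radical_over (ideal_powr J (1 / real n)) I)"
proof -
  note I = assms(1)
  have dJ: "dixmier_ideal J" unfolding assms(2) by (rule dixmier_ideal_interior)
  have aJ: "alg_ideal J" by (rule dixmier_idealD(1)[OF dJ])
  have JI: "J \<subseteq> I" unfolding assms(2) by (rule dixmier_interior_subset[OF I])
  have IK: "I \<subseteq> K" unfolding assms(3) dixmier_closure_def by blast
  have KS: "K \<subseteq> semiprime_closure I"
    unfolding assms(3) dixmier_closure_def
    using dixmier_ideal_semiprime_closure[of I] semiprime_closure_superset[of I] by blast
  have IS: "I \<subseteq> semiprime_closure I" by (rule semiprime_closure_superset)
  have powrJ: "semiprime_closure I \<subseteq> (\<Union>n\<in>{1::nat..}. ideal_powr J (1 / real n))"
    unfolding assms(2) by (rule semiprime_closure_subset_Union_ideal_powr[OF I])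
  have subJ: "ideal_powr J (1 / real n) \<subseteq> semiprime_closure I" if "n \<ge> 1" for n
    using ideal_powr_subset[OF _ that] JI IS by blast
  have subK: "ideal_powr K (1 / real n) \<subseteq> semiprime_closure I" if "n \<ge> 1" for n
    by (rule ideal_powr_subset[OF KS that])
  have JK: "ideal_powr J s \<subseteq> ideal_powr K s" for s
    unfolding ideal_powr_def using JI IK by (intro complex_vector.span_mono) blast
  have SJ: "semiprime_closure I \<subseteq> semiprime_closure J"
  proof
    fix x assume "x \<in> semiprime_closure I"
    then have "star x * x \<in> semiprime_closure I" by (simp add: semiprime_closure_star_mult)
    from npow_in_dixmier_interior[OF I star_mult_positive this]
    obtain n where n: "n \<ge> 1" "npow (star x * x) n \<in> J" by (auto simp: assms(2))
    then have "star x * x \<in> semiprime_closure J"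
      using semiprime_closure_superset[of J] by (intro semiprime_closure_npow[OF star_mult_positive]) auto
    then show "x \<in> semiprime_closure J" by (simp add: semiprime_closure_star_mult)
  qed
  show ?thesis
  proof (intro conjI allI impI)
    show "semiprime_closure I = semiprime_closure J"
      using SJ semiprime_closure_mono[OF JI] by (rule equalityI)
    \<comment> \<open>Every prime ideal containing \<open>I\<close> contains
      \<open>semiprime_closure I\<close> and therefore \<open>K\<close>.\<close>
    show "semiprime_closure I = semiprime_closure K"
      using semiprime_closure_mono[OF IK] KS unfolding semiprime_closure_def by blast
    show "semiprime_closure I = (\<Union>n\<in>{1::nat..}. ideal_powr J (1 / real n))"
      using powrJ subJ by (intro equalityI UN_least) auto
    show "semiprime_closure I = (\<Union>n\<in>{1::nat..}. ideal_powr K (1 / real n))"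
    proof
      show "semiprime_closure I \<subseteq> (\<Union>n\<in>{1::nat..}. ideal_powr K (1 / real n))"
        using powrJ JK by blast
      show "(\<Union>n\<in>{1::nat..}. ideal_powr K (1 / real n)) \<subseteq> semiprime_closure I"
        using subK by (intro UN_least) auto
    qed
    show "semiprime_closure I = {x. \<exists>n\<ge>1. npow (star x * x) n \<in> I \<inter> positives}"
      "semiprime_closure I = {x. \<exists>n\<ge>1. npow (x * star x) n \<in> I \<inter> positives}"
      by (rule semiprime_closure_eq[OF I])+
    fix n :: nat assume n: "n \<ge> 1"
    show "alg_ideal (ideal_powr J (1 / real n))" by (rule alg_ideal_ideal_powr[OF dJ n])
    show "ideal_powr J (1 / real n) \<subseteq> ideal_powr J (1 / real (n + 1))"
      by (rule ideal_powr_mono[OF aJ n]) simp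
    \<comment> \<open>Elements of \<open>J^(1/n)\<close> need not be positive, but any element of
      the semiprime closure has a power in \<open>I\<close>, by the existence of prime ideals
      avoiding all powers.\<close>
    show "radical_over (ideal_powr J (1 / real n)) I"
      unfolding radical_over_def using subJ[OF n] npow_in_of_semiprime_closure[OF I] by blast
  qed
qed

end
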